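(* Let $0\le S<T<\infty$ and let $K\in\mathcal K_{\mathbb F}(S,T;\mathbb R^{d\times d})$ be a $\star$-Volterra kernel on $(S,T)$. Suppose that there exist $m\in\mathbb N$ and points $S=U_0<U_1<\cdots<U_m=T$ such that, for every $k\in\{0,1,\dots,m-1\}$, the restricted $\star$-Volterra kernel $K_{(U_k,U_{k+1})}\in\mathcal K_{\mathbb F}(U_k,U_{k+1};\mathbb R^{d\times d})$ has a $\star$-resolvent on $(U_k,U_{k+1})$. Then $K$ has a $\star$-resolvent on $(S,T)$.
   Context: $d\in\mathbb N$ is fixed; $\mathbb N_0=\mathbb N\cup\{0\}$. $(\Omega,\mathcal F,\mathbb P)$ is a complete probability space with a one-dimensional Brownian motion $W$; for $s\le t$, $\mathcal F^s_t$ is the $\mathbb P$-augmentation of the $\sigma$-field generated by $W(r)-W(s)$, $s\le r\le t$. The following is used for every interval $0\le S<T<\infty$. $\Delta_n(S,T)=\{(t_1,\dots,t_n): T>t_1>\cdots>t_n>S\}$. $|A|$ is the Frobenius norm and $|A|_{\mathrm{op}}$ the operator norm. $L^2_{\mathbb F}(S,T;\mathbb R^{d\times d})$ is the space of measurable processes $\xi$ on $(S,T)$ with $\xi(t)$ $\mathcal F^S_t$-measurable and $\mathbb E\int_S^T|\xi(t)|^2dt<\infty$. Put $\mathfrak W_0[f_0](t)=f_0(t)$ and $\mathfrak W_n[f_n](t)=\int_S^t\int_S^{t_1}\cdots\int_S^{t_{n-1}}f_n(t,t_1,\dots,t_n)\,dW(t_n)\cdots dW(t_1)$ for deterministic $f_n\in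 L^2(\Delta_{n+1}(S,T))$; each $\xi\in L^2_{\mathbb F}(S,T)$ is uniquely $\xi=\sum_{n\ge0}\mathfrak W_n[\mathfrak F_n[\xi]]$ with $\mathfrak F_n[\xi]\in L^2(\Delta_{n+1}(S,T))$ (Wiener–Itô chaos expansion). $\mathcal V_{n+1}(S,T;\mathbb R^{d\times d})$ is the set of measurable $k:\Delta_{n+1}(S,T)\to\mathbb R^{d\times d}$ with finite norm $\|k\|_{\mathcal V_1(S,T)}=\operatorname{ess\,sup}_t|k(t)|_{\mathrm{op}}$ (if $n=0$), $\|k\|_{\mathcal V_{n+1}(S,T)}=\operatorname{ess\,sup}_{t\in(S,T)}(\int_{\Delta_n(t,T)}|k(s,t)|_{\mathrm{op}}^2ds)^{1/2}$ (if $n\ge1$). The space of $\star$-Volterra kernels is $\mathcal K_{\mathbb F}(S,T;\mathbb R^{d\times d})=\{K\in L^2_{\mathbb F}(S,T;\mathbb R^{d\times d}):\mathfrak F_n[K]\in\mathcal V_{n+1}(S,T;\mathbb R^{d\times d})\ \forall n\in\mathbb N_0,\ \sum_{n\ge0}\|\mathfrak F_n[K]\|_{\mathcal V_{n+1}(S,T)}<\infty\}$. For $f$ on $\Delta_{m+1}(S,T)$ and $g$ on $\Delta_{n+1}(S,T)$ ($m,n\in\mathbb N_0$), $(f\triangleright g)(t_0,\dots,t_{m+n})=f(t_0,\dots,t_m)g(t_m,\dots,t_{m+n})$. For $K_1,K_2\in\mathcal K_{\mathbb F}(S,T;\mathbb R^{d\times d})$, $K_1\star K_2\in\mathcal K_{\mathbb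 F}(S,T;\mathbb R^{d\times d})$ is defined by $\mathfrak F_n[K_1\star K_2]=\sum_{k=0}^n\mathfrak F_{n-k}[K_1]\triangleright\mathfrak F_k[K_2]$, $n\in\mathbb N_0$. $R\in\mathcal K_{\mathbb F}(S,T;\mathbb R^{d\times d})$ is a $\star$-resolvent of $K\in\mathcal K_{\mathbb F}(S,T;\mathbb R^{d\times d})$ (on $(S,T)$) if $R=K+K\star R=K+R\star K$. For a subinterval $(U,V)\subset(S,T)$, the restricted $\star$-Volterra kernel $K_{(U,V)}\in\mathcal K_{\mathbb F}(U,V;\mathbb R^{d\times d})$ is defined by the chaos expansion (with respect to the interval $(U,V)$) $\mathfrak F_n[K_{(U,V)}]=\mathfrak F_n[K]|_{\Delta_{n+1}(U,V)}$, $n\in\mathbb N_0$. *)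

theory Defs
  imports "HOL-Probability.Probability"
begin

definition brownian_motion :: "'w measure \<Rightarrow> (real \<Rightarrow> 'w \<Rightarrow> real) \<Rightarrow> bool" where
  "brownian_motion M W \<longleftrightarrow>
     (\<forall>t\<ge>0. W t \<in> borel_measurable M) \<and>
     (AE \<omega> in M. W 0 \<omega> = 0) \<and>
     (AE \<omega> in M. continuous_on {0..} (\<lambda>t. W t \<omega>)) \<and>
     (\<forall>s t. 0 \<le> s \<and> s < t \<longrightarrow>
        distributed M lborel (\<lambda>\<omega>. W t \<omega> - W s \<omega>) (normal_density 0 (sqrt (t - s)))) \<and>
     (\<forall>n (t :: nat \<Rightarrow> real). 0 \<le> t 0 \<and> (\<forall>i<n. t i < t (Suc i)) \<longrightarrow>
        prob_space.indep_vars M (\<lambda>_. borel) (\<lambda>i \<omega>. W (t (Suc i)) \<omega> - W (t i) \<omega>) {..<n})"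

definition increment_filtration ::
    "'w measure \<Rightarrow> (real \<Rightarrow> 'w \<Rightarrow> real) \<Rightarrow> real \<Rightarrow> real \<Rightarrow> 'w measure" where
  "increment_filtration M W s t =
     sigma (space M)
       ({(\<lambda>\<omega>. W r \<omega> - W s \<omega>) -` A \<inter> space M | r A. s \<le> r \<and> r \<le> t \<and> A \<in> sets borel} \<union> null_sets M)"

definition time_interval :: "real \<Rightarrow> real \<Rightarrow> real measure" where
  "time_interval S T = restrict_space lborel {S<..<T}"

text \<open>
  The space of square-integrable adapted processes on the open interval. Elements are
  representatives; equality in this space is equality almost everywhere with respect to
  \<^term>\<open>time_interval S T \<Otimes>\<^sub>M M\<close>. On matrices \<^typ>\<open>real^'n^'n\<close>
  the library norm is the Frobenius norm.
\<close>

definition L2_adapted ::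
    "'w measure \<Rightarrow> (real \<Rightarrow> 'w \<Rightarrow> real) \<Rightarrow> real \<Rightarrow> real \<Rightarrow> (real \<Rightarrow> 'w \<Rightarrow> 'a::euclidean_space) set" where
  "L2_adapted M W S T = {\<xi>.
     case_prod \<xi> \<in> borel_measurable (time_interval S T \<Otimes>\<^sub>M M) \<and>
     (\<forall>t\<in>{S<..<T}. \<xi> t \<in> borel_measurable (increment_filtration M W S t)) \<and>
     (\<integral>\<^sup>+ (t, \<omega>). ennreal ((norm (\<xi> t \<omega>))\<^sup>2) \<partial>(time_interval S T \<Otimes>\<^sub>M M)) < \<infinity>}"

definition ae_equal ::
    "'w measure \<Rightarrow> real \<Rightarrow> real \<Rightarrow> (real \<Rightarrow> 'w \<Rightarrow> 'a) \<Rightarrow> (real \<Rightarrow> 'w \<Rightarrow> 'a) \<Rightarrow> bool" where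
  "ae_equal M S T \<xi> \<eta> \<longleftrightarrow> (AE (t, \<omega>) in time_interval S T \<Otimes>\<^sub>M M. \<xi> t \<omega> = \<eta> t \<omega>)"

text \<open>
  A simple process on \<open>(a, b)\<close> with nodes \<open>a = s 0 \<le> \<dots> \<le> s m = b\<close>
  takes the value \<open>z i\<close> on \<open>(s i, s (i + 1)]\<close>.
\<close>

definition simple_data ::
    "'w measure \<Rightarrow> (real \<Rightarrow> 'w \<Rightarrow> real) \<Rightarrow> real \<Rightarrow> real \<Rightarrow>
     nat \<Rightarrow> (nat \<Rightarrow> real) \<Rightarrow> (nat \<Rightarrow> 'w \<Rightarrow> 'a::euclidean_space) \<Rightarrow> bool" where
  "simple_data M W a b m s z \<longleftrightarrow>
     s 0 = a \<and> s m = b \<and> (\<forall>i<m. s i \<le> s (Suc i)) \<and>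
     (\<forall>i<m. z i \<in> borel_measurable (increment_filtration M W a (s i)) \<and>
            integrable M (\<lambda>\<omega>. (norm (z i \<omega>))\<^sup>2))"

definition simple_value ::
    "nat \<Rightarrow> (nat \<Rightarrow> real) \<Rightarrow> (nat \<Rightarrow> 'w \<Rightarrow> 'a::euclidean_space) \<Rightarrow> real \<Rightarrow> 'w \<Rightarrow> 'a" where
  "simple_value m s z r \<omega> = (\<Sum>i<m. indicator {s i<..s (Suc i)} r *\<^sub>R z i \<omega>)"

definition simple_integral ::
    "(real \<Rightarrow> 'w \<Rightarrow> real) \<Rightarrow> nat \<Rightarrow> (nat \<Rightarrow> real) \<Rightarrow> (nat \<Rightarrow> 'w \<Rightarrow> 'a::euclidean_space) \<Rightarrow> 'w \<Rightarrow> 'a" where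
  "simple_integral W m s z \<omega> = (\<Sum>i<m. (W (s (Suc i)) \<omega> - W (s i) \<omega>) *\<^sub>R z i \<omega>)"

text \<open>
  \<open>has_ito_integral M W a b \<phi> X\<close>: the random variable \<open>X\<close> is (a version of)
  \<open>\<integral>\<^sub>a\<^sup>b \<phi> dW\<close>, i.e. the mean-square limit of the integrals of simple
  processes converging to \<open>\<phi>\<close> in \<open>L\<^sup>2\<close>.
\<close>

definition has_ito_integral ::
    "'w measure \<Rightarrow> (real \<Rightarrow> 'w \<Rightarrow> real) \<Rightarrow> real \<Rightarrow> real \<Rightarrow>
     (real \<Rightarrow> 'w \<Rightarrow> 'a::euclidean_space) \<Rightarrow> ('w \<Rightarrow> 'a) \<Rightarrow> bool" where
  "has_ito_integral M W a b \<phi> X \<longleftrightarrow>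
     \<phi> \<in> L2_adapted M W a b \<and> X \<in> borel_measurable M \<and>
     (\<exists>m s z.
        (\<forall>j. simple_data M W a b (m j) (s j) (z j)) \<and>
        (\<lambda>j. \<integral>\<^sup>+ (r, \<omega>). ennreal ((norm (simple_value (m j) (s j) (z j) r \<omega> - \<phi> r \<omega>))\<^sup>2)
               \<partial>(time_interval a b \<Otimes>\<^sub>M M)) \<longlonglongrightarrow> 0 \<and>
        (\<lambda>j. \<integral>\<^sup>+ \<omega>. ennreal ((norm (simple_integral W (m j) (s j) (z j) \<omega> - X \<omega>))\<^sup>2) \<partial>M) \<longlonglongrightarrow> 0)"

text \<open>
  Points of \<open>\<Delta>\<^sub>n(S,T)\<close> are indexed by \<open>0, \<dots>, n - 1\<close> in decreasing order of time.
\<close>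

definition simplex_pts :: "nat \<Rightarrow> real \<Rightarrow> real \<Rightarrow> (nat \<Rightarrow> real) set" where
  "simplex_pts n S T =
     {t \<in> {..<n} \<rightarrow>\<^sub>E UNIV. (\<forall>i<n. S < t i \<and> t i < T) \<and> (\<forall>i j. i < j \<and> j < n \<longrightarrow> t j < t i)}"

definition simplex_measure :: "nat \<Rightarrow> real \<Rightarrow> real \<Rightarrow> (nat \<Rightarrow> real) measure" where
  "simplex_measure n S T = restrict_space (\<Pi>\<^sub>M i\<in>{..<n}. lborel) (simplex_pts n S T)"

definition L2_simplex :: "nat \<Rightarrow> real \<Rightarrow> real \<Rightarrow> ((nat \<Rightarrow> real) \<Rightarrow> 'a::euclidean_space) set" where
  "L2_simplex n S T = {f. f \<in> borel_measurable (simplex_measure n S T) \<and>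
     (\<integral>\<^sup>+ t. ennreal ((norm (f t))\<^sup>2) \<partial>simplex_measure n S T) < \<infinity>}"

definition cons_pt :: "nat \<Rightarrow> real \<Rightarrow> (nat \<Rightarrow> real) \<Rightarrow> nat \<Rightarrow> real" where
  "cons_pt n t s = (\<lambda>i\<in>{..<Suc n}. case i of 0 \<Rightarrow> t | Suc j \<Rightarrow> s j)"

definition snoc_pt :: "nat \<Rightarrow> (nat \<Rightarrow> real) \<Rightarrow> real \<Rightarrow> nat \<Rightarrow> real" where
  "snoc_pt n s t = (\<lambda>i\<in>{..<Suc n}. if i < n then s i else t)"

text \<open>
  \<open>has_iterated_integral M W S n t g X\<close>: \<open>X\<close> is a version of
  \<open>\<integral> \<dots> \<integral> g(t\<^sub>1, \<dots>, t\<^sub>n) dW(t\<^sub>n) \<dots> dW(t\<^sub>1)\<close>, iterated over \<open>S < t\<^sub>n < \<dots> < t\<^sub>1 < t\<close>.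
  The process \<open>Y\<close> is a measurable adapted version of the inner integral as a function of \<open>t\<^sub>1\<close>;
  for \<open>n = 0\<close>, \<open>\<lambda>_. undefined\<close> is the empty tuple.
\<close>

primrec has_iterated_integral ::
    "'w measure \<Rightarrow> (real \<Rightarrow> 'w \<Rightarrow> real) \<Rightarrow> real \<Rightarrow>
     nat \<Rightarrow> real \<Rightarrow> ((nat \<Rightarrow> real) \<Rightarrow> 'a::euclidean_space) \<Rightarrow> ('w \<Rightarrow> 'a) \<Rightarrow> bool" where
  "has_iterated_integral M W S 0 t g X \<longleftrightarrow>
     X \<in> borel_measurable M \<and> (AE \<omega> in M. X \<omega> = g (\<lambda>_. undefined))"
| "has_iterated_integral M W S (Suc n) t g X \<longleftrightarrow>
     (\<exists>Y. (AE t1 in time_interval S t.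
             has_iterated_integral M W S n t1 (\<lambda>s. g (cons_pt n t1 s)) (Y t1)) \<and>
          has_ito_integral M W S t Y X)"

text \<open>
  \<open>\<WW>\<^sub>n[f]\<close> for \<open>f \<in> L\<^sup>2(\<Delta>\<^sub>n\<^sub>+\<^sub>1(S,T))\<close>, as an adapted process, determined up to
  almost-everywhere equality.
\<close>

definition wiener_process ::
    "'w measure \<Rightarrow> (real \<Rightarrow> 'w \<Rightarrow> real) \<Rightarrow> real \<Rightarrow> real \<Rightarrow>
     nat \<Rightarrow> ((nat \<Rightarrow> real) \<Rightarrow> 'a::euclidean_space) \<Rightarrow> real \<Rightarrow> 'w \<Rightarrow> 'a" where
  "wiener_process M W S T n f =
     (SOME X. X \<in> L2_adapted M W S T \<and>
        (AE t in time_interval S T. has_iterated_integral M W S n t (\<lambda>s. f (cons_pt n t s)) (X t)))"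

definition has_chaos_expansion ::
    "'w measure \<Rightarrow> (real \<Rightarrow> 'w \<Rightarrow> real) \<Rightarrow> real \<Rightarrow> real \<Rightarrow>
     (real \<Rightarrow> 'w \<Rightarrow> 'a::euclidean_space) \<Rightarrow> (nat \<Rightarrow> (nat \<Rightarrow> real) \<Rightarrow> 'a) \<Rightarrow> bool" where
  "has_chaos_expansion M W S T \<xi> f \<longleftrightarrow>
     \<xi> \<in> L2_adapted M W S T \<and> (\<forall>n. f n \<in> L2_simplex (Suc n) S T) \<and>
     (\<lambda>N. \<integral>\<^sup>+ (t, \<omega>). ennreal ((norm (\<xi> t \<omega> - (\<Sum>n<N. wiener_process M W S T n (f n) t \<omega>)))\<^sup>2)
            \<partial>(time_interval S T \<Otimes>\<^sub>M M)) \<longlonglongrightarrow> 0"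

definition chaos_coeff ::
    "'w measure \<Rightarrow> (real \<Rightarrow> 'w \<Rightarrow> real) \<Rightarrow> real \<Rightarrow> real \<Rightarrow>
     (real \<Rightarrow> 'w \<Rightarrow> 'a::euclidean_space) \<Rightarrow> nat \<Rightarrow> (nat \<Rightarrow> real) \<Rightarrow> 'a" where
  "chaos_coeff M W S T \<xi> = (SOME f. has_chaos_expansion M W S T \<xi> f)"

definition from_chaos ::
    "'w measure \<Rightarrow> (real \<Rightarrow> 'w \<Rightarrow> real) \<Rightarrow> real \<Rightarrow> real \<Rightarrow>
     (nat \<Rightarrow> (nat \<Rightarrow> real) \<Rightarrow> 'a::euclidean_space) \<Rightarrow> real \<Rightarrow> 'w \<Rightarrow> 'a" where
  "from_chaos M W S T f = (SOME \<xi>. has_chaos_expansion M W S T \<xi> f)"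

definition op_norm :: "real^'d^'d \<Rightarrow> real" where
  "op_norm A = onorm ((*v) A)"

definition ennreal_sqrt :: "ennreal \<Rightarrow> ennreal" where
  "ennreal_sqrt x = (if x = \<infinity> then \<infinity> else ennreal (sqrt (enn2real x)))"

text \<open>
  \<open>volterra_norm S T n\<close> is the norm of \<open>\<V>\<^sub>n\<^sub>+\<^sub>1(S,T)\<close>; the essential supremum is
  over the last (smallest) time variable.
\<close>

definition volterra_norm :: "real \<Rightarrow> real \<Rightarrow> nat \<Rightarrow> ((nat \<Rightarrow> real) \<Rightarrow> real^'d^'d) \<Rightarrow> ennreal" where
  "volterra_norm S T n k =
     (if n = 0
      then esssup (time_interval S T) (\<lambda>t. ennreal (op_norm (k (snoc_pt 0 (\<lambda>_. undefined) t))))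
      else esssup (time_interval S T) (\<lambda>t. ennreal_sqrt
             (\<integral>\<^sup>+ s. ennreal ((op_norm (k (snoc_pt n s t)))\<^sup>2) \<partial>simplex_measure n t T)))"

definition volterra_space :: "real \<Rightarrow> real \<Rightarrow> nat \<Rightarrow> ((nat \<Rightarrow> real) \<Rightarrow> real^'d^'d) set" where
  "volterra_space S T n =
     {k. k \<in> borel_measurable (simplex_measure (Suc n) S T) \<and> volterra_norm S T n k < \<infinity>}"

text \<open>
  By the Wiener--Ito theorem every process in \<^const>\<open>L2_adapted\<close> has a chaos expansion, so
  the second condition below only records that \<^const>\<open>chaos_coeff\<close> is meaningful.
\<close>

definition star_kernels ::
    "'w measure \<Rightarrow> (real \<Rightarrow> 'w \<Rightarrow> real) \<Rightarrow> real \<Rightarrow> real \<Rightarrow> (real \<Rightarrow> 'w \<Rightarrow> real^'d^'d) set" where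
  "star_kernels M W S T = {K.
     K \<in> L2_adapted M W S T \<and>
     has_chaos_expansion M W S T K (chaos_coeff M W S T K) \<and>
     (\<forall>n. chaos_coeff M W S T K n \<in> volterra_space S T n) \<and>
     (\<Sum>n. volterra_norm S T n (chaos_coeff M W S T K n)) < \<infinity>}"

definition tri_prod ::
    "nat \<Rightarrow> nat \<Rightarrow> ((nat \<Rightarrow> real) \<Rightarrow> real^'d^'d) \<Rightarrow> ((nat \<Rightarrow> real) \<Rightarrow> real^'d^'d) \<Rightarrow>
     (nat \<Rightarrow> real) \<Rightarrow> real^'d^'d" where
  "tri_prod m n f g t = f (\<lambda>i\<in>{..m}. t i) ** g (\<lambda>i\<in>{..n}. t (m + i))"

definition star ::
    "'w measure \<Rightarrow> (real \<Rightarrow> 'w \<Rightarrow> real) \<Rightarrow> real \<Rightarrow> real \<Rightarrow>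
     (real \<Rightarrow> 'w \<Rightarrow> real^'d^'d) \<Rightarrow> (real \<Rightarrow> 'w \<Rightarrow> real^'d^'d) \<Rightarrow> real \<Rightarrow> 'w \<Rightarrow> real^'d^'d" where
  "star M W S T K1 K2 = from_chaos M W S T
     (\<lambda>n t. \<Sum>k\<le>n. tri_prod (n - k) k (chaos_coeff M W S T K1 (n - k)) (chaos_coeff M W S T K2 k) t)"

definition is_star_resolvent ::
    "'w measure \<Rightarrow> (real \<Rightarrow> 'w \<Rightarrow> real) \<Rightarrow> real \<Rightarrow> real \<Rightarrow>
     (real \<Rightarrow> 'w \<Rightarrow> real^'d^'d) \<Rightarrow> (real \<Rightarrow> 'w \<Rightarrow> real^'d^'d) \<Rightarrow> bool" where
  "is_star_resolvent M W S T K R \<longleftrightarrow>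
     R \<in> star_kernels M W S T \<and>
     ae_equal M S T R (\<lambda>t \<omega>. K t \<omega> + star M W S T K R t \<omega>) \<and>
     ae_equal M S T R (\<lambda>t \<omega>. K t \<omega> + star M W S T R K t \<omega>)"

definition restrict_kernel ::
    "'w measure \<Rightarrow> (real \<Rightarrow> 'w \<Rightarrow> real) \<Rightarrow> real \<Rightarrow> real \<Rightarrow> real \<Rightarrow> real \<Rightarrow>
     (real \<Rightarrow> 'w \<Rightarrow> real^'d^'d) \<Rightarrow> real \<Rightarrow> 'w \<Rightarrow> real^'d^'d" where
  "restrict_kernel M W S T U V K = from_chaos M W U V
     (\<lambda>n. restrict (chaos_coeff M W S T K n) (simplex_pts (Suc n) U V))"

end

(* By the chaos expansion the statement concerns coefficient families only, that is, the
   convolution algebra of families f_n on the simplices. Splitting (S,T) at a point U, the kernel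
   becomes block triangular: the diagonal blocks live on (S,U) and (U,T), and the off-diagonal block
   c consists of the points with t_0 >= U > t_n; the only products that survive are a a, d d, c a
   and d c. If p and q are the resolvents of the diagonal blocks a and d, then
   p + q + (1 + q) c (1 + p) is a resolvent of a + c + d, and induction on the number of pieces
   gives the theorem.

   To pass between kernels and coefficient families one needs existence, uniqueness and
   orthogonality of iterated Ito integrals. Existence follows from closedness: the families that
   have an iterated integral form a subspace closed under L^2 limits (by the isometry), and it
   contains the indicators of products of ordered intervals, whose integrals are products of
   increments; such products generate the Borel sets of the simplex. *)

theory Submission
  imports Defs
begin

section \<open>Square-integrable functions\<close>

text \<open>Coefficients are determined only almost everywhere, yet a product evaluates both factors
  at a shared time, so it must be shown that null sets do no harm and that products stay in the
  space. One estimate gives both: the shared time is the last time of the left factor, and the norm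
  takes an essential supremum in exactly that variable. The formula for the resolvent is block
  inversion. If \<open>1 + r\<close> is the inverse of \<open>1 - k\<close> and \<open>k\<close> is
  block triangular, the off-diagonal block of that inverse is
  \<open>(1 - d)^-1 c (1 - a)^-1\<close>, which is \<open>(1 + q) c (1 + p)\<close>. As
  \<open>c\<close> enters linearly, gluing needs no series and no smallness. Wiener processes,
  coefficients and processes with prescribed coefficients are all defined by Hilbert choice. Hence
  equations between them hold only up to null sets and have to be recovered from existence together
  with the isometry.\<close>

definition sqn :: "'a measure \<Rightarrow> ('a \<Rightarrow> 'b::real_normed_vector) \<Rightarrow> ennreal" where
  "sqn M f = (\<integral>\<^sup>+ x. ennreal ((norm (f x))\<^sup>2) \<partial>M)"

lemma sqn_cong_AE: "AE x in M. f x = g x \<Longrightarrow> sqn M f = sqn M g"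
  unfolding sqn_def by (rule nn_integral_cong_AE) auto

lemma sqn_minus: "sqn M (\<lambda>x. - f x) = sqn M f"
  by (simp add: sqn_def)

lemma sqn_commute: "sqn M (\<lambda>x. f x - g x) = sqn M (\<lambda>x. g x - f x)"
  by (simp add: sqn_def norm_minus_commute)

lemma sqn_scaleR: 
  fixes f :: "'a \<Rightarrow> 'b::euclidean_space"
  assumes [measurable]: "f \<in> borel_measurable M"
  shows "sqn M (\<lambda>x. c *\<^sub>R f x) = ennreal (c\<^sup>2) * sqn M f"
  unfolding sqn_def
  by (subst nn_integral_cmult[symmetric]) (auto simp: power_mult_distrib ennreal_mult)

text \<open>If \<open>c < x\<close>, there is a finite \<open>d\<close> with
  \<open>c < d \<le> x\<close>, and its square exceeds that of \<open>c\<close>. Passing through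
  \<open>d\<close> covers an infinite \<open>x\<close> as well.\<close>

lemma ennreal_le_of_power2_le:
  assumes "x\<^sup>2 \<le> (ennreal c)\<^sup>2" "c \<ge> 0"
  shows "x \<le> ennreal c"
proof (rule ccontr)
  assume "\<not> x \<le> ennreal c"
  then obtain d where d: "ennreal c < ennreal d" "ennreal d \<le> x" "d \<ge> 0"
    by (metis dense ennreal_cases less_imp_le not_le less_top order_less_le_trans top_greatest)
  then have "c < d" using assms(2) by (simp add: ennreal_less_iff)
  have "ennreal d * ennreal d \<le> x * x" using d by (intro mult_mono) auto
  also have "\<dots> \<le> ennreal c * ennreal c" using assms(1) by (simp add: power2_eq_square)
  finally have "d * d \<le> c * c"
    using assms(2) d(3) by (simp add: ennreal_mult[symmetric] ennreal_le_iff)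
  with \<open>c < d\<close> assms(2) show False
    by (meson mult_strict_mono' not_le)
qed

text \<open>Cauchy-Schwarz bounds the cross term by \<open>a * b\<close>. The radii are reals that
  merely dominate the norms, so no square root in \<open>ennreal\<close> is taken. The sharp
  constant matters where norms have to converge and where the majorants of a convolution are
  added.\<close>

lemma sqn_Minkowski:
  fixes f g :: "'a \<Rightarrow> 'b::euclidean_space"
  assumes [measurable]: "f \<in> borel_measurable M" "g \<in> borel_measurable M"
    and a: "sqn M f \<le> ennreal (a\<^sup>2)" "sqn M g \<le> ennreal (b\<^sup>2)" "a \<ge> 0" "b \<ge> 0"
  shows "sqn M (\<lambda>x. f x + g x) \<le> ennreal ((a + b)\<^sup>2)"
proof -
  have CS: "(\<integral>\<^sup>+ x. ennreal (norm (f x)) * ennreal (norm (g x)) \<partial>M)\<^sup>2 \<le> sqn M f * sqn M g"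
    unfolding sqn_def ennreal_power[symmetric, OF norm_ge_zero]
    by (rule Cauchy_Schwarz_nn_integral) auto
  let ?I = "\<integral>\<^sup>+ x. ennreal (norm (f x)) * ennreal (norm (g x)) \<partial>M"
  have "?I\<^sup>2 \<le> ennreal (a\<^sup>2) * ennreal (b\<^sup>2)"
    using CS a by (meson mult_mono order_trans zero_le)
  also have "\<dots> = (ennreal (a * b))\<^sup>2"
    using a by (simp add: ennreal_power ennreal_mult[symmetric] power_mult_distrib)
  finally have "?I\<^sup>2 \<le> (ennreal (a * b))\<^sup>2" .
  then have I: "?I \<le> ennreal (a * b)"
    by (rule ennreal_le_of_power2_le) (use a(3,4) in simp)
  have "sqn M (\<lambda>x. f x + g x) \<le> (\<integral>\<^sup>+ x. ennreal ((norm (f x))\<^sup>2) + (ennreal ((norm (g x))\<^sup>2)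
      + 2 * (ennreal (norm (f x)) * ennreal (norm (g x)))) \<partial>M)"
    unfolding sqn_def
  proof (rule nn_integral_mono)
    fix x
    have "(norm (f x + g x))\<^sup>2 \<le> (norm (f x) + norm (g x))\<^sup>2"
      by (intro power_mono norm_triangle_ineq) auto
    then have "ennreal ((norm (f x + g x))\<^sup>2) \<le> ennreal ((norm (f x))\<^sup>2 + ((norm (g x))\<^sup>2 + 2 *
      (norm (f x) * norm (g x))))"
      by (intro ennreal_leI) (simp add: power2_sum)
    then show "ennreal ((norm (f x + g x))\<^sup>2) \<le> ennreal ((norm (f x))\<^sup>2) + (ennreal ((norm (g x))\<^sup>2)
      + 2 * (ennreal (norm (f x)) * ennreal (norm (g x))))"
      by (simp add: ennreal_plus ennreal_mult)
  qed
  also have "\<dots> = sqn M f + (sqn M g + 2 * ?I)"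
    unfolding sqn_def
    by (simp add: nn_integral_add nn_integral_cmult)
  also have "\<dots> \<le> ennreal (a\<^sup>2) + (ennreal (b\<^sup>2) + 2 * ennreal (a * b))"
    using a I by (intro add_mono mult_left_mono) auto
  also have "\<dots> = ennreal (a\<^sup>2) + (ennreal (b\<^sup>2) + ennreal 2 * ennreal (a * b))"
    by simp
  also have "\<dots> = ennreal (a\<^sup>2 + (b\<^sup>2 + 2 * (a * b)))"
    using a by (simp add: ennreal_mult ennreal_plus del: ennreal_numeral)
  also have "\<dots> = ennreal ((a + b)\<^sup>2)"
    by (simp add: power2_sum algebra_simps)
  finally show ?thesis .
qed

text \<open>The crude form with factors 2 has no finiteness condition and suffices whenever only
  finiteness or convergence to zero is at stake.\<close>

lemma sqn_add_le:
  fixes f g :: "'a \<Rightarrow> 'b::euclidean_space"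
  assumes [measurable]: "f \<in> borel_measurable M" "g \<in> borel_measurable M"
  shows "sqn M (\<lambda>x. f x + g x) \<le> 2 * sqn M f + 2 * sqn M g"
proof -
  have "sqn M (\<lambda>x. f x + g x) \<le> (\<integral>\<^sup>+ x. 2 * ennreal ((norm (f x))\<^sup>2) + 2 * ennreal ((norm (g x))\<^sup>2) \<partial>M)"
    unfolding sqn_def
  proof (rule nn_integral_mono)
    fix x
    have "(norm (f x + g x))\<^sup>2 \<le> (norm (f x) + norm (g x))\<^sup>2"
      by (intro power_mono norm_triangle_ineq) auto
    also have "\<dots> \<le> 2 * (norm (f x))\<^sup>2 + 2 * (norm (g x))\<^sup>2"
      using sum_squares_bound[of "norm (f x)" "norm (g x)"] by (simp add: power2_sum)
    finally have "ennreal ((norm (f x + g x))\<^sup>2) \<le> ennreal (2 * (norm (f x))\<^sup>2 + 2 * (norm (g x))\<^sup>2)"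
      by (intro ennreal_leI)
    then show "ennreal ((norm (f x + g x))\<^sup>2) \<le> 2 * ennreal ((norm (f x))\<^sup>2) + 2 * ennreal ((norm (g x))\<^sup>2)"
      by (simp add: ennreal_plus ennreal_mult)
  qed
  also have "\<dots> = 2 * sqn M f + 2 * sqn M g"
    unfolding sqn_def by (simp add: nn_integral_add nn_integral_cmult)
  finally show ?thesis .
qed

lemma sqn_diff_le:
  fixes f g h :: "'a \<Rightarrow> 'b::euclidean_space"
  assumes [measurable]: "f \<in> borel_measurable M" "g \<in> borel_measurable M" "h \<in> borel_measurable M"
  shows "sqn M (\<lambda>x. f x - h x) \<le> 2 * sqn M (\<lambda>x. f x - g x) + 2 * sqn M (\<lambda>x. g x - h x)"
  using sqn_add_le[of "\<lambda>x. f x - g x" M "\<lambda>x. g x - h x"] by simp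

lemma sqn_eq_0_iff:
  fixes f :: "'a \<Rightarrow> 'b::euclidean_space"
  assumes [measurable]: "f \<in> borel_measurable M"
  shows "sqn M f = 0 \<longleftrightarrow> (AE x in M. f x = 0)"
  unfolding sqn_def by (subst nn_integral_0_iff_AE) (auto simp: ennreal_eq_0_iff)

section \<open>Limits and completeness in mean square\<close>

lemma tendsto_ennreal_0_enn2real:
  fixes x :: "nat \<Rightarrow> ennreal"
  assumes "x \<longlonglongrightarrow> 0" shows "(\<lambda>j. enn2real (x j)) \<longlonglongrightarrow> 0"
  using tendsto_enn2real[of x 0] assms by simp

text \<open>The triangle inequality in both directions squeezes \<open>sqn M (f j)\<close> between
  squares of two radii that tend to the norm \<open>b\<close> of the limit.\<close>

lemma sqn_tendsto:
  fixes f :: "nat \<Rightarrow> 'a \<Rightarrow> 'b::euclidean_space"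
  assumes [measurable]: "\<And>j. f j \<in> borel_measurable M" "g \<in> borel_measurable M"
    and fin: "sqn M g < \<infinity>"
    and lim: "(\<lambda>j. sqn M (\<lambda>x. f j x - g x)) \<longlonglongrightarrow> 0"
  shows "(\<lambda>j. sqn M (f j)) \<longlonglongrightarrow> sqn M g"
proof -
  define b where "b = sqrt (enn2real (sqn M g))"
  define d where "d = (\<lambda>j. sqrt (enn2real (sqn M (\<lambda>x. f j x - g x))))"
  have d0: "d \<longlonglongrightarrow> 0"
    using tendsto_real_sqrt[OF tendsto_ennreal_0_enn2real[OF lim]] by (simp add: d_def)
  have b: "sqn M g = ennreal (b\<^sup>2)" "b \<ge> 0" "\<And>j. d j \<ge> 0"
    using fin by (auto simp: b_def d_def less_top[symmetric])
  have fl: "\<forall>\<^sub>F j in sequentially. sqn M (\<lambda>x. f j x - g x) < \<infinity>"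
    using lim by (rule order_tendstoD) simp
  \<comment> \<open>The lower radius is cut off at 0 because \<open>b - d j\<close> may be negative
    and squaring is monotone only on nonnegative numbers.\<close>
  then have ev: "\<forall>\<^sub>F j in sequentially. sqn M (f j) \<le> ennreal ((d j + b)\<^sup>2) \<and> ennreal ((max 0 (b - d
    j))\<^sup>2) \<le> sqn M (f j)"
  proof eventually_elim
    case (elim j)
    have d: "sqn M (\<lambda>x. f j x - g x) = ennreal ((d j)\<^sup>2)"
      using elim by (simp add: d_def less_top[symmetric])
    have up: "sqn M (f j) \<le> ennreal ((d j + b)\<^sup>2)"
      using sqn_Minkowski[of "\<lambda>x. f j x - g x" M g "d j" b] b d by simp
    then have "sqn M (f j) < \<infinity>" using le_less_trans by fastforce
    then have e: "sqn M (f j) = ennreal ((sqrt (enn2real (sqn M (f j))))\<^sup>2)"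
      by (simp add: less_top[symmetric])
    define e where "e = sqrt (enn2real (sqn M (f j)))"
    have "sqn M g \<le> ennreal ((d j + e)\<^sup>2)"
      using sqn_Minkowski[of "\<lambda>x. g x - f j x" M "f j" "d j" e] b d e sqn_commute[of M g "f j"]
      by (simp add: e_def)
    then have "b\<^sup>2 \<le> (d j + e)\<^sup>2" using b by (simp add: ennreal_le_iff)
    then have "b \<le> d j + e" using b e_def by (meson add_nonneg_nonneg enn2real_nonneg
      power2_le_imp_le real_sqrt_ge_zero)
    then have "max 0 (b - d j) \<le> e" by (simp add: e_def)
    then have "(max 0 (b - d j))\<^sup>2 \<le> e\<^sup>2" by (intro power_mono) auto
    then show ?case using up e by (metis e_def ennreal_leI)
  qed
  have "(\<lambda>j. ennreal ((d j + b)\<^sup>2)) \<longlonglongrightarrow> ennreal ((0 + b)\<^sup>2)"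
    by (intro tendsto_ennrealI tendsto_intros d0)
  moreover have "(\<lambda>j. ennreal ((max 0 (b - d j))\<^sup>2)) \<longlonglongrightarrow> ennreal ((max 0 (b - 0))\<^sup>2)"
    by (intro tendsto_ennrealI tendsto_intros d0)
  moreover have "max 0 (b - 0) = b" "0 + b = b" using b(2) by auto
  ultimately have lims: "(\<lambda>j. ennreal ((max 0 (b - d j))\<^sup>2)) \<longlonglongrightarrow> ennreal (b\<^sup>2)"
      "(\<lambda>j. ennreal ((d j + b)\<^sup>2)) \<longlonglongrightarrow> ennreal (b\<^sup>2)" by simp_all
  have "(\<lambda>j. sqn M (f j)) \<longlonglongrightarrow> ennreal (b\<^sup>2)"
    by (rule tendsto_sandwich[OF _ _ lims]; rule eventually_mono[OF ev]) blast+
  then show ?thesis using b(1) by simp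
qed

text \<open>Along a subsequence the integrals are below \<open>(1/2)^i\<close>. Then the sum of the
  functions has a finite integral, is finite almost everywhere, and its terms tend to 0
  there.\<close>

lemma nn_integral_tendsto_0_AE_subseq:
  fixes h :: "nat \<Rightarrow> 'a \<Rightarrow> ennreal"
  assumes [measurable]: "\<And>j. h j \<in> borel_measurable M"
    and lim: "(\<lambda>j. \<integral>\<^sup>+ x. h j x \<partial>M) \<longlonglongrightarrow> 0"
  obtains r :: "nat \<Rightarrow> nat" where "strict_mono r" "AE x in M. (\<lambda>j. h (r j) x) \<longlonglongrightarrow> 0"
proof -
  have "\<forall>\<^sub>F j in sequentially. (\<integral>\<^sup>+ x. h j x \<partial>M) < ennreal ((1/2)^i)" for i
    using lim by (rule order_tendstoD) simp
  then have ex: "\<exists>N. \<forall>j\<ge>N. (\<integral>\<^sup>+ x. h j x \<partial>M) < ennreal ((1/2)^i)" for i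
    by (simp add: eventually_sequentially)
  have "\<exists>r::nat\<Rightarrow>nat. \<forall>i. (\<integral>\<^sup>+ x. h (r i) x \<partial>M) < ennreal ((1/2)^i) \<and> r i < r (Suc i)"
  proof (rule dependent_nat_choice)
    show "\<exists>x. (\<integral>\<^sup>+ y. h x y \<partial>M) < ennreal ((1/2)^0)" using ex[of 0] by auto
    fix x n assume "(\<integral>\<^sup>+ y. h x y \<partial>M) < ennreal ((1/2)^n)"
    obtain N where "\<forall>j\<ge>N. (\<integral>\<^sup>+ x. h j x \<partial>M) < ennreal ((1/2)^Suc n)" using ex by blast
    then show "\<exists>y. (\<integral>\<^sup>+ x. h y x \<partial>M) < ennreal ((1/2)^Suc n) \<and> x < y"
      by (intro exI[of _ "max N (Suc x)"]) auto
  qed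
  then obtain r where r: "\<And>i. (\<integral>\<^sup>+ x. h (r i) x \<partial>M) < ennreal ((1/2)^i)" "\<And>i. r i < r (Suc i)" by blast
  have "(\<integral>\<^sup>+ x. (\<Sum>i. h (r i) x) \<partial>M) = (\<Sum>i. \<integral>\<^sup>+ x. h (r i) x \<partial>M)"
    by (rule nn_integral_suminf) simp
  also have "\<dots> \<le> (\<Sum>i. ennreal ((1/2)^i))"
    using r by (intro suminf_le) (auto intro: less_imp_le)
  also have "\<dots> < \<infinity>"
    by (subst suminf_ennreal_eq[of _ 2]) (use geometric_sums[of "1/2::real"] in auto)
  finally have "AE x in M. (\<Sum>i. h (r i) x) \<noteq> \<infinity>"
    by (intro nn_integral_noteq_infinite) auto
  then have "AE x in M. (\<lambda>j. h (r j) x) \<longlonglongrightarrow> 0"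
  proof eventually_elim
    case (elim x)
    then have fin: "\<And>i. h (r i) x \<noteq> \<infinity>"
      using sum_le_suminf[of "\<lambda>i. h (r i) x" "{i}" for i] by simp (metis top_unique)
    then have "summable (\<lambda>i. enn2real (h (r i) x))"
      using elim by (intro summable_suminf_not_top) (auto simp: less_top[symmetric])
    then have "(\<lambda>i. ennreal (enn2real (h (r i) x))) \<longlonglongrightarrow> ennreal 0"
      by (intro tendsto_ennrealI summable_LIMSEQ_zero)
    then show ?case using fin by (simp add: less_top[symmetric])
  qed
  then show ?thesis using that[of r] r(2) by (auto simp: strict_mono_Suc_iff)
qed

text \<open>Weighting the squared increments by \<open>2^j\<close> against the bound
  \<open>(1/4)^j\<close> still leaves a convergent series. Its sum \<open>C\<close> is finite almost
  everywhere, so the increments at \<open>x\<close> are at most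
  \<open>sqrt C * (1 / sqrt 2)^j\<close>, a geometric bound.\<close>

lemma fast_convergent_AE:
  fixes f :: "nat \<Rightarrow> 'a \<Rightarrow> 'b::euclidean_space"
  assumes [measurable]: "\<And>j. f j \<in> borel_measurable M"
    and fast: "\<And>j. sqn M (\<lambda>x. f (Suc j) x - f j x) \<le> ennreal ((1/4)^j)"
  shows "AE x in M. convergent (\<lambda>j. f j x)"
proof -
  have "(\<integral>\<^sup>+ x. (\<Sum>j. ennreal (2^j) * ennreal ((norm (f (Suc j) x - f j x))\<^sup>2)) \<partial>M)
      = (\<Sum>j. ennreal (2^j) * sqn M (\<lambda>x. f (Suc j) x - f j x))"
    unfolding sqn_def by (subst nn_integral_suminf) (auto simp: nn_integral_cmult)
  also have "\<dots> \<le> (\<Sum>j. ennreal ((1/2)^j))"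
  proof (rule suminf_le)
    fix j
    have "ennreal (2^j) * sqn M (\<lambda>x. f (Suc j) x - f j x) \<le> ennreal (2^j) * ennreal ((1/4)^j)"
      by (intro mult_left_mono fast) auto
    also have "\<dots> = ennreal (2^j * (1/4)^j)"
      by (rule ennreal_mult[symmetric]) auto
    also have "2^j * (1/4)^j = ((1/2)^j :: real)"
      by (subst power_mult_distrib[symmetric]) simp
    finally show "ennreal (2^j) * sqn M (\<lambda>x. f (Suc j) x - f j x) \<le> ennreal ((1/2)^j)" .
  qed auto
  also have "\<dots> < \<infinity>"
    by (subst suminf_ennreal_eq[of _ 2]) (use geometric_sums[of "1/2::real"] in auto)
  finally have "AE x in M. (\<Sum>j. ennreal (2^j) * ennreal ((norm (f (Suc j) x - f j x))\<^sup>2)) \<noteq> \<infinity>"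
    by (intro nn_integral_noteq_infinite) auto
  then show ?thesis
  proof eventually_elim
    case (elim x)
    let ?C = "\<Sum>j. ennreal (2^j) * ennreal ((norm (f (Suc j) x - f j x))\<^sup>2)"
    define C where "C = enn2real ?C"
    have C: "?C = ennreal C" using elim by (simp add: C_def less_top[symmetric])
    have C0: "C \<ge> 0" by (simp add: C_def)
    have bd: "norm (f (Suc j) x - f j x) \<le> sqrt C * (1 / sqrt 2)^j" for j
    proof -
      have "ennreal (2^j) * ennreal ((norm (f (Suc j) x - f j x))\<^sup>2) \<le> ?C"
        using sum_le_suminf[of "\<lambda>j. ennreal (2^j) * ennreal ((norm (f (Suc j) x - f j x))\<^sup>2)" "{j}"] by simp
      then have "ennreal (2^j * (norm (f (Suc j) x - f j x))\<^sup>2) \<le> ennreal C"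
        unfolding C by (subst ennreal_mult) auto
      then have "2^j * (norm (f (Suc j) x - f j x))\<^sup>2 \<le> C"
        using C0 by (simp only: ennreal_le_iff)
      then have "(norm (f (Suc j) x - f j x))\<^sup>2 \<le> C * (1/2)^j"
        by (simp add: field_simps)
      then have "norm (f (Suc j) x - f j x) \<le> sqrt (C * (1/2)^j)"
        by (rule real_le_rsqrt)
      also have "\<dots> = sqrt C * (1 / sqrt 2)^j"
        by (simp add: real_sqrt_mult real_sqrt_power real_sqrt_divide power_divide)
      finally show ?thesis .
    qed
    have "summable (\<lambda>j. f (Suc j) x - f j x)"
      by (rule summable_comparison_test'[OF summable_mult[OF summable_geometric[of "1 / sqrt 2"], of
        "sqrt C"], of 0])
        (use bd in auto)
    then have "convergent (\<lambda>n. \<Sum>j<n. f (Suc j) x - f j x)"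
      by (simp add: summable_iff_convergent)
    then have "convergent (\<lambda>n. f n x - f 0 x)"
      by (subst (asm) sum_lessThan_telescope)
    then have "convergent (\<lambda>n. (f n x - f 0 x) + f 0 x)"
      by (intro convergent_add convergent_const)
    then show "convergent (\<lambda>j. f j x)" by simp
  qed
qed

text \<open>Fatou's lemma, applied to the squared distances from the fixed function
  \<open>h\<close>.\<close>

lemma sqn_limit_le:
  fixes f :: "nat \<Rightarrow> 'a \<Rightarrow> 'b::euclidean_space"
  assumes [measurable]: "\<And>j. f j \<in> borel_measurable M" "g \<in> borel_measurable M" "h \<in> borel_measurable M"
    and conv: "AE x in M. (\<lambda>j. f j x) \<longlonglongrightarrow> g x"
    and bd: "\<forall>\<^sub>F j in sequentially. sqn M (\<lambda>x. f j x - h x) \<le> e"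
  shows "sqn M (\<lambda>x. g x - h x) \<le> e"
proof -
  have "sqn M (\<lambda>x. g x - h x) = (\<integral>\<^sup>+ x. liminf (\<lambda>j. ennreal ((norm (f j x - h x))\<^sup>2)) \<partial>M)"
    unfolding sqn_def
  proof (rule nn_integral_cong_AE)
    show "AE x in M. ennreal ((norm (g x - h x))\<^sup>2) = liminf (\<lambda>j. ennreal ((norm (f j x - h x))\<^sup>2))"
      using conv
    proof eventually_elim
      case (elim x)
      then have "(\<lambda>j. ennreal ((norm (f j x - h x))\<^sup>2)) \<longlonglongrightarrow> ennreal ((norm (g x - h x))\<^sup>2)"
        by (intro tendsto_ennrealI tendsto_intros)
      then show ?case
        by (metis lim_imp_Liminf sequentially_bot)
    qed
  qed
  also have "\<dots> \<le> liminf (\<lambda>j. sqn M (\<lambda>x. f j x - h x))"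
    unfolding sqn_def by (rule nn_integral_liminf) auto
  also have "\<dots> \<le> e"
    by (rule order_trans[OF Liminf_le_Limsup Limsup_bounded]) (use bd in auto)
  finally show ?thesis .
qed

text \<open>The limit is taken pointwise along a subsequence, so that it inherits every kind of
  measurability that the approximants share.\<close>

lemma sqn_complete:
  fixes f :: "nat \<Rightarrow> 'a \<Rightarrow> 'b::euclidean_space"
  assumes [measurable]: "\<And>j. f j \<in> borel_measurable M"
    and Cauchy: "\<And>e::real. e > 0 \<Longrightarrow> \<exists>N. \<forall>i\<ge>N. \<forall>j\<ge>N. sqn M (\<lambda>x. f i x - f j x) < ennreal e"
  obtains r :: "nat \<Rightarrow> nat" where "strict_mono r"
    "(\<lambda>j. sqn M (\<lambda>x. f j x - lim (\<lambda>i. f (r i) x))) \<longlonglongrightarrow> 0"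
proof -
  \<comment> \<open>The index \<open>r k\<close> controls the distance to all later members, in
    particular to the one at \<open>r (Suc k)\<close>, which is what
    \<open>fast_convergent_AE\<close> asks for.\<close>
  have "\<exists>r::nat\<Rightarrow>nat. \<forall>k. (\<forall>i\<ge>r k. sqn M (\<lambda>x. f i x - f (r k) x) < ennreal ((1/4)^k)) \<and> r k < r (Suc k)"
  proof (rule dependent_nat_choice)
    show "\<exists>n. \<forall>i\<ge>n. sqn M (\<lambda>x. f i x - f n x) < ennreal ((1/4)^0)" using Cauchy[of 1] by auto
    fix n k
    obtain N where N: "\<forall>i\<ge>N. \<forall>j\<ge>N. sqn M (\<lambda>x. f i x - f j x) < ennreal ((1/4)^Suc k)"
      using Cauchy[of "(1/4)^Suc k"] by auto
    show "\<exists>m. (\<forall>i\<ge>m. sqn M (\<lambda>x. f i x - f m x) < ennreal ((1/4)^Suc k)) \<and> n < m"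
      using N by (intro exI[of _ "max N (Suc n)"]) auto
  qed
  then obtain r where r: "\<And>k i. i \<ge> r k \<Longrightarrow> sqn M (\<lambda>x. f i x - f (r k) x) < ennreal ((1/4)^k)"
      "\<And>k. r k < r (Suc k)" by blast
  then have sm: "strict_mono r" by (simp add: strict_mono_Suc_iff)
  have "AE x in M. convergent (\<lambda>k. f (r k) x)"
    by (rule fast_convergent_AE) (use r in \<open>auto intro!: less_imp_le\<close>)
  then have conv: "AE x in M. (\<lambda>k. f (r k) x) \<longlonglongrightarrow> lim (\<lambda>i. f (r i) x)"
    by (auto simp: convergent_LIMSEQ_iff)
  have "(\<lambda>j. sqn M (\<lambda>x. lim (\<lambda>i. f (r i) x) - f j x)) \<longlonglongrightarrow> 0"
  proof (rule order_tendstoI)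
    fix a :: ennreal assume "0 < a"
    then obtain e where e: "e > 0" "ennreal e < a"
      by (metis dense ennreal_cases ennreal_less_zero_iff less_top order_less_le_trans top_greatest)
    obtain N where N: "\<forall>i\<ge>N. \<forall>j\<ge>N. sqn M (\<lambda>x. f i x - f j x) < ennreal e"
      using Cauchy[OF e(1)] by auto
    have "sqn M (\<lambda>x. lim (\<lambda>i. f (r i) x) - f j x) \<le> ennreal e" if "j \<ge> N" for j
    proof (rule sqn_limit_le[OF _ _ _ conv])
      show "\<forall>\<^sub>F k in sequentially. sqn M (\<lambda>x. f (r k) x - f j x) \<le> ennreal e"
        using eventually_ge_at_top[of N]
      proof eventually_elim
        case (elim k)
        then have "r k \<ge> N" using seq_suble[OF sm, of k] by simp
        with N that show ?case by (auto intro!: less_imp_le)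
      qed
    qed auto
    then show "\<forall>\<^sub>F j in sequentially. sqn M (\<lambda>x. lim (\<lambda>i. f (r i) x) - f j x) < a"
      using e by (auto simp: eventually_sequentially intro: le_less_trans)
  qed auto
  then show ?thesis using that[OF sm] by (simp add: sqn_commute)
qed

section \<open>Points of the simplex\<close>

abbreviation cube_measure :: "nat \<Rightarrow> (nat \<Rightarrow> real) measure" where
  "cube_measure n \<equiv> \<Pi>\<^sub>M i\<in>{..<n}. lborel"

interpretation lborel_prod: product_sigma_finite "\<lambda>_::nat. lborel :: real measure" ..

interpretation cube: sigma_finite_measure "cube_measure n" for n
  by (rule lborel_prod.sigma_finite) simp

definition append_pt :: "nat \<Rightarrow> nat \<Rightarrow> (nat \<Rightarrow> real) \<Rightarrow> (nat \<Rightarrow> real) \<Rightarrow> nat \<Rightarrow> real" where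
  "append_pt m n x y = (\<lambda>i\<in>{..<m + n}. if i < m then x i else y (i - m))"

section \<open>Splitting off coordinates of the cube\<close>

lemma measurable_cons_pt [measurable]:
  "(\<lambda>(t, s). cons_pt n t s) \<in> lborel \<Otimes>\<^sub>M cube_measure n \<rightarrow>\<^sub>M cube_measure (Suc n)"
  unfolding cons_pt_def case_prod_beta
proof (rule measurable_restrict)
  fix i assume "i \<in> {..<Suc n}"
  then show "(\<lambda>x. case i of 0 \<Rightarrow> fst x | Suc j \<Rightarrow> snd x j) \<in> lborel \<Otimes>\<^sub>M cube_measure n \<rightarrow>\<^sub>M lborel"
    by (cases i) auto
qed

lemma measurable_snoc_pt [measurable]:
  "(\<lambda>(t, s). snoc_pt n s t) \<in> lborel \<Otimes>\<^sub>M cube_measure n \<rightarrow>\<^sub>M cube_measure (Suc n)"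
  unfolding snoc_pt_def case_prod_beta
proof (rule measurable_restrict)
  fix i assume "i \<in> {..<Suc n}"
  then show "(\<lambda>x. if i < n then snd x i else fst x) \<in> lborel \<Otimes>\<^sub>M cube_measure n \<rightarrow>\<^sub>M lborel"
    by (cases "i < n") auto
qed

lemma measurable_append_pt [measurable]:
  "(\<lambda>(x, y). append_pt m n x y) \<in> cube_measure m \<Otimes>\<^sub>M cube_measure n \<rightarrow>\<^sub>M cube_measure (m + n)"
  unfolding append_pt_def case_prod_beta
proof (rule measurable_restrict)
  fix i assume "i \<in> {..<m + n}"
  then show "(\<lambda>x. if i < m then fst x i else snd x (i - m)) \<in> cube_measure m \<Otimes>\<^sub>M cube_measure n \<rightarrow>\<^sub>M lborel"
    by (cases "i < m") auto
qed

text \<open>The product measure is determined by its values on boxes, and the preimage of a box is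
  again a box whose measure factors.\<close>

lemma distr_cons_pt:
  "distr (lborel \<Otimes>\<^sub>M cube_measure n) (cube_measure (Suc n)) (\<lambda>(t, s). cons_pt n t s) = cube_measure (Suc n)"
proof (rule lborel_prod.PiM_eqI)
  fix A :: "nat \<Rightarrow> real set" assume A: "\<And>i. i \<in> {..<Suc n} \<Longrightarrow> A i \<in> sets lborel"
  have [measurable]: "Pi\<^sub>E {..<Suc n} A \<in> sets (cube_measure (Suc n))"
    using A by (intro sets_PiM_I_finite) auto
  have "(\<lambda>(t, s). cons_pt n t s) -` Pi\<^sub>E {..<Suc n} A \<inter> space (lborel \<Otimes>\<^sub>M cube_measure n)
      = A 0 \<times> Pi\<^sub>E {..<n} (\<lambda>i. A (Suc i))"
  proof (intro set_eqI)
    fix p :: "real \<times> (nat \<Rightarrow> real)"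
    obtain a b where p: "p = (a, b)" by force
    have "(\<forall>i<Suc n. cons_pt n a b i \<in> A i) \<longleftrightarrow> a \<in> A 0 \<and> (\<forall>i<n. b i \<in> A (Suc i))"
      unfolding All_less_Suc2 by (simp add: cons_pt_def)
    moreover have "cons_pt n a b \<in> extensional {..<Suc n}" by (auto simp: cons_pt_def)
    ultimately show "p \<in> (\<lambda>(t, s). cons_pt n t s) -` Pi\<^sub>E {..<Suc n} A \<inter> space (lborel \<Otimes>\<^sub>M cube_measure n)
      \<longleftrightarrow> p \<in> A 0 \<times> Pi\<^sub>E {..<n} (\<lambda>i. A (Suc i))"
      unfolding p by (auto simp: space_pair_measure space_PiM PiE_iff)
  qed
  then show "emeasure (distr (lborel \<Otimes>\<^sub>M cube_measure n) (cube_measure (Suc n)) (\<lambda>(t, s). cons_pt n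
    t s)) (Pi\<^sub>E {..<Suc n} A)
      = (\<Prod>i\<in>{..<Suc n}. emeasure lborel (A i))"
    using A lborel_prod.emeasure_PiM[of "{..<n}" "\<lambda>i. A (Suc i)"] by (subst emeasure_distr)
      (auto simp: cube.emeasure_pair_measure_Times sets_PiM_I_finite prod.lessThan_Suc_shift simp
        del: prod.lessThan_Suc)
qed auto

lemma distr_append_pt:
  "distr (cube_measure m \<Otimes>\<^sub>M cube_measure n) (cube_measure (m + n)) (\<lambda>(x, y). append_pt m n x y) =
    cube_measure (m + n)"
proof (rule lborel_prod.PiM_eqI)
  fix A :: "nat \<Rightarrow> real set" assume A: "\<And>i. i \<in> {..<m + n} \<Longrightarrow> A i \<in> sets lborel"
  have [measurable]: "Pi\<^sub>E {..<m + n} A \<in> sets (cube_measure (m + n))"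
    using A by (intro sets_PiM_I_finite) auto
  have eq: "(\<lambda>(x, y). append_pt m n x y) -` Pi\<^sub>E {..<m + n} A \<inter> space (cube_measure m \<Otimes>\<^sub>M cube_measure n)
      = Pi\<^sub>E {..<m} A \<times> Pi\<^sub>E {..<n} (\<lambda>i. A (m + i))"
  proof (intro set_eqI)
    fix p :: "(nat \<Rightarrow> real) \<times> (nat \<Rightarrow> real)"
    obtain x y where p: "p = (x, y)" by force
    have "(\<forall>i<m + n. append_pt m n x y i \<in> A i) \<longleftrightarrow> (\<forall>i<m. x i \<in> A i) \<and> (\<forall>i<n. y i \<in> A (m + i))"
    proof safe
      fix i assume h: "\<forall>i<m + n. append_pt m n x y i \<in> A i" 
      { assume "i < m" then show "x i \<in> A i" using h[rule_format, of i] by (simp add: append_pt_def) }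
      { assume "i < n" then show "y i \<in> A (m + i)" using h[rule_format, of "m + i"] by (simp add:
        append_pt_def) }
    next
      fix i assume "\<forall>i<m. x i \<in> A i" "\<forall>i<n. y i \<in> A (m + i)" "i < m + n"
      then show "append_pt m n x y i \<in> A i"
        by (cases "i < m") (auto simp: append_pt_def dest: spec[of _ "i - m"])
    qed
    moreover have "append_pt m n x y \<in> extensional {..<m + n}" by (auto simp: append_pt_def)
    ultimately show "p \<in> (\<lambda>(x, y). append_pt m n x y) -` Pi\<^sub>E {..<m + n} A \<inter> space (cube_measure m
      \<Otimes>\<^sub>M cube_measure n)
       \<longleftrightarrow> p \<in> Pi\<^sub>E {..<m} A \<times> Pi\<^sub>E {..<n} (\<lambda>i. A (m + i))"
      unfolding p by (auto simp: space_pair_measure space_PiM PiE_iff)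
  qed
  have "(\<Prod>i<m + n. emeasure lborel (A i)) = (\<Prod>i<m. emeasure lborel (A i)) * (\<Prod>i<n. emeasure lborel
    (A (m + i)))"
    by (induction n) (auto simp: mult.assoc)
  with eq show "emeasure (distr (cube_measure m \<Otimes>\<^sub>M cube_measure n) (cube_measure (m + n)) (\<lambda>(x, y).
    append_pt m n x y)) (Pi\<^sub>E {..<m + n} A)
      = (\<Prod>i\<in>{..<m + n}. emeasure lborel (A i))"
    using A lborel_prod.emeasure_PiM[of "{..<m}" A] lborel_prod.emeasure_PiM[of "{..<n}" "\<lambda>i. A (m + i)"]
    by (subst emeasure_distr)
      (auto simp: cube.emeasure_pair_measure_Times sets_PiM_I_finite)
qed auto

lemma nn_integral_cons_pt:
  assumes [measurable]: "h \<in> borel_measurable (cube_measure (Suc n))"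
  shows "(\<integral>\<^sup>+ x. h x \<partial>cube_measure (Suc n)) = (\<integral>\<^sup>+ t. \<integral>\<^sup>+ s. h (cons_pt n t s) \<partial>cube_measure n \<partial>lborel)"
proof -
  have "(\<integral>\<^sup>+ x. h x \<partial>cube_measure (Suc n)) = (\<integral>\<^sup>+ p. h (case p of (t, s) \<Rightarrow> cons_pt n t s) \<partial>(lborel
    \<Otimes>\<^sub>M cube_measure n))"
    by (subst distr_cons_pt[symmetric], subst nn_integral_distr) auto
  also have "\<dots> = (\<integral>\<^sup>+ t. \<integral>\<^sup>+ s. h (cons_pt n t s) \<partial>cube_measure n \<partial>lborel)"
    by (subst cube.nn_integral_fst[symmetric]) auto
  finally show ?thesis .
qed

text \<open>Appending a last coordinate is a function update at \<open>n\<close>, so the library's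
  rule for one more index applies directly. Prepending shifts all the indices, which is why
  \<open>nn_integral_cons_pt\<close> goes through an image measure instead.\<close>

lemma nn_integral_snoc_pt:
  assumes h: "h \<in> borel_measurable (cube_measure (Suc n))"
  shows "(\<integral>\<^sup>+ x. h x \<partial>cube_measure (Suc n)) = (\<integral>\<^sup>+ t. \<integral>\<^sup>+ s. h (snoc_pt n s t) \<partial>cube_measure n \<partial>lborel)"
proof -
  have e: "s(n := t) = snoc_pt n s t" if "s \<in> space (cube_measure n)" for s t
    using that by (auto simp: snoc_pt_def space_PiM fun_eq_iff PiE_iff less_Suc_eq dest: extensional_arb)
  have "(\<integral>\<^sup>+ x. h x \<partial>cube_measure (Suc n)) = (\<integral>\<^sup>+ t. \<integral>\<^sup>+ s. h (s(n := t)) \<partial>cube_measure n \<partial>lborel)"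
    unfolding lessThan_Suc by (rule lborel_prod.product_nn_integral_insert_rev) (use h in \<open>simp_all
      add: lessThan_Suc\<close>)
  also have "\<dots> = (\<integral>\<^sup>+ t. \<integral>\<^sup>+ s. h (snoc_pt n s t) \<partial>cube_measure n \<partial>lborel)"
    by (intro nn_integral_cong) (simp only: e)
  finally show ?thesis .
qed

lemma nn_integral_append_pt:
  assumes [measurable]: "h \<in> borel_measurable (cube_measure (m + n))"
  shows "(\<integral>\<^sup>+ x. h x \<partial>cube_measure (m + n)) = (\<integral>\<^sup>+ y. \<integral>\<^sup>+ x. h (append_pt m n x y) \<partial>cube_measure m
    \<partial>cube_measure n)"
proof -
  interpret pair_sigma_finite "cube_measure m" "cube_measure n" ..
  have "(\<integral>\<^sup>+ x. h x \<partial>cube_measure (m + n)) = (\<integral>\<^sup>+ p. h (case p of (s, t) \<Rightarrow> append_pt m n s t)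
    \<partial>(cube_measure m \<Otimes>\<^sub>M cube_measure n))"
    by (subst distr_append_pt[symmetric], subst nn_integral_distr) auto
  also have "\<dots> = (\<integral>\<^sup>+ t. \<integral>\<^sup>+ s. h (append_pt m n s t) \<partial>cube_measure m \<partial>cube_measure n)"
    by (subst nn_integral_snd[symmetric]) (auto simp: split_beta')
  finally show ?thesis .
qed

lemma simplex_pts_sets [measurable]: "simplex_pts n S T \<in> sets (cube_measure n)"
proof -
  have "simplex_pts n S T = {t \<in> space (cube_measure n).
      (\<forall>i\<in>{..<n}. S < t i \<and> t i < T) \<and> (\<forall>j\<in>{..<n}. \<forall>i\<in>{..<j}. t j < t i)}"
    by (fastforce simp: simplex_pts_def space_PiM)
  also have "\<dots> \<in> sets (cube_measure n)"
  proof (intro sets.sets_Collect_conj sets.sets_Collect_finite_All finite_lessThan)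
    fix i assume "i \<in> {..<n}"
    then show "{x \<in> space (cube_measure n). S < x i} \<in> sets (cube_measure n)"
      "{x \<in> space (cube_measure n). x i < T} \<in> sets (cube_measure n)"
      by measurable
    fix j assume "j \<in> {..<i}"
    then have "j \<in> {..<n}" using \<open>i \<in> {..<n}\<close> by auto
    with \<open>i \<in> {..<n}\<close> show "{x \<in> space (cube_measure n). x i < x j} \<in> sets (cube_measure n)"
      by measurable
  qed
  finally show ?thesis .
qed

lemma cons_pt_in_simplex_iff:
  assumes "s \<in> space (cube_measure n)"
  shows "cons_pt n t s \<in> simplex_pts (Suc n) S T \<longleftrightarrow> S < t \<and> t < T \<and> s \<in> simplex_pts n S t"
proof
  assume h: "cons_pt n t s \<in> simplex_pts (Suc n) S T"
  have e: "cons_pt n t s 0 = t" "\<And>i. i < n \<Longrightarrow> cons_pt n t s (Suc i) = s i" by (auto simp: cons_pt_def)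
  have a: "\<And>i. i < Suc n \<Longrightarrow> S < cons_pt n t s i \<and> cons_pt n t s i < T"
    and b: "\<And>i j. i < j \<Longrightarrow> j < Suc n \<Longrightarrow> cons_pt n t s j < cons_pt n t s i"
    using h by (auto simp: simplex_pts_def)
  show "S < t \<and> t < T \<and> s \<in> simplex_pts n S t"
    using a[of 0] a[of "Suc _"] b[of 0 "Suc _"] b[of "Suc _" "Suc _"] assms
    by (auto simp: simplex_pts_def space_PiM e)
next
  assume h: "S < t \<and> t < T \<and> s \<in> simplex_pts n S t"
  then show "cons_pt n t s \<in> simplex_pts (Suc n) S T"
    by (auto simp: simplex_pts_def cons_pt_def less_Suc_eq_0_disj split: nat.splits intro: less_trans)
qed

lemma snoc_pt_in_simplex_iff:
  assumes "s \<in> space (cube_measure n)"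
  shows "snoc_pt n s t \<in> simplex_pts (Suc n) S T \<longleftrightarrow> S < t \<and> t < T \<and> s \<in> simplex_pts n t T"
proof
  assume h: "snoc_pt n s t \<in> simplex_pts (Suc n) S T"
  have e: "snoc_pt n s t n = t" "\<And>i. i < n \<Longrightarrow> snoc_pt n s t i = s i" by (auto simp: snoc_pt_def)
  have a: "\<And>i. i < Suc n \<Longrightarrow> S < snoc_pt n s t i \<and> snoc_pt n s t i < T"
    and b: "\<And>i j. i < j \<Longrightarrow> j < Suc n \<Longrightarrow> snoc_pt n s t j < snoc_pt n s t i"
    using h by (auto simp: simplex_pts_def)
  show "S < t \<and> t < T \<and> s \<in> simplex_pts n t T"
    using a[of n] a b[of _ n] b assms
    by (auto simp: simplex_pts_def space_PiM e) (metis e less_SucI)+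
next
  assume h: "S < t \<and> t < T \<and> s \<in> simplex_pts n t T"
  then show "snoc_pt n s t \<in> simplex_pts (Suc n) S T"
    by (auto simp: simplex_pts_def snoc_pt_def less_Suc_eq intro: less_trans)
qed

section \<open>Measures on the interval and on the simplex, and their slices\<close>

lemma space_time_interval [simp]: "space (time_interval S T) = {S<..<T}"
  by (simp add: time_interval_def space_restrict_space)

lemma space_simplex_measure [simp]: "space (simplex_measure n S T) = simplex_pts n S T"
  using sets.sets_into_space[OF simplex_pts_sets[of n S T]]
  by (auto simp: simplex_measure_def space_restrict_space)

lemma sets_time_interval [measurable_cong]: "sets (time_interval S T) = sets (restrict_space borel {S<..<T})"
  unfolding time_interval_def by (rule sets_restrict_space_cong) simp

lemma sigma_finite_time_interval: "sigma_finite_measure (time_interval S T)"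
  unfolding time_interval_def by (intro sigma_finite_measure_restrict_space
    lborel.sigma_finite_measure_axioms) simp

interpretation time_interval: sigma_finite_measure "time_interval S T" for S T
  by (rule sigma_finite_time_interval)

lemma nn_integral_time_interval:
  "(\<integral>\<^sup>+ t. h t \<partial>time_interval S T) = (\<integral>\<^sup>+ t. h t * indicator {S<..<T} t \<partial>lborel)"
  unfolding time_interval_def by (subst nn_integral_restrict_space) auto

lemma nn_integral_simplex:
  "(\<integral>\<^sup>+ t. h t \<partial>simplex_measure n S T) = (\<integral>\<^sup>+ t. h t * indicator (simplex_pts n S T) t \<partial>cube_measure n)"
  unfolding simplex_measure_def
  using sets.sets_into_space[OF simplex_pts_sets[of n S T]]
  by (subst nn_integral_restrict_space) (auto simp: Int_absorb2)

lemma AE_time_interval: "(AE t in time_interval S T. P t) \<longleftrightarrow> (AE t in lborel. S < t \<and> t < T \<longrightarrow> P t)"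
  unfolding time_interval_def by (subst AE_restrict_space_iff) auto

lemma AE_simplex: "(AE t in simplex_measure n S T. P t) \<longleftrightarrow> (AE t in cube_measure n. t \<in> simplex_pts n
  S T \<longrightarrow> P t)"
  unfolding simplex_measure_def
  using sets.sets_into_space[OF simplex_pts_sets[of n S T]]
  by (subst AE_restrict_space_iff) (auto simp: Int_absorb2)

text \<open>Extension by zero moves a function from the simplex to the whole cube, where the measure
  is a product and Fubini is available.\<close>

definition zero_ext :: "'a set \<Rightarrow> ('a \<Rightarrow> 'b) \<Rightarrow> 'a \<Rightarrow> 'b::zero" where
  "zero_ext A f x = (if x \<in> A then f x else 0)"

lemma zero_ext_measurable:
  fixes f :: "(nat \<Rightarrow> real) \<Rightarrow> 'b::euclidean_space"
  shows "zero_ext (simplex_pts n S T) f \<in> borel_measurable (cube_measure n) \<longleftrightarrow> f \<in> borel_measurable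
    (simplex_measure n S T)"
proof -
  have e: "zero_ext (simplex_pts n S T) f = (\<lambda>x. indicator (simplex_pts n S T) x *\<^sub>R f x)"
    by (auto simp: zero_ext_def)
  show ?thesis unfolding simplex_measure_def e
    using sets.sets_into_space[OF simplex_pts_sets[of n S T]]
    by (subst borel_measurable_restrict_space_iff) (auto simp: Int_absorb2)
qed

lemma sqn_simplex:
  "sqn (simplex_measure n S T) f = sqn (cube_measure n) (zero_ext (simplex_pts n S T) f)"
  unfolding sqn_def nn_integral_simplex
  by (intro nn_integral_cong) (auto simp: zero_ext_def)

text \<open>One Fubini argument for both ways of slicing. With \<open>e\<close> prepending the first
  time, the remaining times lie between \<open>S\<close> and it, as iterated integrals require. With
  \<open>e\<close> appending the last time, the others lie between it and \<open>T\<close>, as the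
  Volterra norm requires. The functions \<open>A\<close> and \<open>B\<close> give the ends of the
  slice.\<close>

lemma
  fixes f :: "(nat \<Rightarrow> real) \<Rightarrow> 'b::euclidean_space"
  assumes e: "(\<lambda>(t, s). e t s) \<in> lborel \<Otimes>\<^sub>M cube_measure n \<rightarrow>\<^sub>M cube_measure (Suc n)"
    and int: "\<And>h. h \<in> borel_measurable (cube_measure (Suc n)) \<Longrightarrow>
      (\<integral>\<^sup>+ x. h x \<partial>cube_measure (Suc n)) = (\<integral>\<^sup>+ t. \<integral>\<^sup>+ s. h (e t s) \<partial>cube_measure n \<partial>lborel)"
    and iff: "\<And>t s. s \<in> space (cube_measure n) \<Longrightarrow>
      e t s \<in> simplex_pts (Suc n) S T \<longleftrightarrow> S < t \<and> t < T \<and> s \<in> simplex_pts n (A t) (B t)"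
    and f: "f \<in> borel_measurable (simplex_measure (Suc n) S T)"
  shows slice_measurable: "S < t \<Longrightarrow> t < T \<Longrightarrow> (\<lambda>s. f (e t s)) \<in> borel_measurable (simplex_measure n (A t) (B t))"
    and slice_sqn_borel: "(\<lambda>t. sqn (simplex_measure n (A t) (B t)) (\<lambda>s. f (e t s))) \<in>
      borel_measurable (time_interval S T)" (is ?A)
    and slice_Fubini: "sqn (simplex_measure (Suc n) S T) f
      = (\<integral>\<^sup>+ t. sqn (simplex_measure n (A t) (B t)) (\<lambda>s. f (e t s)) \<partial>time_interval S T)" (is ?B)
proof -
  define F where "F = zero_ext (simplex_pts (Suc n) S T) f"
  have [measurable]: "F \<in> borel_measurable (cube_measure (Suc n))"
    using f by (simp only: zero_ext_measurable F_def)
  note e [measurable]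
  have "(\<lambda>s. F (case (t, s) of (t, s) \<Rightarrow> e t s)) \<in> borel_measurable (cube_measure n)" for t
    by measurable
  also have "?this t \<longleftrightarrow> zero_ext (simplex_pts n (A t) (B t)) (\<lambda>s. f (e t s)) \<in> borel_measurable
    (cube_measure n)"
    if "S < t" "t < T" for t
    using that by (intro measurable_cong) (simp add: F_def zero_ext_def iff)
  finally show "S < t \<Longrightarrow> t < T \<Longrightarrow> (\<lambda>s. f (e t s)) \<in> borel_measurable (simplex_measure n (A t) (B t))"
    by (simp only: zero_ext_measurable)
  have eq: "(\<integral>\<^sup>+ s. ennreal ((norm (F (e t s)))\<^sup>2) \<partial>cube_measure n)
     = sqn (simplex_measure n (A t) (B t)) (\<lambda>s. f (e t s)) * indicator {S<..<T} t" for t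
  proof (cases "t \<in> {S<..<T}")
    case True
    then show ?thesis unfolding sqn_simplex unfolding sqn_def F_def zero_ext_def
      by (auto intro!: nn_integral_cong simp: iff)
  next
    case False
    then have "F (e t s) = 0" if "s \<in> space (cube_measure n)" for s
      unfolding F_def zero_ext_def iff[OF that] by auto
    then show ?thesis using False by (simp cong: nn_integral_cong_simp)
  qed
  have m: "(\<lambda>t. \<integral>\<^sup>+ s. ennreal ((norm (F (case (t, s) of (t, s) \<Rightarrow> e t s)))\<^sup>2) \<partial>cube_measure n) \<in>
    borel_measurable lborel"
    by measurable
  have "(\<lambda>t. \<integral>\<^sup>+ s. ennreal ((norm (F (e t s)))\<^sup>2) \<partial>cube_measure n) \<in> borel_measurable (time_interval S T)"
    using m unfolding time_interval_def by (intro measurable_restrict_space1) simp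
  then show ?A unfolding eq by (rule measurable_cong[THEN iffD1, rotated]) auto
  have "sqn (simplex_measure (Suc n) S T) f = (\<integral>\<^sup>+ x. ennreal ((norm (F x))\<^sup>2) \<partial>cube_measure (Suc n))"
    unfolding sqn_simplex unfolding sqn_def F_def ..
  also have "\<dots> = (\<integral>\<^sup>+ t. \<integral>\<^sup>+ s. ennreal ((norm (F (e t s)))\<^sup>2) \<partial>cube_measure n \<partial>lborel)"
    by (rule int) measurable
  finally show ?B unfolding eq nn_integral_time_interval .
qed

lemma
  fixes f :: "(nat \<Rightarrow> real) \<Rightarrow> 'b::euclidean_space"
  assumes f: "f \<in> borel_measurable (simplex_measure (Suc n) S T)"
  shows simplex_measurable_cons: "S < t \<Longrightarrow> t < T \<Longrightarrow> (\<lambda>s. f (cons_pt n t s)) \<in> borel_measurable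
    (simplex_measure n S t)"
    and measurable_sqn_cons: "(\<lambda>t. sqn (simplex_measure n S t) (\<lambda>s. f (cons_pt n t s))) \<in>
      borel_measurable (time_interval S T)"
    and sqn_simplex_cons: "sqn (simplex_measure (Suc n) S T) f
      = (\<integral>\<^sup>+ t. sqn (simplex_measure n S t) (\<lambda>s. f (cons_pt n t s)) \<partial>time_interval S T)"
  by (rule slice_measurable slice_sqn_borel slice_Fubini, rule measurable_cons_pt,
      erule nn_integral_cons_pt, erule cons_pt_in_simplex_iff, rule f, assumption?, assumption?)+

lemma
  fixes f :: "(nat \<Rightarrow> real) \<Rightarrow> 'b::euclidean_space"
  assumes f: "f \<in> borel_measurable (simplex_measure (Suc n) S T)"
  shows simplex_measurable_snoc: "S < t \<Longrightarrow> t < T \<Longrightarrow> (\<lambda>s. f (snoc_pt n s t)) \<in> borel_measurable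
    (simplex_measure n t T)"
    and measurable_sqn_snoc: "(\<lambda>t. sqn (simplex_measure n t T) (\<lambda>s. f (snoc_pt n s t))) \<in>
      borel_measurable (time_interval S T)"
    and sqn_simplex_snoc: "sqn (simplex_measure (Suc n) S T) f
      = (\<integral>\<^sup>+ t. sqn (simplex_measure n t T) (\<lambda>s. f (snoc_pt n s t)) \<partial>time_interval S T)"
  by (rule slice_measurable slice_sqn_borel slice_Fubini, rule measurable_snoc_pt,
      erule nn_integral_snoc_pt, erule snoc_pt_in_simplex_iff, rule f, assumption?, assumption?)+

text \<open>For every interval the simplex of dimension zero is the single point
  \<open>\<lambda>_. undefined\<close>, of mass 1.\<close>

lemma sqn_simplex_0: "sqn (simplex_measure 0 S T) f = ennreal ((norm (f (\<lambda>_. undefined)))\<^sup>2)"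
  unfolding sqn_simplex unfolding sqn_def
  by (simp add: lborel_prod.nn_integral_empty zero_ext_def simplex_pts_def)

section \<open>Simple processes\<close>

lemma integrable_norm2_add:
  fixes f g :: "'x \<Rightarrow> 'a::euclidean_space"
  assumes [measurable]: "f \<in> borel_measurable N" "g \<in> borel_measurable N"
    and int: "integrable N (\<lambda>\<omega>. (norm (f \<omega>))\<^sup>2)" "integrable N (\<lambda>\<omega>. (norm (g \<omega>))\<^sup>2)"
  shows "integrable N (\<lambda>\<omega>. (norm (f \<omega> + g \<omega>))\<^sup>2)"
proof (rule Bochner_Integration.integrable_bound[OF integrable_mult_right[OF
  Bochner_Integration.integrable_add[OF int], of 2]])
  show "AE \<omega> in N. norm ((norm (f \<omega> + g \<omega>))\<^sup>2) \<le> norm (2 * ((norm (f \<omega>))\<^sup>2 + (norm (g \<omega>))\<^sup>2))"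
  proof (intro AE_I2)
    fix \<omega>
    have "(norm (f \<omega> + g \<omega>))\<^sup>2 \<le> (norm (f \<omega>) + norm (g \<omega>))\<^sup>2"
      by (intro power_mono norm_triangle_ineq) auto
    also have "\<dots> \<le> 2 * ((norm (f \<omega>))\<^sup>2 + (norm (g \<omega>))\<^sup>2)"
      using sum_squares_bound[of "norm (f \<omega>)" "norm (g \<omega>)"] by (simp add: power2_sum)
    finally show "norm ((norm (f \<omega> + g \<omega>))\<^sup>2) \<le> norm (2 * ((norm (f \<omega>))\<^sup>2 + (norm (g \<omega>))\<^sup>2))" by simp
  qed
qed measurable

section \<open>Filtration and independence of Brownian increments\<close>

locale brownian = prob_space M for M :: "'w measure" +
  fixes W :: "real \<Rightarrow> 'w \<Rightarrow> real"
  assumes bm: "brownian_motion M W"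
begin

lemma W_measurable [measurable]: "0 \<le> t \<Longrightarrow> W t \<in> borel_measurable M"
  using bm by (simp add: brownian_motion_def)

definition increment_events :: "real \<Rightarrow> real \<Rightarrow> 'w set set" where
  "increment_events s t = {(\<lambda>\<omega>. W r \<omega> - W s \<omega>) -` A \<inter> space M | r A. s \<le> r \<and> r \<le> t \<and> A \<in> sets borel}
    \<union> null_sets M"

lemma increment_events_sets: "0 \<le> s \<Longrightarrow> increment_events s t \<subseteq> sets M"
  unfolding increment_events_def by (auto intro!: measurable_sets[of _ _ borel])

lemma increment_events_Pow: "increment_events s t \<subseteq> Pow (space M)"
  unfolding increment_events_def using sets.sets_into_space by fastforce

lemma space_filtration [simp]: "space (increment_filtration M W s t) = space M"
  unfolding increment_filtration_def by (simp add: space_measure_of_conv)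

lemma sets_filtration: "sets (increment_filtration M W s t) = sigma_sets (space M) (increment_events s t)"
  using increment_events_Pow[of s t] unfolding increment_filtration_def increment_events_def
  by (rule sets_measure_of)

lemma filtration_le: "0 \<le> s \<Longrightarrow> sets (increment_filtration M W s t) \<subseteq> sets M"
  unfolding sets_filtration by (intro sets.sigma_sets_subset increment_events_sets)

lemma filtration_mono:
  assumes "t \<le> t'" shows "sets (increment_filtration M W s t) \<subseteq> sets (increment_filtration M W s t')"
  unfolding sets_filtration
proof (rule sigma_sets_mono')
  show "increment_events s t \<subseteq> increment_events s t'"
    unfolding increment_events_def
  proof (intro Un_mono subset_refl Collect_mono impI, elim exE conjE)
    fix x r A assume "x = (\<lambda>\<omega>. W r \<omega> - W s \<omega>) -` A \<inter> space M" "s \<le> r" "r \<le> t" "A \<in> sets borel"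
    then show "\<exists>r A. x = (\<lambda>\<omega>. W r \<omega> - W s \<omega>) -` A \<inter> space M \<and> s \<le> r \<and> r \<le> t' \<and> A \<in> sets borel"
      using assms by (intro exI[of _ r] exI[of _ A]) auto
  qed
qed

lemma filtration_measurable_mono:
  assumes "f \<in> borel_measurable (increment_filtration M W s t)" "t \<le> t'"
  shows "f \<in> borel_measurable (increment_filtration M W s t')"
  using assms filtration_mono[OF assms(2), of s] by (auto simp: measurable_def)

lemma filtration_measurable:
  assumes "f \<in> borel_measurable (increment_filtration M W s t)" "0 \<le> s"
  shows "f \<in> borel_measurable M"
  using assms filtration_le[OF assms(2), of t] by (auto simp: measurable_def)

lemma increment_measurable_filtration:
  assumes "s \<le> r" "r \<le> r'" "r' \<le> t"
  shows "(\<lambda>\<omega>. W r' \<omega> - W r \<omega>) \<in> borel_measurable (increment_filtration M W s t)"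
proof -
  have *: "(\<lambda>\<omega>. W r \<omega> - W s \<omega>) \<in> borel_measurable (increment_filtration M W s t)" if "s \<le> r" "r \<le> t" for r
    by (rule measurableI) (use that in \<open>auto simp: sets_filtration increment_events_def intro!:
      sigma_sets.Basic\<close>)
  have "(\<lambda>\<omega>. (W r' \<omega> - W s \<omega>) - (W r \<omega> - W s \<omega>)) \<in> borel_measurable (increment_filtration M W s t)"
    by (intro borel_measurable_diff *) (use assms in auto)
  then show ?thesis by simp
qed

text \<open>The random vector of increments from \<open>s\<close>, observed at the times in
  \<open>R\<close>. For finite \<open>R\<close> its events form an intersection-stable family, from
  which independence is carried over to the filtration.\<close>

definition past :: "real \<Rightarrow> real set \<Rightarrow> 'w \<Rightarrow> real \<Rightarrow> real" where
  "past s R \<omega> = (\<lambda>r\<in>R. W r \<omega> - W s \<omega>)"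

lemma past_measurable:
  assumes "0 \<le> s" "R \<subseteq> {s..}"
  shows "past s R \<in> M \<rightarrow>\<^sub>M PiM R (\<lambda>_. borel)"
proof -
  have "(\<lambda>\<omega>. \<lambda>r\<in>R. W r \<omega> - W s \<omega>) \<in> M \<rightarrow>\<^sub>M PiM R (\<lambda>_. borel)"
    by (rule measurable_restrict) (use assms in \<open>auto intro!: borel_measurable_diff W_measurable\<close>)
  then show ?thesis by (simp add: past_def[abs_def])
qed

text \<open>Independence is postulated only for consecutive increments along increasing times.
  Sorting \<open>R\<close> together with \<open>s\<close> and \<open>a\<close> makes every entry of
  \<open>past s R\<close> a partial sum of such increments, all of them before the increment from
  \<open>a\<close> to \<open>b\<close>.\<close>

lemma past_indep:
  assumes "0 \<le> s" "s \<le> a" "a < b" and R: "finite R" "R \<subseteq> {s..a}"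
  shows "indep_var (PiM R (\<lambda>_. borel)) (past s R) (PiM {b} (\<lambda>_. borel)) (\<lambda>\<omega>. \<lambda>_\<in>{b}. W b \<omega> - W a \<omega>)"
proof -
  define L where "L = sorted_list_of_set (R \<union> {s, a})"
  define n where "n = length L - 1"
  \<comment> \<open>The sorted times occupy the indices 0 to \<open>n\<close>, from \<open>s\<close>
    to \<open>a\<close>, and \<open>b\<close> follows. So increments with index below
    \<open>n\<close> form the past, and increment \<open>n\<close> is
    \<open>W b - W a\<close>.\<close>
  define t where "t = (\<lambda>i. if i \<le> n then L ! i else b)"
  have finR: "finite (R \<union> {s, a})" using R by simp
  have setL: "set L = R \<union> {s, a}" unfolding L_def by (rule set_sorted_list_of_set[OF finR])
  then have lenL: "length L = Suc n" by (cases L) (auto simp: n_def)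
  have sL: "sorted_wrt (<) L" by (simp add: L_def)
  have tL: "L ! i < L ! j" if "i < j" "j \<le> n" for i j
    using sorted_wrt_nth_less[OF sL that(1)] that(2) lenL by simp
  have mono: "L ! i \<le> L ! j" if "i \<le> j" "j \<le> n" for i j
    using tL[of i j] that by (cases "i = j") auto
  have inL: "L ! i \<in> {s..a}" if "i \<le> n" for i
    using nth_mem[of i L] that lenL setL R assms(2) by auto
  obtain i0 where "i0 \<le> n" "L ! i0 = s" using setL lenL by (metis UnCI in_set_conv_nth insertCI
    less_Suc_eq_le)
  then have L0: "L ! 0 = s" using inL[of 0] mono[of 0 i0] by auto
  obtain i1 where "i1 \<le> n" "L ! i1 = a" using setL lenL by (metis UnCI in_set_conv_nth insertCI
    less_Suc_eq_le)
  then have Ln: "L ! n = a" using inL[of n] mono[of i1 n] by auto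
  define D where "D = (\<lambda>i \<omega>. W (t (Suc i)) \<omega> - W (t i) \<omega>)"
  have "0 \<le> t 0 \<and> (\<forall>i<Suc n. t i < t (Suc i))"
    using assms L0 Ln tL by (auto simp: t_def less_Suc_eq)
  then have "indep_vars (\<lambda>_. borel) D {..<Suc n}"
    using bm unfolding brownian_motion_def D_def by blast
  from indep_var_restrict[OF this, of "{..<n}" "{n}"]
  have "indep_var (PiM {..<n} (\<lambda>_. borel)) (\<lambda>\<omega>. restrict (\<lambda>i. D i \<omega>) {..<n}) (PiM {n} (\<lambda>_. borel))
    (\<lambda>\<omega>. restrict (\<lambda>i. D i \<omega>) {n})"
    by auto
  \<comment> \<open>The entry at \<open>r\<close> telescopes: it adds up the increments that start
    before \<open>r\<close>.\<close>
  then have "indep_var (PiM R (\<lambda>_. borel)) ((\<lambda>d. \<lambda>r\<in>R. \<Sum>i\<in>{i. i < n \<and> t i < r}. d i) \<circ> (\<lambda>\<omega>. restrict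
    (\<lambda>i. D i \<omega>) {..<n}))
      (PiM {b} (\<lambda>_. borel)) ((\<lambda>d. \<lambda>_\<in>{b}. d n) \<circ> (\<lambda>\<omega>. restrict (\<lambda>i. D i \<omega>) {n}))"
  proof (rule indep_var_compose)
    show "(\<lambda>d. \<lambda>r\<in>R. \<Sum>i\<in>{i. i < n \<and> t i < r}. d i :: real) \<in> PiM {..<n} (\<lambda>_. borel) \<rightarrow>\<^sub>M PiM R (\<lambda>_. borel)"
    proof (rule measurable_restrict)
      show "(\<lambda>d. \<Sum>i\<in>{i. i < n \<and> t i < r}. d i :: real) \<in> borel_measurable (PiM {..<n} (\<lambda>_. borel))"
        for r :: real
        by (rule borel_measurable_sum, rule measurable_component_singleton) auto
    qed
    show "(\<lambda>d. \<lambda>_\<in>{b}. d n :: real) \<in> PiM {n} (\<lambda>_. borel) \<rightarrow>\<^sub>M PiM {b} (\<lambda>_. borel)"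
      by (intro measurable_restrict measurable_component_singleton) auto
  qed
  moreover have "(\<lambda>d. \<lambda>r\<in>R. \<Sum>i\<in>{i. i < n \<and> t i < r}. d i) \<circ> (\<lambda>\<omega>. restrict (\<lambda>i. D i \<omega>) {..<n}) = past s R"
  proof (intro ext)
    fix \<omega> r
    show "((\<lambda>d. \<lambda>r\<in>R. \<Sum>i\<in>{i. i < n \<and> t i < r}. d i) \<circ> (\<lambda>\<omega>. restrict (\<lambda>i. D i \<omega>) {..<n})) \<omega> r = past s R \<omega> r"
    proof (cases "r \<in> R")
      case True
      then obtain p where p: "p \<le> n" "L ! p = r" using setL lenL by (metis UnCI in_set_conv_nth
        less_Suc_eq_le)
      have "{i. i < n \<and> t i < r} = {..<p}"
      proof safe
        fix i assume "i < n" "t i < r"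
        then show "i < p" using p mono[of p i] by (auto simp: t_def not_less[symmetric] intro!: leI)
      next
        fix i assume "i < p"
        then show "i < n" "t i < r" using p tL[of i p] by (auto simp: t_def)
      qed
      moreover have "(\<Sum>i<p. D i \<omega>) = W (t p) \<omega> - W (t 0) \<omega>"
        unfolding D_def by (rule sum_lessThan_telescope)
      ultimately show ?thesis using True p L0 by (simp add: past_def t_def)
    qed (simp add: past_def)
  qed
  moreover have "(\<lambda>d. \<lambda>_\<in>{b}. d n) \<circ> (\<lambda>\<omega>. restrict (\<lambda>i. D i \<omega>) {n}) = (\<lambda>\<omega>. \<lambda>_\<in>{b}. W b \<omega> - W a \<omega>)"
    by (auto simp: D_def t_def Ln fun_eq_iff)
  ultimately show ?thesis by simp
qed

lemma indep_set_commute: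
  assumes "indep_set A B" shows "indep_set B A"
proof (rule indep_setI)
  show "B \<subseteq> events" "A \<subseteq> events" using assms by (auto simp: indep_sets2_eq)
  show "prob (b \<inter> a) = prob b * prob a" if "b \<in> B" "a \<in> A" for a b
    using indep_setD[OF assms that(2,1)] by (simp add: Int_commute mult.commute)
qed

text \<open>Independence holds on two intersection-stable families, the cylinder events
  \<open>G\<close> of the past and the events \<open>H\<close> of the increment, and passes to the
  generated sigma-algebras. The first of these contains the filtration at time
  \<open>a\<close>.\<close>

lemma increment_indep_filtration:
  assumes "0 \<le> s" "s \<le> a" "a < b" and f: "f \<in> borel_measurable (increment_filtration M W s a)"
  shows "indep_var borel (\<lambda>\<omega>. W b \<omega> - W a \<omega>) borel (f :: 'w \<Rightarrow> real)"
proof -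
  define D where "D = (\<lambda>\<omega>. W b \<omega> - W a \<omega>)"
  have [measurable]: "D \<in> borel_measurable M" using assms by (auto simp: D_def)
  have fM [measurable]: "f \<in> borel_measurable M" using filtration_measurable[OF f] assms by simp
  \<comment> \<open>Agreement with a cylinder is required only almost everywhere, so that the null
    sets added by the augmentation belong to \<open>G\<close>.\<close>
  define G where "G = {A \<in> sets M. \<exists>R B. finite R \<and> R \<subseteq> {s..a} \<and> B \<in> sets (PiM R (\<lambda>_. borel)) \<and>
      (AE \<omega> in M. \<omega> \<in> A \<longleftrightarrow> past s R \<omega> \<in> B)}"
  define H where "H = {D -` C \<inter> space M | C. C \<in> sets (borel :: real measure)}"
  have HM: "H \<subseteq> sets M" by (auto simp: H_def)
  have "Int_stable G"
  proof (rule Int_stableI)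
    fix A A' assume "A \<in> G" "A' \<in> G"
    then obtain R B R' B' where h: "A \<in> sets M" "A' \<in> sets M" "finite R" "R \<subseteq> {s..a}" "B \<in> sets (PiM
      R (\<lambda>_. borel))"
      "AE \<omega> in M. \<omega> \<in> A \<longleftrightarrow> past s R \<omega> \<in> B" "finite R'" "R' \<subseteq> {s..a}" "B' \<in> sets (PiM R' (\<lambda>_. borel))"
      "AE \<omega> in M. \<omega> \<in> A' \<longleftrightarrow> past s R' \<omega> \<in> B'" by (auto simp: G_def)
    let ?R = "R \<union> R'"
    define C where "C = ((\<lambda>x. restrict x R) -` B \<inter> (\<lambda>x. restrict x R') -` B') \<inter> space (PiM ?R (\<lambda>_.
      borel :: real measure))"
    have "C = ((\<lambda>x. restrict x R) -` B \<inter> space (PiM ?R (\<lambda>_. borel))) \<inter> ((\<lambda>x. restrict x R') -` B' \<inter>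
      space (PiM ?R (\<lambda>_. borel)))"
      by (auto simp: C_def)
    also have "\<dots> \<in> sets (PiM ?R (\<lambda>_. borel))"
      by (intro sets.Int measurable_sets[OF measurable_restrict_subset h(5)] measurable_sets[OF
        measurable_restrict_subset h(9)]) auto
    finally have C: "C \<in> sets (PiM ?R (\<lambda>_. borel))" .
    have e: "past s ?R \<omega> \<in> C \<longleftrightarrow> past s R \<omega> \<in> B \<and> past s R' \<omega> \<in> B'" for \<omega>
    proof -
      have "restrict (past s ?R \<omega>) R = past s R \<omega>" "restrict (past s ?R \<omega>) R' = past s R' \<omega>"
        by (auto simp: past_def fun_eq_iff)
      moreover have "past s ?R \<omega> \<in> space (PiM ?R (\<lambda>_. borel))" by (auto simp: space_PiM past_def)
      ultimately show ?thesis by (auto simp: C_def)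
    qed
    have "AE \<omega> in M. \<omega> \<in> A \<inter> A' \<longleftrightarrow> past s ?R \<omega> \<in> C"
      using h(6) h(10) by eventually_elim (auto simp: e)
    then show "A \<inter> A' \<in> G"
      unfolding G_def using h C by (intro CollectI conjI exI[of _ ?R] exI[of _ C]) auto
  qed
  have "Int_stable H"
  proof (rule Int_stableI)
    fix A A' assume "A \<in> H" "A' \<in> H"
    then obtain C C' where "C \<in> sets borel" "C' \<in> sets borel" "A = D -` C \<inter> space M" "A' = D -` C' \<inter> space M"
      by (auto simp: H_def)
    then show "A \<inter> A' \<in> H" unfolding H_def by (intro CollectI exI[of _ "C \<inter> C'"]) auto
  qed
  have "indep_set G H"
  proof (rule indep_setI)
    show "G \<subseteq> events" "H \<subseteq> events" using HM by (auto simp: G_def)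
    fix A E assume "A \<in> G" "E \<in> H"
    then obtain R B C where h: "A \<in> sets M" "finite R" "R \<subseteq> {s..a}" "B \<in> sets (PiM R (\<lambda>_. borel))"
      "AE \<omega> in M. \<omega> \<in> A \<longleftrightarrow> past s R \<omega> \<in> B" "C \<in> sets borel" "E = D -` C \<inter> space M" by (auto simp: G_def H_def)
    have pm: "past s R \<in> M \<rightarrow>\<^sub>M PiM R (\<lambda>_. borel)" by (rule past_measurable) (use h assms in auto)
    have iv: "indep_var (PiM R (\<lambda>_. borel)) (past s R) (PiM {b} (\<lambda>_. borel)) (\<lambda>\<omega>. \<lambda>_\<in>{b}. D \<omega>)"
      unfolding D_def by (rule past_indep) (use h assms in auto)
    define C' where "C' = (\<lambda>x. x b) -` C \<inter> space (PiM {b} (\<lambda>_. borel :: real measure))"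
    have C': "C' \<in> sets (PiM {b} (\<lambda>_. borel))"
      unfolding C'_def by (intro measurable_sets[OF measurable_component_singleton]) (use h in auto)
    have DC: "(\<lambda>_\<in>{b}. D \<omega>) \<in> C' \<longleftrightarrow> D \<omega> \<in> C" for \<omega> by (auto simp: C'_def space_PiM)
    have P: "past s R -` B \<inter> space M \<in> sets M" using pm h by (auto intro: measurable_sets)
    have E: "E \<in> sets M" using h by auto
    have "prob (A \<inter> E) = prob ((past s R -` B \<inter> space M) \<inter> E)"
      by (rule finite_measure_eq_AE) (use h(1,5) E P in \<open>auto elim: eventually_mono\<close>)
    also have "(past s R -` B \<inter> space M) \<inter> E = (\<lambda>x. (past s R x, \<lambda>_\<in>{b}. D x)) -` (B \<times> C') \<inter> space M"
      using h DC by auto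
    also have "prob \<dots> = prob (past s R -` B \<inter> space M) * prob ((\<lambda>\<omega>. \<lambda>_\<in>{b}. D \<omega>) -` C' \<inter> space M)"
      by (rule indep_varD[OF iv h(4) C'])
    also have "(\<lambda>\<omega>. \<lambda>_\<in>{b}. D \<omega>) -` C' = D -` C"
      using DC by auto
    also have "prob (past s R -` B \<inter> space M) = prob A"
      by (rule finite_measure_eq_AE) (use h(1,5) P in \<open>auto elim: eventually_mono\<close>)
    finally show "prob (A \<inter> E) = prob A * prob E" using h by simp
  qed
  from indep_set_sigma_sets[OF this \<open>Int_stable G\<close> \<open>Int_stable H\<close>]
  have ind: "indep_set (sigma_sets (space M) G) (sigma_sets (space M) H)" .
  have "increment_events s a \<subseteq> G"
  proof
    fix A assume A: "A \<in> increment_events s a"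
    then have AM: "A \<in> sets M" using increment_events_sets[of s a] assms by auto
    consider r B where "s \<le> r" "r \<le> a" "B \<in> sets borel" "A = (\<lambda>\<omega>. W r \<omega> - W s \<omega>) -` B \<inter> space M" |
      "A \<in> null_sets M"
      using A unfolding increment_events_def by blast
    then show "A \<in> G"
    proof cases
      case 1
      have "(\<lambda>x. x r) -` B \<inter> space (PiM {r} (\<lambda>_. borel :: real measure)) \<in> sets (PiM {r} (\<lambda>_. borel))"
        by (intro measurable_sets[OF measurable_component_singleton]) (use 1 in auto)
      then show ?thesis unfolding G_def using 1 AM
        by (intro CollectI conjI exI[of _ "{r}"] exI[of _ "(\<lambda>x. x r) -` B \<inter> space (PiM {r} (\<lambda>_.
          borel :: real measure))"])
          (auto simp: past_def space_PiM)
    next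
      case 2
      \<comment> \<open>A null set agrees almost everywhere with the empty cylinder.\<close>
      then show ?thesis unfolding G_def using AM AE_not_in[OF 2]
        by (intro CollectI conjI exI[of _ "{}"]) (auto)
    qed
  qed
  then have FG: "sets (increment_filtration M W s a) \<subseteq> sigma_sets (space M) G"
    unfolding sets_filtration by (rule sigma_sets_mono')
  have GP: "G \<subseteq> Pow (space M)" using sets.sets_into_space by (auto simp: G_def)
  interpret SG: sigma_algebra "space M" "sigma_sets (space M) G" by (rule sigma_algebra_sigma_sets[OF GP])
  have "sigma_sets (space M) {f -` A \<inter> space M | A. A \<in> sets borel} \<subseteq> sigma_sets (space M) G"
  proof (rule SG.sigma_sets_subset)
    have "f -` A \<inter> space M \<in> sets (increment_filtration M W s a)" if "A \<in> sets borel" for A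
      using measurable_sets[OF f that] by simp
    then show "{f -` A \<inter> space M | A. A \<in> sets borel} \<subseteq> sigma_sets (space M) G" using FG by auto
  qed
  then have "indep_set (sigma_sets (space M) {f -` A \<inter> space M | A. A \<in> sets borel}) (sigma_sets
    (space M) {D -` A \<inter> space M | A. A \<in> sets borel})"
    using ind unfolding indep_sets2_eq H_def[symmetric] by blast
  then have "indep_set (sigma_sets (space M) {D -` A \<inter> space M | A. A \<in> sets borel}) (sigma_sets
    (space M) {f -` A \<inter> space M | A. A \<in> sets borel})"
    by (rule indep_set_commute)
  then show ?thesis unfolding D_def[symmetric] by (simp add: indep_var_eq)
qed

section \<open>Isometry for integrals of simple processes\<close>

lemma increment_moments:
  assumes "0 \<le> a" "a < b"
  shows "integrable M (\<lambda>\<omega>. W b \<omega> - W a \<omega>)" "integrable M (\<lambda>\<omega>. (W b \<omega> - W a \<omega>)\<^sup>2)"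
    "expectation (\<lambda>\<omega>. W b \<omega> - W a \<omega>) = 0" "expectation (\<lambda>\<omega>. (W b \<omega> - W a \<omega>)\<^sup>2) = b - a"
proof -
  define D where "D = (\<lambda>\<omega>. W b \<omega> - W a \<omega>)"
  have dist: "distributed M lborel D (normal_density 0 (sqrt (b - a)))"
    using bm assms unfolding brownian_motion_def D_def by blast
  have s: "0 < sqrt (b - a)" using assms by simp
  show "integrable M (\<lambda>\<omega>. W b \<omega> - W a \<omega>)"
    using integrable_normal_moment_nz_1[OF s, of 0] distributed_integrable[OF dist, of "\<lambda>x. x"]
    by (simp add: D_def)
  show "integrable M (\<lambda>\<omega>. (W b \<omega> - W a \<omega>)\<^sup>2)"
    using integrable_normal_moment[OF s, of 0 2] distributed_integrable[OF dist, of "\<lambda>x. x\<^sup>2"]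
    by (simp add: D_def)
  show e: "expectation (\<lambda>\<omega>. W b \<omega> - W a \<omega>) = 0"
    using normal_distributed_expectation[OF s dist] by (simp add: D_def)
  show "expectation (\<lambda>\<omega>. (W b \<omega> - W a \<omega>)\<^sup>2) = b - a"
    using normal_distributed_variance[OF s dist] e assms by (simp add: D_def)
qed

text \<open>Expanding the square leaves a cross term and a quadratic term. The increment is
  independent of what is known at time \<open>a\<close>: the cross term vanishes as the increment is
  centred, and the quadratic term factors with variance \<open>b - a\<close>. The case
  \<open>a = b\<close> is separate because nodes of a simple process may coincide.\<close>

lemma increment_step:
  fixes X z :: "'w \<Rightarrow> 'a::euclidean_space"
  assumes s: "0 \<le> s" "s \<le> a" "a \<le> b"
    and X: "X \<in> borel_measurable (increment_filtration M W s a)" "integrable M (\<lambda>\<omega>. (norm (X \<omega>))\<^sup>2)"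
    and z: "z \<in> borel_measurable (increment_filtration M W s a)" "integrable M (\<lambda>\<omega>. (norm (z \<omega>))\<^sup>2)"
  shows "integrable M (\<lambda>\<omega>. (norm (X \<omega> + (W b \<omega> - W a \<omega>) *\<^sub>R z \<omega>))\<^sup>2)"
    and "expectation (\<lambda>\<omega>. (norm (X \<omega> + (W b \<omega> - W a \<omega>) *\<^sub>R z \<omega>))\<^sup>2)
       = expectation (\<lambda>\<omega>. (norm (X \<omega>))\<^sup>2) + (b - a) * expectation (\<lambda>\<omega>. (norm (z \<omega>))\<^sup>2)"
proof -
  have [measurable]: "X \<in> borel_measurable M" "z \<in> borel_measurable M"
    using X z s filtration_measurable by auto
  have "integrable M (\<lambda>\<omega>. (norm (X \<omega> + (W b \<omega> - W a \<omega>) *\<^sub>R z \<omega>))\<^sup>2) \<and>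
    expectation (\<lambda>\<omega>. (norm (X \<omega> + (W b \<omega> - W a \<omega>) *\<^sub>R z \<omega>))\<^sup>2)
       = expectation (\<lambda>\<omega>. (norm (X \<omega>))\<^sup>2) + (b - a) * expectation (\<lambda>\<omega>. (norm (z \<omega>))\<^sup>2)"
  proof (cases "a = b")
    case True
    then show ?thesis using X by simp
  next
    case False
    then have ab: "a < b" using s by simp
    have a0: "0 \<le> a" using s by simp
    note mom = increment_moments[OF a0 ab]
    have i1: "integrable M (\<lambda>\<omega>. X \<omega> \<bullet> z \<omega>)"
    proof (rule Bochner_Integration.integrable_bound[OF Bochner_Integration.integrable_add[OF X(2) z(2)]])
      show "AE \<omega> in M. norm (X \<omega> \<bullet> z \<omega>) \<le> norm ((norm (X \<omega>))\<^sup>2 + (norm (z \<omega>))\<^sup>2)"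
      proof (intro AE_I2)
        fix \<omega>
        have "\<bar>X \<omega> \<bullet> z \<omega>\<bar> \<le> norm (X \<omega>) * norm (z \<omega>)" by (rule Cauchy_Schwarz_ineq2)
        also have "\<dots> \<le> (norm (X \<omega>))\<^sup>2 + (norm (z \<omega>))\<^sup>2"
          using sum_squares_bound[of "norm (X \<omega>)" "norm (z \<omega>)"] mult_nonneg_nonneg[OF
            norm_ge_zero[of "X \<omega>"] norm_ge_zero[of "z \<omega>"]] by linarith
        finally show "norm (X \<omega> \<bullet> z \<omega>) \<le> norm ((norm (X \<omega>))\<^sup>2 + (norm (z \<omega>))\<^sup>2)" by simp
      qed
    qed simp
    have ind1: "indep_var borel (\<lambda>\<omega>. W b \<omega> - W a \<omega>) borel (\<lambda>\<omega>. X \<omega> \<bullet> z \<omega>)"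
      by (rule increment_indep_filtration[OF s(1,2) ab borel_measurable_inner[OF X(1) z(1)]])
    have "indep_var borel (\<lambda>\<omega>. W b \<omega> - W a \<omega>) borel (\<lambda>\<omega>. (norm (z \<omega>))\<^sup>2)"
      by (rule increment_indep_filtration[OF s(1,2) ab borel_measurable_power[OF
        measurable_compose[OF z(1) borel_measurable_norm]]])
    then have "indep_var borel ((\<lambda>x. x\<^sup>2) \<circ> (\<lambda>\<omega>. W b \<omega> - W a \<omega>)) borel ((\<lambda>x. x) \<circ> (\<lambda>\<omega>. (norm (z \<omega>))\<^sup>2))"
      by (rule indep_var_compose) auto
    then have ind2: "indep_var borel (\<lambda>\<omega>. (W b \<omega> - W a \<omega>)\<^sup>2) borel (\<lambda>\<omega>. (norm (z \<omega>))\<^sup>2)"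
      unfolding comp_def .
    have j1: "integrable M (\<lambda>\<omega>. (W b \<omega> - W a \<omega>) * (X \<omega> \<bullet> z \<omega>))"
      by (rule indep_var_integrable[OF ind1 mom(1) i1])
    have j2: "integrable M (\<lambda>\<omega>. (W b \<omega> - W a \<omega>)\<^sup>2 * (norm (z \<omega>))\<^sup>2)"
      by (rule indep_var_integrable[OF ind2 mom(2) z(2)])
    have e1: "expectation (\<lambda>\<omega>. (W b \<omega> - W a \<omega>) * (X \<omega> \<bullet> z \<omega>)) = 0"
      using indep_var_lebesgue_integral[OF ind1 mom(1) i1] mom by simp
    have e2: "expectation (\<lambda>\<omega>. (W b \<omega> - W a \<omega>)\<^sup>2 * (norm (z \<omega>))\<^sup>2) = (b - a) * expectation (\<lambda>\<omega>.
      (norm (z \<omega>))\<^sup>2)"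
      using indep_var_lebesgue_integral[OF ind2 mom(2) z(2)] mom by simp
    have ex: "(norm (X \<omega> + (W b \<omega> - W a \<omega>) *\<^sub>R z \<omega>))\<^sup>2 =
        (norm (X \<omega>))\<^sup>2 + (2 * ((W b \<omega> - W a \<omega>) * (X \<omega> \<bullet> z \<omega>)) + (W b \<omega> - W a \<omega>)\<^sup>2 * (norm (z \<omega>))\<^sup>2)" for \<omega>
      unfolding power2_norm_eq_inner
      by (simp add: inner_add_left inner_add_right inner_commute power2_eq_square)
    show ?thesis unfolding ex using X(2) j1 j2 e1 e2 by simp
  qed
  then show "integrable M (\<lambda>\<omega>. (norm (X \<omega> + (W b \<omega> - W a \<omega>) *\<^sub>R z \<omega>))\<^sup>2)"
    and "expectation (\<lambda>\<omega>. (norm (X \<omega> + (W b \<omega> - W a \<omega>) *\<^sub>R z \<omega>))\<^sup>2)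
       = expectation (\<lambda>\<omega>. (norm (X \<omega>))\<^sup>2) + (b - a) * expectation (\<lambda>\<omega>. (norm (z \<omega>))\<^sup>2)" by auto
qed

abbreviation path_measure :: "real \<Rightarrow> real \<Rightarrow> (real \<times> 'w) measure" where
  "path_measure a b \<equiv> time_interval a b \<Otimes>\<^sub>M M"

lemma sqn_pair:
  fixes f :: "real \<times> 'w \<Rightarrow> 'a::euclidean_space"
  assumes [measurable]: "f \<in> borel_measurable (path_measure a b)"
  shows "sqn (path_measure a b) f = (\<integral>\<^sup>+ t. sqn M (\<lambda>\<omega>. f (t, \<omega>)) \<partial>time_interval a b)"
  unfolding sqn_def by (subst nn_integral_fst[symmetric]) auto

lemma simple_data_mono:
  assumes "simple_data M W a b m s z" "i \<le> j" "j \<le> m"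
  shows "s i \<le> s j"
  using assms(2,3)
proof (induction j)
  case (Suc j)
  then show ?case using assms(1) by (cases "i = Suc j") (auto simp: simple_data_def intro: order_trans)
qed simp

lemma simple_data_bounds:
  assumes "simple_data M W a b m s z" "i \<le> m"
  shows "a \<le> s i" "s i \<le> b"
  using simple_data_mono[OF assms(1), of 0 i] simple_data_mono[OF assms(1), of i m] assms
  by (auto simp: simple_data_def)

lemma simple_data_measurable:
  assumes "simple_data M W a b m s z" "0 \<le> a" "i < m"
  shows "z i \<in> borel_measurable M"
  using assms filtration_measurable[of "z i" a "s i"] by (simp add: simple_data_def)

lemma simple_value_measurable [measurable]:
  fixes z :: "nat \<Rightarrow> 'w \<Rightarrow> 'a::euclidean_space"
  assumes "simple_data M W a b m s z" "0 \<le> a"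
  shows "case_prod (simple_value m s z) \<in> borel_measurable (path_measure a b)"
proof -
  have [measurable]: "i < m \<Longrightarrow> z i \<in> borel_measurable M" for i using simple_data_measurable[OF assms] .
  have [measurable]: "(\<lambda>p. indicator {s i<..s (Suc i)} (fst p) :: real) \<in> borel_measurable
    (path_measure a b)" for i
  proof (rule measurable_compose[OF measurable_fst])
    show "indicator {s i<..s (Suc i)} \<in> borel_measurable (time_interval a b)"
      unfolding time_interval_def by (rule measurable_restrict_space1) simp
  qed
  show ?thesis unfolding simple_value_def[abs_def] case_prod_beta
    by (intro borel_measurable_sum borel_measurable_scaleR) auto
qed

lemma simple_integral_measurable:
  fixes z :: "nat \<Rightarrow> 'w \<Rightarrow> 'a::euclidean_space"
  assumes "simple_data M W a b m s z" "0 \<le> a"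
  shows "simple_integral W m s z \<in> borel_measurable M"
  unfolding simple_integral_def[abs_def]
proof (intro borel_measurable_sum borel_measurable_scaleR borel_measurable_diff)
  fix i assume "i \<in> {..<m}"
  then show "W (s (Suc i)) \<in> borel_measurable M" "W (s i) \<in> borel_measurable M" "z i \<in> borel_measurable M"
    using simple_data_measurable[OF assms] simple_data_bounds[OF assms(1), of i]
      simple_data_bounds[OF assms(1), of "Suc i"] assms(2)
    by auto
qed

text \<open>The intervals are disjoint, so at any \<open>r\<close> at most one summand is nonzero
  and squaring produces no cross terms.\<close>

lemma norm_simple_value:
  fixes z :: "nat \<Rightarrow> 'w \<Rightarrow> 'a::euclidean_space"
  assumes "\<forall>i<m. s i \<le> s (Suc i)"
  shows "(norm (simple_value m s z r \<omega>))\<^sup>2 = (\<Sum>i<m. indicator {s i<..s (Suc i)} r * (norm (z i \<omega>))\<^sup>2)"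
  using assms
proof (induction m)
  case (Suc m)
  have mono: "s i \<le> s m" if "i \<le> m" for i
    using that Suc.prems
  proof (induction rule: inc_induct)
    case (step n) then show ?case by (meson less_Suc_eq order_trans)
  qed simp
  show ?case
  proof (cases "r \<in> {s m<..s (Suc m)}")
    case True
    have "indicator {s i<..s (Suc i)} r = (0::real)" if "i < m" for i
      using True mono[of "Suc i"] that by (auto simp: indicator_def)
    then show ?thesis using True by (simp add: simple_value_def)
  next
    case False
    then show ?thesis using Suc by (simp add: simple_value_def)
  qed
qed (simp add: simple_value_def)

lemma sqn_simple_value:
  fixes z :: "nat \<Rightarrow> 'w \<Rightarrow> 'a::euclidean_space"
  assumes sd: "simple_data M W a b m s z" and a: "0 \<le> a"
  shows "sqn (path_measure a b) (case_prod (simple_value m s z)) = ennreal (\<Sum>i<m. (s (Suc i) - s i)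
    * expectation (\<lambda>\<omega>. (norm (z i \<omega>))\<^sup>2))"
proof -
  have m: "\<forall>i<m. s i \<le> s (Suc i)" using sd by (simp add: simple_data_def)
  have int: "integrable M (\<lambda>\<omega>. (norm (z i \<omega>))\<^sup>2)" if "i < m" for i using sd that by (simp add:
    simple_data_def)
  have [measurable]: "z i \<in> borel_measurable M" if "i < m" for i using simple_data_measurable[OF sd a that] .
  have "sqn (path_measure a b) (case_prod (simple_value m s z)) = (\<integral>\<^sup>+ t. sqn M (simple_value m s z
    t) \<partial>time_interval a b)"
    by (subst sqn_pair) (auto intro: simple_value_measurable sd a)
  also have "\<dots> = (\<integral>\<^sup>+ t. (\<Sum>i<m. ennreal (expectation (\<lambda>\<omega>. (norm (z i \<omega>))\<^sup>2)) * indicator {s i<..s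
    (Suc i)} t) \<partial>time_interval a b)"
  proof (rule nn_integral_cong)
    fix t
    have "sqn M (simple_value m s z t) = (\<integral>\<^sup>+ \<omega>. (\<Sum>i<m. indicator {s i<..s (Suc i)} t * ennreal
      ((norm (z i \<omega>))\<^sup>2)) \<partial>M)"
      unfolding sqn_def norm_simple_value[OF m]
    proof (intro nn_integral_cong)
      fix \<omega>
      have "ennreal (\<Sum>i<m. indicator {s i<..s (Suc i)} t * (norm (z i \<omega>))\<^sup>2) = (\<Sum>i<m. ennreal
        (indicator {s i<..s (Suc i)} t * (norm (z i \<omega>))\<^sup>2))"
        by (rule sum_ennreal[symmetric]) simp
      also have "\<dots> = (\<Sum>i<m. indicator {s i<..s (Suc i)} t * ennreal ((norm (z i \<omega>))\<^sup>2))"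
        by (intro sum.cong) (auto split: split_indicator)
      finally show "ennreal (\<Sum>i<m. indicator {s i<..s (Suc i)} t * (norm (z i \<omega>))\<^sup>2) = (\<Sum>i<m.
        indicator {s i<..s (Suc i)} t * ennreal ((norm (z i \<omega>))\<^sup>2))" .
    qed
    also have "\<dots> = (\<Sum>i<m. indicator {s i<..s (Suc i)} t * (\<integral>\<^sup>+ \<omega>. ennreal ((norm (z i \<omega>))\<^sup>2) \<partial>M))"
      by (subst nn_integral_sum) (auto simp: nn_integral_cmult)
    also have "\<dots> = (\<Sum>i<m. ennreal (expectation (\<lambda>\<omega>. (norm (z i \<omega>))\<^sup>2)) * indicator {s i<..s (Suc i)} t)"
      by (intro sum.cong) (auto simp: nn_integral_eq_integral[OF int] mult.commute)
    finally show "sqn M (simple_value m s z t) = (\<Sum>i<m. ennreal (expectation (\<lambda>\<omega>. (norm (z i \<omega>))\<^sup>2))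
      * indicator {s i<..s (Suc i)} t)" .
  qed
  also have "\<dots> = (\<Sum>i<m. ennreal (expectation (\<lambda>\<omega>. (norm (z i \<omega>))\<^sup>2)) * emeasure lborel ({s i<..s
    (Suc i)} \<inter> {a<..<b}))"
  proof -
    have "(\<Sum>i<m. ennreal (expectation (\<lambda>\<omega>. (norm (z i \<omega>))\<^sup>2)) * indicator {s i<..s (Suc i)} t) *
      indicator {a<..<b} t
       = (\<Sum>i<m. ennreal (expectation (\<lambda>\<omega>. (norm (z i \<omega>))\<^sup>2)) * indicator ({s i<..s (Suc i)} \<inter>
         {a<..<b}) t)" for t
      unfolding sum_distrib_right by (intro sum.cong) (auto simp: indicator_inter_arith mult.assoc)
    then show ?thesis unfolding nn_integral_time_interval
      by (simp only:) (subst nn_integral_sum; simp add: nn_integral_cmult_indicator)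
  qed
  also have "\<dots> = (\<Sum>i<m. ennreal ((s (Suc i) - s i) * expectation (\<lambda>\<omega>. (norm (z i \<omega>))\<^sup>2)))"
  proof (rule sum.cong[OF refl])
    fix i assume "i \<in> {..<m}"
    then have b: "a \<le> s i" "s (Suc i) \<le> b" "s i \<le> s (Suc i)"
      using simple_data_bounds[OF sd, of i] simple_data_bounds[OF sd, of "Suc i"] m by auto
    have "emeasure lborel ({s i<..s (Suc i)} \<inter> {a<..<b}) = ennreal (s (Suc i) - s i)"
    \<comment> \<open>Pieces contain their right end point while the time interval is open. An
      interval ending at \<open>b\<close> loses that point, which does not change its
      length.\<close>
    proof (cases "s (Suc i) = b")
      case True
      then have "{s i<..s (Suc i)} \<inter> {a<..<b} = {s i<..<s (Suc i)}" using b by auto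
      then show ?thesis using b by simp
    next
      case False
      then have "{s i<..s (Suc i)} \<inter> {a<..<b} = {s i<..s (Suc i)}" using b by auto
      then show ?thesis using b by simp
    qed
    then show "ennreal (expectation (\<lambda>\<omega>. (norm (z i \<omega>))\<^sup>2)) * emeasure lborel ({s i<..s (Suc i)} \<inter> {a<..<b})
       = ennreal ((s (Suc i) - s i) * expectation (\<lambda>\<omega>. (norm (z i \<omega>))\<^sup>2))"
      using b by (simp add: ennreal_mult mult.commute)
  qed
  also have "\<dots> = ennreal (\<Sum>i<m. (s (Suc i) - s i) * expectation (\<lambda>\<omega>. (norm (z i \<omega>))\<^sup>2))"
    using m by (intro sum_ennreal) (auto intro!: mult_nonneg_nonneg)
  finally show ?thesis .
qed

text \<open>Induction over the nodes: the partial sum up to node \<open>k\<close> is known at time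
  \<open>s k\<close>, so \<open>increment_step\<close> adds the next piece. The constant
  \<open>c\<close> is carried along because the order-zero term of a chaos sum is a constant, and
  this form shows it orthogonal to the integral.\<close>

lemma sqn_simple_integral:
  fixes z :: "nat \<Rightarrow> 'w \<Rightarrow> 'a::euclidean_space"
  assumes sd: "simple_data M W a b m s z" and a: "0 \<le> a"
  shows "sqn M (\<lambda>\<omega>. c + simple_integral W m s z \<omega>) = ennreal ((norm c)\<^sup>2) + sqn (path_measure a b)
    (case_prod (simple_value m s z))"
proof -
  have "k \<le> m \<Longrightarrow> simple_integral W k s z \<in> borel_measurable (increment_filtration M W a (s k)) \<and>
     integrable M (\<lambda>\<omega>. (norm (c + simple_integral W k s z \<omega>))\<^sup>2) \<and>
     expectation (\<lambda>\<omega>. (norm (c + simple_integral W k s z \<omega>))\<^sup>2) = (norm c)\<^sup>2 + (\<Sum>i<k. (s (Suc i) - s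
       i) * expectation (\<lambda>\<omega>. (norm (z i \<omega>))\<^sup>2))" for k
  proof (induction k)
    case 0
    then show ?case by (simp add: simple_integral_def[abs_def] prob_space)
  next
    case (Suc k)
    have b: "a \<le> s k" "s k \<le> s (Suc k)" using simple_data_bounds[OF sd, of k] simple_data_mono[OF
      sd, of k "Suc k"] Suc by auto
    have zk: "z k \<in> borel_measurable (increment_filtration M W a (s k))" "integrable M (\<lambda>\<omega>. (norm (z k \<omega>))\<^sup>2)"
      using sd Suc by (auto simp: simple_data_def)
    have IH: "simple_integral W k s z \<in> borel_measurable (increment_filtration M W a (s k))"
      "integrable M (\<lambda>\<omega>. (norm (c + simple_integral W k s z \<omega>))\<^sup>2)"
      "expectation (\<lambda>\<omega>. (norm (c + simple_integral W k s z \<omega>))\<^sup>2) = (norm c)\<^sup>2 + (\<Sum>i<k. (s (Suc i) -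
        s i) * expectation (\<lambda>\<omega>. (norm (z i \<omega>))\<^sup>2))"
      using Suc by auto
    have cm: "(\<lambda>\<omega>. c + simple_integral W k s z \<omega>) \<in> borel_measurable (increment_filtration M W a (s k))"
      using IH(1) by (intro borel_measurable_add) auto
    have e: "simple_integral W (Suc k) s z = (\<lambda>\<omega>. simple_integral W k s z \<omega> + (W (s (Suc k)) \<omega> - W
      (s k) \<omega>) *\<^sub>R z k \<omega>)"
      by (simp add: simple_integral_def[abs_def])
    have "simple_integral W (Suc k) s z \<in> borel_measurable (increment_filtration M W a (s (Suc k)))"
      unfolding e using b
      by (intro borel_measurable_add borel_measurable_scaleR increment_measurable_filtration
          filtration_measurable_mono[OF IH(1)] filtration_measurable_mono[OF zk(1)]) auto
    then show ?case
      using increment_step[OF a b cm IH(2) zk] IH(3) unfolding e by (simp add: add.assoc)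
  qed
  from this[of m] have i: "integrable M (\<lambda>\<omega>. (norm (c + simple_integral W m s z \<omega>))\<^sup>2)"
    and e: "expectation (\<lambda>\<omega>. (norm (c + simple_integral W m s z \<omega>))\<^sup>2) = (norm c)\<^sup>2 + (\<Sum>i<m. (s (Suc
      i) - s i) * expectation (\<lambda>\<omega>. (norm (z i \<omega>))\<^sup>2))"
    by auto
  have "(\<Sum>i<m. (s (Suc i) - s i) * expectation (\<lambda>\<omega>. (norm (z i \<omega>))\<^sup>2)) \<ge> 0"
    using sd by (intro sum_nonneg mult_nonneg_nonneg) (auto simp: simple_data_def)
  then show ?thesis unfolding sqn_simple_value[OF sd a]
    unfolding sqn_def nn_integral_eq_integral[OF i, simplified] e by (simp add: ennreal_plus)
qed

text \<open>Passing to a finer, strictly increasing set of nodes changes neither the values nor the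
  integral. Two processes given on different nodes can then be added on common ones.\<close>

lemma simple_data_refine:
  fixes z :: "nat \<Rightarrow> 'w \<Rightarrow> 'a::euclidean_space"
  assumes sd: "simple_data M W a b m s z" and a: "0 \<le> a" and q: "q 0 = a" "q k = b" "\<And>i j. i < j \<Longrightarrow> j
    \<le> k \<Longrightarrow> q i < q j"
    and sub: "s ` {..m} \<subseteq> q ` {..k}"
  obtains z' where "simple_data M W a b k q z'" "simple_value k q z' = simple_value m s z"
    "simple_integral W k q z' = simple_integral W m s z"
proof -
  have qm: "q i \<le> q j" if "i \<le> j" "j \<le> k" for i j using q(3)[of i j] that by (cases "i = j") auto
  have "\<forall>j\<in>{..m}. \<exists>i. i \<le> k \<and> q i = s j" using sub by (force simp: image_subset_iff)
  then obtain p where p: "\<And>j. j \<le> m \<Longrightarrow> p j \<le> k \<and> q (p j) = s j" by (metis atMost_iff)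
  have pm: "p j \<le> p (Suc j)" if "j < m" for j
  proof (rule ccontr)
    assume "\<not> p j \<le> p (Suc j)"
    then have "q (p (Suc j)) < q (p j)" using q(3)[of "p (Suc j)" "p j"] p[of j] that by auto
    then show False using p[of j] p[of "Suc j"] that sd by (auto simp: simple_data_def dest!: spec[of _ j])
  qed
  \<comment> \<open>\<open>p j\<close> is the position of the old node \<open>s j\<close> among the
    new ones. The new value on piece \<open>i\<close> is written as a sum over all old pieces that
    cover it, so no covering piece has to be selected.\<close>
  define z' where "z' = (\<lambda>i \<omega>. \<Sum>j<m. if p j \<le> i \<and> i < p (Suc j) then z j \<omega> else 0)"
  have sd': "simple_data M W a b k q z'"
    unfolding simple_data_def
  proof (intro conjI allI impI q(1,2))
    fix i assume i: "i < k"
    then show "q i \<le> q (Suc i)" using qm by simp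
    have *: "(\<lambda>\<omega>. if p j \<le> i \<and> i < p (Suc j) then z j \<omega> else 0) \<in> borel_measurable
      (increment_filtration M W a (q i))
       \<and> integrable M (\<lambda>\<omega>. (norm (if p j \<le> i \<and> i < p (Suc j) then z j \<omega> else 0))\<^sup>2)" if "j < m" for j
    proof (cases "p j \<le> i \<and> i < p (Suc j)")
      case True
      then have "s j \<le> q i" using p[of j] that qm[of "p j" i] i by auto
      then show ?thesis using True sd that filtration_measurable_mono[of "z j" a "s j" "q i"]
        by (auto simp: simple_data_def)
    next
      case False
      then show ?thesis by (simp only: if_False) simp
    qed
    show "z' i \<in> borel_measurable (increment_filtration M W a (q i))"
      unfolding z'_def using * by (intro borel_measurable_sum) auto
    have "l \<le> m \<Longrightarrow> (\<lambda>\<omega>. \<Sum>j<l. if p j \<le> i \<and> i < p (Suc j) then z j \<omega> else 0) \<in> borel_measurable M \<and> 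
      integrable M (\<lambda>\<omega>. (norm (\<Sum>j<l. if p j \<le> i \<and> i < p (Suc j) then z j \<omega> else 0))\<^sup>2)" for l
    proof (induction l)
      case (Suc l)
      let ?f = "\<lambda>\<omega>. \<Sum>j<l. if p j \<le> i \<and> i < p (Suc j) then z j \<omega> else 0"
      let ?g = "\<lambda>\<omega>. if p l \<le> i \<and> i < p (Suc l) then z l \<omega> else 0"
      have f: "?f \<in> borel_measurable M" "integrable M (\<lambda>\<omega>. (norm (?f \<omega>))\<^sup>2)" using Suc by auto
      have g: "?g \<in> borel_measurable M" "integrable M (\<lambda>\<omega>. (norm (?g \<omega>))\<^sup>2)"
        using filtration_measurable[OF conjunct1[OF *] a] conjunct2[OF *] Suc.prems by simp_all
      show ?case
        unfolding sum.lessThan_Suc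
        using integrable_norm2_add[OF f(1) g(1) f(2) g(2)] borel_measurable_add[OF f(1) g(1)] by blast
    qed simp
    then show "integrable M (\<lambda>\<omega>. (norm (z' i \<omega>))\<^sup>2)" unfolding z'_def by blast
  qed
  \<comment> \<open>One telescoping identity serves twice. With \<open>G\<close> a path of
    \<open>W\<close> it compares the integrals. With \<open>G\<close> the indicator of
    \<open>{r..}\<close> it compares the values at \<open>r\<close>, since the indicator of a
    half-open interval is a difference of two such indicators.\<close>
  have tele: "(\<Sum>i<k. (G (q (Suc i)) - G (q i)) *\<^sub>R z' i \<omega>) = (\<Sum>j<m. (G (s (Suc j)) - G (s j)) *\<^sub>R z
    j \<omega>)" for G :: "real \<Rightarrow> real" and \<omega>
  proof -
    have "(\<Sum>i<k. (G (q (Suc i)) - G (q i)) *\<^sub>R z' i \<omega>)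
      = (\<Sum>i<k. \<Sum>j<m. if p j \<le> i \<and> i < p (Suc j) then (G (q (Suc i)) - G (q i)) *\<^sub>R z j \<omega> else 0)"
      unfolding z'_def scaleR_sum_right by (intro sum.cong) auto
    also have "\<dots> = (\<Sum>j<m. \<Sum>i<k. if p j \<le> i \<and> i < p (Suc j) then (G (q (Suc i)) - G (q i)) *\<^sub>R z j \<omega> else 0)"
      by (rule sum.swap)
    also have "\<dots> = (\<Sum>j<m. (G (s (Suc j)) - G (s j)) *\<^sub>R z j \<omega>)"
    proof (rule sum.cong[OF refl])
      fix j assume "j \<in> {..<m}"
      then have j: "j < m" by simp
      have "{i\<in>{..<k}. p j \<le> i \<and> i < p (Suc j)} = {p j..<p (Suc j)}"
        using p[of "Suc j"] j by auto
      then have "(\<Sum>i<k. if p j \<le> i \<and> i < p (Suc j) then (G (q (Suc i)) - G (q i)) *\<^sub>R z j \<omega> else 0)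
         = (\<Sum>i=p j..<p (Suc j). (G (q (Suc i)) - G (q i)) *\<^sub>R z j \<omega>)"
        by (simp add: sum.inter_filter[symmetric])
      also have "\<dots> = (\<Sum>i=p j..<p (Suc j). G (q (Suc i)) - G (q i)) *\<^sub>R z j \<omega>"
        by (rule scaleR_sum_left[symmetric])
      also have "\<dots> = (G (s (Suc j)) - G (s j)) *\<^sub>R z j \<omega>"
        using p[of j] p[of "Suc j"] j by (subst sum_Suc_diff'[OF pm[OF j]]) simp
      finally show "(\<Sum>i<k. if p j \<le> i \<and> i < p (Suc j) then (G (q (Suc i)) - G (q i)) *\<^sub>R z j \<omega> else 0)
         = (G (s (Suc j)) - G (s j)) *\<^sub>R z j \<omega>" .
    qed
    finally show ?thesis .
  qed
  have ind: "indicator {x<..y} r = (indicator {r..} y - indicator {r..} x :: real)" if "x \<le> y" for x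
    y r :: real
    using that by (auto simp: indicator_def)
  have "simple_value k q z' = simple_value m s z"
  proof (intro ext)
    fix r \<omega>
    have "simple_value k q z' r \<omega> = (\<Sum>i<k. (indicator {r..} (q (Suc i)) - indicator {r..} (q i)) *\<^sub>R z' i \<omega>)"
      unfolding simple_value_def using qm by (intro sum.cong) (auto simp: ind)
    also have "\<dots> = (\<Sum>j<m. (indicator {r..} (s (Suc j)) - indicator {r..} (s j)) *\<^sub>R z j \<omega>)" by (rule tele)
    also have "\<dots> = simple_value m s z r \<omega>"
      unfolding simple_value_def using sd by (intro sum.cong) (auto simp: ind simple_data_def)
    finally show "simple_value k q z' r \<omega> = simple_value m s z r \<omega>" .
  qed
  moreover have "simple_integral W k q z' = simple_integral W m s z"
    unfolding simple_integral_def using tele[of "\<lambda>x. W x _"] by (intro ext) blast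
  ultimately show ?thesis using that sd' by blast
qed

lemma simple_data_add:
  fixes z z' :: "nat \<Rightarrow> 'w \<Rightarrow> 'a::euclidean_space"
  assumes sd: "simple_data M W a b m s z" "simple_data M W a b m' s' z'" and a: "0 \<le> a"
  obtains k q y where "simple_data M W a b k q y"
    "\<And>r \<omega>. simple_value k q y r \<omega> = simple_value m s z r \<omega> + simple_value m' s' z' r \<omega>"
    "\<And>\<omega>. simple_integral W k q y \<omega> = simple_integral W m s z \<omega> + simple_integral W m' s' z' \<omega>"
proof -
  define P where "P = s ` {..m} \<union> s' ` {..m'}"
  define L where "L = sorted_list_of_set P"
  define k where "k = length L - 1"
  define q where "q = (\<lambda>i. L ! i)"
  have finP: "finite P" by (simp add: P_def)
  have setL: "set L = P" unfolding L_def by (rule set_sorted_list_of_set[OF finP])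
  have aP: "a \<in> P" "b \<in> P" using sd unfolding P_def simple_data_def by (metis UnI1 atMost_iff imageI
    le0 order_refl)+
  then have lenL: "length L = Suc k" using setL by (cases L) (auto simp: k_def)
  have sL: "sorted_wrt (<) L" by (simp add: L_def)
  have q3: "q i < q j" if "i < j" "j \<le> k" for i j
    using sorted_wrt_nth_less[OF sL that(1)] that(2) lenL by (simp add: q_def)
  have mono: "q i \<le> q j" if "i \<le> j" "j \<le> k" for i j
    using q3[of i j] that by (cases "i = j") auto
  have qP: "q ` {..k} = P"
    unfolding setL[symmetric] set_conv_nth using lenL by (auto simp: q_def less_Suc_eq_le)
  have Pab: "P \<subseteq> {a..b}" using simple_data_bounds[OF sd(1)] simple_data_bounds[OF sd(2)] by (auto simp: P_def)
  obtain i0 where "i0 \<le> k" "q i0 = a" using aP qP by (metis imageE atMost_iff)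
  then have q0: "q 0 = a" using mono[of 0 i0] qP Pab by force
  obtain i1 where "i1 \<le> k" "q i1 = b" using aP qP by (metis imageE atMost_iff)
  then have qk: "q k = b" using mono[of i1 k] qP Pab by force
  obtain y where y: "simple_data M W a b k q y" "simple_value k q y = simple_value m s z"
    "simple_integral W k q y = simple_integral W m s z"
    by (rule simple_data_refine[OF sd(1) a q0 qk q3]) (auto simp: qP P_def)
  obtain y' where y': "simple_data M W a b k q y'" "simple_value k q y' = simple_value m' s' z'"
    "simple_integral W k q y' = simple_integral W m' s' z'"
    by (rule simple_data_refine[OF sd(2) a q0 qk q3]) (auto simp: qP P_def)
  show ?thesis
  proof (rule that[of k q "\<lambda>i \<omega>. y i \<omega> + y' i \<omega>"])
    show "simple_value k q (\<lambda>i \<omega>. y i \<omega> + y' i \<omega>) r \<omega> = simple_value m s z r \<omega> + simple_value m' s'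
      z' r \<omega>" for r \<omega>
      unfolding y(2)[symmetric] y'(2)[symmetric] by (simp add: simple_value_def scaleR_add_right sum.distrib)
    show "simple_integral W k q (\<lambda>i \<omega>. y i \<omega> + y' i \<omega>) \<omega> = simple_integral W m s z \<omega> +
      simple_integral W m' s' z' \<omega>" for \<omega>
      unfolding y(3)[symmetric] y'(3)[symmetric] by (simp add: simple_integral_def scaleR_add_right
        sum.distrib)
    show "simple_data M W a b k q (\<lambda>i \<omega>. y i \<omega> + y' i \<omega>)"
      unfolding simple_data_def
    proof (intro conjI allI impI)
      fix i assume i: "i < k"
      show "(\<lambda>\<omega>. y i \<omega> + y' i \<omega>) \<in> borel_measurable (increment_filtration M W a (q i))"
        using y(1) y'(1) i by (intro borel_measurable_add) (simp_all add: simple_data_def)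
      show "integrable M (\<lambda>\<omega>. (norm (y i \<omega> + y' i \<omega>))\<^sup>2)"
        by (rule integrable_norm2_add) (use y(1) y'(1) i simple_data_measurable[OF y(1) a i]
          simple_data_measurable[OF y'(1) a i] in \<open>auto simp: simple_data_def\<close>)
      show "q i \<le> q (Suc i)" using mono i by simp
    qed (use q0 qk in auto)
  qed
qed

lemma simple_data_scaleR:
  fixes z :: "nat \<Rightarrow> 'w \<Rightarrow> 'a::euclidean_space"
  assumes sd: "simple_data M W a b m s z"
  shows "simple_data M W a b m s (\<lambda>i \<omega>. c *\<^sub>R z i \<omega>)"
    "simple_value m s (\<lambda>i \<omega>. c *\<^sub>R z i \<omega>) r \<omega> = c *\<^sub>R simple_value m s z r \<omega>"
    "simple_integral W m s (\<lambda>i \<omega>. c *\<^sub>R z i \<omega>) \<omega> = c *\<^sub>R simple_integral W m s z \<omega>"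
proof -
  show "simple_data M W a b m s (\<lambda>i \<omega>. c *\<^sub>R z i \<omega>)"
    using sd by (auto simp: simple_data_def power_mult_distrib)
  show "simple_value m s (\<lambda>i \<omega>. c *\<^sub>R z i \<omega>) r \<omega> = c *\<^sub>R simple_value m s z r \<omega>"
    unfolding simple_value_def scaleR_sum_right by (intro sum.cong refl scaleR_left_commute)
  show "simple_integral W m s (\<lambda>i \<omega>. c *\<^sub>R z i \<omega>) \<omega> = c *\<^sub>R simple_integral W m s z \<omega>"
    unfolding simple_integral_def scaleR_sum_right by (intro sum.cong refl scaleR_left_commute)
qed

section \<open>The Ito integral\<close>

lemma L2_adapted_iff:
  fixes \<xi> :: "real \<Rightarrow> 'w \<Rightarrow> 'a::euclidean_space"
  shows "\<xi> \<in> L2_adapted M W S T \<longleftrightarrow> case_prod \<xi> \<in> borel_measurable (path_measure S T) \<and>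
    (\<forall>t\<in>{S<..<T}. \<xi> t \<in> borel_measurable (increment_filtration M W S t)) \<and>
    sqn (path_measure S T) (case_prod \<xi>) < \<infinity>"
  by (simp add: L2_adapted_def sqn_def case_prod_unfold)

lemma L2_adapted_measurable [measurable_dest]:
  "\<xi> \<in> L2_adapted M W S T \<Longrightarrow> case_prod \<xi> \<in> borel_measurable (path_measure S T)"
  by (simp add: L2_adapted_iff)

lemma L2_adapted_at_measurable:
  "\<xi> \<in> L2_adapted M W S T \<Longrightarrow> 0 \<le> S \<Longrightarrow> t \<in> {S<..<T} \<Longrightarrow> \<xi> t \<in> borel_measurable M"
  using filtration_measurable by (auto simp: L2_adapted_iff)

lemma L2_adapted_add:
  fixes \<xi> \<eta> :: "real \<Rightarrow> 'w \<Rightarrow> 'a::euclidean_space"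
  assumes "\<xi> \<in> L2_adapted M W S T" "\<eta> \<in> L2_adapted M W S T"
  shows "(\<lambda>t \<omega>. \<xi> t \<omega> + \<eta> t \<omega>) \<in> L2_adapted M W S T"
  unfolding L2_adapted_iff
proof (intro conjI ballI)
  have m: "case_prod \<xi> \<in> borel_measurable (path_measure S T)" "case_prod \<eta> \<in> borel_measurable
    (path_measure S T)"
    using assms by (auto simp: L2_adapted_iff)
  have e: "(\<lambda>(t, \<omega>). \<xi> t \<omega> + \<eta> t \<omega>) = (\<lambda>p. case_prod \<xi> p + case_prod \<eta> p)" by auto
  show "(\<lambda>(t, \<omega>). \<xi> t \<omega> + \<eta> t \<omega>) \<in> borel_measurable (path_measure S T)"
    unfolding e by (intro borel_measurable_add m)
  show "sqn (path_measure S T) (\<lambda>(t, \<omega>). \<xi> t \<omega> + \<eta> t \<omega>) < \<infinity>"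
    unfolding e by (rule le_less_trans[OF sqn_add_le[OF m]])
      (use assms in \<open>auto simp: L2_adapted_iff ennreal_mult_less_top\<close>)
  fix t assume "t \<in> {S<..<T}"
  then show "(\<lambda>\<omega>. \<xi> t \<omega> + \<eta> t \<omega>) \<in> borel_measurable (increment_filtration M W S t)"
    using assms by (intro borel_measurable_add) (auto simp: L2_adapted_iff)
qed

lemma L2_adapted_scaleR:
  fixes \<xi> :: "real \<Rightarrow> 'w \<Rightarrow> 'a::euclidean_space"
  assumes "\<xi> \<in> L2_adapted M W S T"
  shows "(\<lambda>t \<omega>. c *\<^sub>R \<xi> t \<omega>) \<in> L2_adapted M W S T"
  unfolding L2_adapted_iff
proof (intro conjI ballI)
  have m: "case_prod \<xi> \<in> borel_measurable (path_measure S T)"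
    using assms by (auto simp: L2_adapted_iff)
  have e: "(\<lambda>(t, \<omega>). c *\<^sub>R \<xi> t \<omega>) = (\<lambda>p. c *\<^sub>R case_prod \<xi> p)" by auto
  show "(\<lambda>(t, \<omega>). c *\<^sub>R \<xi> t \<omega>) \<in> borel_measurable (path_measure S T)"
    unfolding e by (intro borel_measurable_scaleR m) simp
  show "sqn (path_measure S T) (\<lambda>(t, \<omega>). c *\<^sub>R \<xi> t \<omega>) < \<infinity>"
    unfolding e sqn_scaleR[OF m] using assms by (auto simp: L2_adapted_iff ennreal_mult_less_top)
  fix t assume "t \<in> {S<..<T}"
  then show "(\<lambda>\<omega>. c *\<^sub>R \<xi> t \<omega>) \<in> borel_measurable (increment_filtration M W S t)"
    using assms by (intro borel_measurable_scaleR) (auto simp: L2_adapted_iff)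
qed

lemma L2_adapted_diff:
  fixes \<xi> \<eta> :: "real \<Rightarrow> 'w \<Rightarrow> 'a::euclidean_space"
  assumes "\<xi> \<in> L2_adapted M W S T" "\<eta> \<in> L2_adapted M W S T"
  shows "(\<lambda>t \<omega>. \<xi> t \<omega> - \<eta> t \<omega>) \<in> L2_adapted M W S T"
  using L2_adapted_add[OF assms(1) L2_adapted_scaleR[OF assms(2), of "-1"]] by simp

lemma L2_adapted_zero: "(\<lambda>t \<omega>. 0::'a::euclidean_space) \<in> L2_adapted M W S T"
  unfolding L2_adapted_iff by (auto simp: sqn_def)

lemma L2_adapted_sum:
  fixes \<xi> :: "nat \<Rightarrow> real \<Rightarrow> 'w \<Rightarrow> 'a::euclidean_space"
  assumes "\<And>n. n < N \<Longrightarrow> \<xi> n \<in> L2_adapted M W S T"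
  shows "(\<lambda>t \<omega>. \<Sum>n<N. \<xi> n t \<omega>) \<in> L2_adapted M W S T"
  using assms by (induction N) (auto intro!: L2_adapted_add L2_adapted_zero)

text \<open>Adaptedness is demanded at every time, not at almost every one. The limit is therefore
  taken pointwise along a subsequence by \<open>lim\<close>, which preserves measurability both on
  the product and at each fixed time.\<close>

lemma L2_adapted_complete:
  fixes \<xi> :: "nat \<Rightarrow> real \<Rightarrow> 'w \<Rightarrow> 'a::euclidean_space"
  assumes \<xi>: "\<And>j. \<xi> j \<in> L2_adapted M W S T"
    and Cauchy: "\<And>e::real. e > 0 \<Longrightarrow> \<exists>N. \<forall>i\<ge>N. \<forall>j\<ge>N. sqn (path_measure S T) (\<lambda>(t, \<omega>). \<xi> i t \<omega> - \<xi> j t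
      \<omega>) < ennreal e"
  obtains \<eta> where "\<eta> \<in> L2_adapted M W S T" "(\<lambda>j. sqn (path_measure S T) (\<lambda>(t, \<omega>). \<xi> j t \<omega> - \<eta> t \<omega>)) \<longlonglongrightarrow> 0"
proof -
  have m: "case_prod (\<xi> j) \<in> borel_measurable (path_measure S T)" for j using \<xi> by (auto simp: L2_adapted_iff)
  have C: "\<exists>N. \<forall>i\<ge>N. \<forall>j\<ge>N. sqn (path_measure S T) (\<lambda>x. case_prod (\<xi> i) x - case_prod (\<xi> j) x) < ennreal e"
    if "e > 0" for e :: real
    using Cauchy[OF that] by (simp add: case_prod_unfold)
  obtain r :: "nat \<Rightarrow> nat" where r: "strict_mono r"
    "(\<lambda>j. sqn (path_measure S T) (\<lambda>x. case_prod (\<xi> j) x - lim (\<lambda>i. case_prod (\<xi> (r i)) x))) \<longlonglongrightarrow> 0"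
    by (rule sqn_complete[of "\<lambda>j. case_prod (\<xi> j)", OF m C], assumption, rule that)
  define \<eta> where "\<eta> = (\<lambda>t \<omega>. lim (\<lambda>i. \<xi> (r i) t \<omega>))"
  have e: "case_prod \<eta> = (\<lambda>x. lim (\<lambda>i. case_prod (\<xi> (r i)) x))" by (auto simp: \<eta>_def)
  have m\<eta>: "case_prod \<eta> \<in> borel_measurable (path_measure S T)"
    unfolding e by (rule borel_measurable_lim_metric) (rule m)
  have "\<forall>\<^sub>F j in sequentially. sqn (path_measure S T) (\<lambda>x. case_prod (\<xi> j) x - case_prod \<eta> x) < 1"
    using r(2) unfolding e by (rule order_tendstoD) simp
  then obtain j where j: "sqn (path_measure S T) (\<lambda>x. case_prod (\<xi> j) x - case_prod \<eta> x) < 1"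
    by (auto simp: eventually_sequentially)
  have "sqn (path_measure S T) (case_prod \<eta>) \<le> 2 * sqn (path_measure S T) (\<lambda>x. case_prod \<eta> x -
    case_prod (\<xi> j) x) + 2 * sqn (path_measure S T) (case_prod (\<xi> j))"
    using sqn_add_le[OF borel_measurable_diff[OF m\<eta> m[of j]] m[of j]] unfolding diff_add_cancel .
  also have "\<dots> < \<infinity>"
  proof -
    have "sqn (path_measure S T) (\<lambda>x. case_prod \<eta> x - case_prod (\<xi> j) x) < \<infinity>"
      unfolding sqn_commute[of _ "case_prod \<eta>"] by (rule less_trans[OF j]) simp
    moreover have "sqn (path_measure S T) (case_prod (\<xi> j)) < \<infinity>" using \<xi>[of j] by (simp add: L2_adapted_iff)
    ultimately show ?thesis by (simp add: ennreal_mult_less_top)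
  qed
  finally have fin: "sqn (path_measure S T) (case_prod \<eta>) < \<infinity>" .
  have "\<eta> \<in> L2_adapted M W S T"
    unfolding L2_adapted_iff
  proof (intro conjI ballI m\<eta> fin)
    fix t assume "t \<in> {S<..<T}"
    then show "\<eta> t \<in> borel_measurable (increment_filtration M W S t)"
      unfolding \<eta>_def using \<xi> by (intro borel_measurable_lim_metric) (auto simp: L2_adapted_iff)
  qed
  moreover have "(\<lambda>j. sqn (path_measure S T) (\<lambda>(t, \<omega>). \<xi> j t \<omega> - \<eta> t \<omega>)) \<longlonglongrightarrow> 0"
    using r(2) by (simp add: \<eta>_def case_prod_unfold)
  ultimately show ?thesis by (rule that)
qed

lemma has_ito_integral_iff:
  fixes \<phi> :: "real \<Rightarrow> 'w \<Rightarrow> 'a::euclidean_space"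
  shows "has_ito_integral M W a b \<phi> X \<longleftrightarrow> \<phi> \<in> L2_adapted M W a b \<and> X \<in> borel_measurable M \<and>
     (\<exists>m s z. (\<forall>j. simple_data M W a b (m j) (s j) (z j)) \<and>
        (\<lambda>j. sqn (path_measure a b) (\<lambda>p. case_prod (simple_value (m j) (s j) (z j)) p - case_prod \<phi> p)) \<longlonglongrightarrow> 0 \<and>
        (\<lambda>j. sqn M (\<lambda>\<omega>. simple_integral W (m j) (s j) (z j) \<omega> - X \<omega>)) \<longlonglongrightarrow> 0)"
  by (simp add: has_ito_integral_def sqn_def case_prod_unfold)

lemma tendsto_mult_ennreal_0:
  fixes f :: "nat \<Rightarrow> ennreal"
  assumes "f \<longlonglongrightarrow> 0" "c < \<infinity>" shows "(\<lambda>j. c * f j) \<longlonglongrightarrow> 0"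
  using ennreal_tendsto_cmult[of c f 0] assms by (auto simp: less_top)

lemma tendsto_0_le_ennreal:
  fixes f g :: "nat \<Rightarrow> ennreal"
  assumes "g \<longlonglongrightarrow> 0" "\<And>j. f j \<le> g j" shows "f \<longlonglongrightarrow> 0"
  by (rule tendsto_sandwich[OF _ _ tendsto_const assms(1)]) (use assms in auto)

lemma tendsto_0_le_sum_ennreal:
  fixes f g h :: "nat \<Rightarrow> ennreal"
  assumes "f \<longlonglongrightarrow> 0" "g \<longlonglongrightarrow> 0" "\<And>j. h j \<le> 2 * f j + 2 * g j" shows "h \<longlonglongrightarrow> 0"
proof (rule tendsto_0_le_ennreal[OF _ assms(3)])
  have "(\<lambda>j. 2 * f j + 2 * g j) \<longlonglongrightarrow> 0 + 0"
    by (intro tendsto_add tendsto_mult_ennreal_0 assms) auto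
  then show "(\<lambda>j. 2 * f j + 2 * g j) \<longlonglongrightarrow> 0" by simp
qed

text \<open>The isometry for simple processes, including the orthogonal constant, passes to the
  limit by \<open>sqn_tendsto\<close> on both sides.\<close>

lemma has_ito_sqn:
  fixes \<phi> :: "real \<Rightarrow> 'w \<Rightarrow> 'a::euclidean_space"
  assumes ito: "has_ito_integral M W a b \<phi> X" and a: "0 \<le> a"
  shows "sqn M (\<lambda>\<omega>. c + X \<omega>) = ennreal ((norm c)\<^sup>2) + sqn (path_measure a b) (case_prod \<phi>)"
proof -
  obtain m s z where sd: "\<And>j. simple_data M W a b (m j) (s j) (z j)"
    and l1: "(\<lambda>j. sqn (path_measure a b) (\<lambda>p. case_prod (simple_value (m j) (s j) (z j)) p -
      case_prod \<phi> p)) \<longlonglongrightarrow> 0"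
    and l2: "(\<lambda>j. sqn M (\<lambda>\<omega>. simple_integral W (m j) (s j) (z j) \<omega> - X \<omega>)) \<longlonglongrightarrow> 0"
    and \<phi>: "\<phi> \<in> L2_adapted M W a b" and X [measurable]: "X \<in> borel_measurable M"
    using ito unfolding has_ito_integral_iff by blast
  have \<phi>m: "case_prod \<phi> \<in> borel_measurable (path_measure a b)" and \<phi>f: "sqn (path_measure a b)
    (case_prod \<phi>) < \<infinity>"
    using \<phi> by (auto simp: L2_adapted_iff)
  note svm = simple_value_measurable[OF sd a]
  note [measurable] = simple_integral_measurable[OF sd a]
  have t1: "(\<lambda>j. sqn (path_measure a b) (case_prod (simple_value (m j) (s j) (z j)))) \<longlonglongrightarrow> sqn
    (path_measure a b) (case_prod \<phi>)"
    by (rule sqn_tendsto[OF svm \<phi>m \<phi>f l1])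
  have "\<forall>\<^sub>F j in sequentially. sqn M (\<lambda>\<omega>. simple_integral W (m j) (s j) (z j) \<omega> - X \<omega>) < 1 \<and> sqn
    (path_measure a b) (case_prod (simple_value (m j) (s j) (z j))) < \<infinity>"
    using order_tendstoD(2)[OF l2, of 1] order_tendstoD(2)[OF t1 \<phi>f] by (auto elim: eventually_elim2)
  then obtain j where j: "sqn M (\<lambda>\<omega>. simple_integral W (m j) (s j) (z j) \<omega> - X \<omega>) < 1" "sqn
    (path_measure a b) (case_prod (simple_value (m j) (s j) (z j))) < \<infinity>"
    by (auto simp: eventually_sequentially)
  \<comment> \<open>A single approximant of finite norm at distance below 1 gives the finiteness
    that \<open>sqn_tendsto\<close> presupposes.\<close>
  have "sqn M (\<lambda>\<omega>. c + X \<omega>) \<le> 2 * sqn M (\<lambda>\<omega>. X \<omega> - simple_integral W (m j) (s j) (z j) \<omega>) + 2 * sqn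
    M (\<lambda>\<omega>. c + simple_integral W (m j) (s j) (z j) \<omega>)"
    using sqn_add_le[of "\<lambda>\<omega>. X \<omega> - simple_integral W (m j) (s j) (z j) \<omega>" M "\<lambda>\<omega>. c + simple_integral
      W (m j) (s j) (z j) \<omega>"]
    by (simp add: algebra_simps)
  also have "\<dots> < \<infinity>"
    using j less_trans[OF j(1), of \<infinity>] unfolding sqn_simple_integral[OF sd a]
    by (simp add: sqn_commute[of M X] ennreal_mult_less_top)
  finally have fin: "sqn M (\<lambda>\<omega>. c + X \<omega>) < \<infinity>" .
  have "(\<lambda>j. sqn M (\<lambda>\<omega>. c + simple_integral W (m j) (s j) (z j) \<omega>)) \<longlonglongrightarrow> sqn M (\<lambda>\<omega>. c + X \<omega>)"
    by (rule sqn_tendsto) (use l2 fin in auto)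
  moreover have "(\<lambda>j. sqn M (\<lambda>\<omega>. c + simple_integral W (m j) (s j) (z j) \<omega>)) \<longlonglongrightarrow> ennreal ((norm c)\<^sup>2)
    + sqn (path_measure a b) (case_prod \<phi>)"
    unfolding sqn_simple_integral[OF sd a] by (intro tendsto_add tendsto_const t1)
  ultimately show ?thesis by (rule LIMSEQ_unique)
qed

lemma has_ito_add:
  fixes \<phi> \<psi> :: "real \<Rightarrow> 'w \<Rightarrow> 'a::euclidean_space"
  assumes "has_ito_integral M W a b \<phi> X" "has_ito_integral M W a b \<psi> Y" and a: "0 \<le> a"
  shows "has_ito_integral M W a b (\<lambda>t \<omega>. \<phi> t \<omega> + \<psi> t \<omega>) (\<lambda>\<omega>. X \<omega> + Y \<omega>)"
proof -
  obtain m s z where sd: "\<And>j. simple_data M W a b (m j) (s j) (z j)"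
    and l1: "(\<lambda>j. sqn (path_measure a b) (\<lambda>p. case_prod (simple_value (m j) (s j) (z j)) p -
      case_prod \<phi> p)) \<longlonglongrightarrow> 0"
    and l2: "(\<lambda>j. sqn M (\<lambda>\<omega>. simple_integral W (m j) (s j) (z j) \<omega> - X \<omega>)) \<longlonglongrightarrow> 0"
    and \<phi>: "\<phi> \<in> L2_adapted M W a b" and X [measurable]: "X \<in> borel_measurable M"
    using assms(1) unfolding has_ito_integral_iff by blast
  obtain m' s' z' where sd': "\<And>j. simple_data M W a b (m' j) (s' j) (z' j)"
    and l1': "(\<lambda>j. sqn (path_measure a b) (\<lambda>p. case_prod (simple_value (m' j) (s' j) (z' j)) p -
      case_prod \<psi> p)) \<longlonglongrightarrow> 0"
    and l2': "(\<lambda>j. sqn M (\<lambda>\<omega>. simple_integral W (m' j) (s' j) (z' j) \<omega> - Y \<omega>)) \<longlonglongrightarrow> 0"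
    and \<psi>: "\<psi> \<in> L2_adapted M W a b" and Y [measurable]: "Y \<in> borel_measurable M"
    using assms(2) unfolding has_ito_integral_iff by blast
  have \<phi>m: "case_prod \<phi> \<in> borel_measurable (path_measure a b)" "case_prod \<psi> \<in> borel_measurable
    (path_measure a b)"
    using \<phi> \<psi> by (auto simp: L2_adapted_iff)
  note svm = simple_value_measurable[OF sd a] simple_value_measurable[OF sd' a]
  note [measurable] = simple_integral_measurable[OF sd a] simple_integral_measurable[OF sd' a]
  have "\<exists>k q y. simple_data M W a b k q y \<and>
    (\<forall>r \<omega>. simple_value k q y r \<omega> = simple_value (m j) (s j) (z j) r \<omega> + simple_value (m' j) (s' j)
      (z' j) r \<omega>) \<and>
    (\<forall>\<omega>. simple_integral W k q y \<omega> = simple_integral W (m j) (s j) (z j) \<omega> + simple_integral W (m'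
      j) (s' j) (z' j) \<omega>)" for j
    by (rule simple_data_add[OF sd[of j] sd'[of j] a]) blast
  then obtain k q y where y: "\<And>j. simple_data M W a b (k j) (q j) (y j)"
    "\<And>j r \<omega>. simple_value (k j) (q j) (y j) r \<omega> = simple_value (m j) (s j) (z j) r \<omega> + simple_value
      (m' j) (s' j) (z' j) r \<omega>"
    "\<And>j \<omega>. simple_integral W (k j) (q j) (y j) \<omega> = simple_integral W (m j) (s j) (z j) \<omega> +
      simple_integral W (m' j) (s' j) (z' j) \<omega>"
    by metis
  have "sqn (path_measure a b) (\<lambda>p. case_prod (simple_value (k j) (q j) (y j)) p - (case p of (t, \<omega>)
    \<Rightarrow> \<phi> t \<omega> + \<psi> t \<omega>))
    \<le> 2 * sqn (path_measure a b) (\<lambda>p. case_prod (simple_value (m j) (s j) (z j)) p - case_prod \<phi> p)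
     + 2 * sqn (path_measure a b) (\<lambda>p. case_prod (simple_value (m' j) (s' j) (z' j)) p - case_prod \<psi> p)" for j
  proof -
    have "(\<lambda>p. case_prod (simple_value (k j) (q j) (y j)) p - (case p of (t, \<omega>) \<Rightarrow> \<phi> t \<omega> + \<psi> t \<omega>))
      = (\<lambda>p. (case_prod (simple_value (m j) (s j) (z j)) p - case_prod \<phi> p) + (case_prod
        (simple_value (m' j) (s' j) (z' j)) p - case_prod \<psi> p))"
      by (auto simp: y fun_eq_iff)
    then show ?thesis
      using sqn_add_le[OF borel_measurable_diff[OF svm(1)[of j] \<phi>m(1)] borel_measurable_diff[OF
        svm(2)[of j] \<phi>m(2)]] by simp
  qed
  then have c1: "(\<lambda>j. sqn (path_measure a b) (\<lambda>p. case_prod (simple_value (k j) (q j) (y j)) p -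
    (case p of (t, \<omega>) \<Rightarrow> \<phi> t \<omega> + \<psi> t \<omega>))) \<longlonglongrightarrow> 0"
    by (rule tendsto_0_le_sum_ennreal[OF l1 l1'])
  have "sqn M (\<lambda>\<omega>. simple_integral W (k j) (q j) (y j) \<omega> - (X \<omega> + Y \<omega>)) \<le>
     2 * sqn M (\<lambda>\<omega>. simple_integral W (m j) (s j) (z j) \<omega> - X \<omega>) + 2 * sqn M (\<lambda>\<omega>. simple_integral W
       (m' j) (s' j) (z' j) \<omega> - Y \<omega>)" for j
    using sqn_add_le[of "\<lambda>\<omega>. simple_integral W (m j) (s j) (z j) \<omega> - X \<omega>" M "\<lambda>\<omega>. simple_integral W
      (m' j) (s' j) (z' j) \<omega> - Y \<omega>"]
    by (simp add: y algebra_simps)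
  then have c2: "(\<lambda>j. sqn M (\<lambda>\<omega>. simple_integral W (k j) (q j) (y j) \<omega> - (X \<omega> + Y \<omega>))) \<longlonglongrightarrow> 0"
    by (rule tendsto_0_le_sum_ennreal[OF l2 l2'])
  show ?thesis
    unfolding has_ito_integral_iff using L2_adapted_add[OF \<phi> \<psi>] y(1) c1 c2 by auto
qed

lemma has_ito_scaleR:
  fixes \<phi> :: "real \<Rightarrow> 'w \<Rightarrow> 'a::euclidean_space"
  assumes "has_ito_integral M W a b \<phi> X" and a: "0 \<le> a"
  shows "has_ito_integral M W a b (\<lambda>t \<omega>. c *\<^sub>R \<phi> t \<omega>) (\<lambda>\<omega>. c *\<^sub>R X \<omega>)"
proof -
  obtain m s z where sd: "\<And>j. simple_data M W a b (m j) (s j) (z j)"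
    and l1: "(\<lambda>j. sqn (path_measure a b) (\<lambda>p. case_prod (simple_value (m j) (s j) (z j)) p -
      case_prod \<phi> p)) \<longlonglongrightarrow> 0"
    and l2: "(\<lambda>j. sqn M (\<lambda>\<omega>. simple_integral W (m j) (s j) (z j) \<omega> - X \<omega>)) \<longlonglongrightarrow> 0"
    and \<phi>: "\<phi> \<in> L2_adapted M W a b" and X [measurable]: "X \<in> borel_measurable M"
    using assms(1) unfolding has_ito_integral_iff by blast
  have \<phi>m: "case_prod \<phi> \<in> borel_measurable (path_measure a b)"
    using \<phi> by (auto simp: L2_adapted_iff)
  note svm = simple_value_measurable[OF sd a]
  note [measurable] = simple_integral_measurable[OF sd a]
  let ?z = "\<lambda>j i \<omega>. c *\<^sub>R z j i \<omega>"
  have "(\<lambda>p. case_prod (simple_value (m j) (s j) (?z j)) p - (case p of (t, \<omega>) \<Rightarrow> c *\<^sub>R \<phi> t \<omega>))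
    = (\<lambda>p. c *\<^sub>R (case_prod (simple_value (m j) (s j) (z j)) p - case_prod \<phi> p))" for j
    by (auto simp: simple_data_scaleR[OF sd] scaleR_diff_right fun_eq_iff)
  then have "sqn (path_measure a b) (\<lambda>p. case_prod (simple_value (m j) (s j) (?z j)) p - (case p of
    (t, \<omega>) \<Rightarrow> c *\<^sub>R \<phi> t \<omega>))
    = ennreal (c\<^sup>2) * sqn (path_measure a b) (\<lambda>p. case_prod (simple_value (m j) (s j) (z j)) p -
      case_prod \<phi> p)" for j
    by (simp only: sqn_scaleR[OF borel_measurable_diff[OF svm[of j] \<phi>m]])
  moreover have "sqn M (\<lambda>\<omega>. simple_integral W (m j) (s j) (?z j) \<omega> - c *\<^sub>R X \<omega>)
    = ennreal (c\<^sup>2) * sqn M (\<lambda>\<omega>. simple_integral W (m j) (s j) (z j) \<omega> - X \<omega>)" for j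
    unfolding simple_data_scaleR[OF sd] scaleR_diff_right[symmetric] by (rule sqn_scaleR) measurable
  ultimately show ?thesis
    unfolding has_ito_integral_iff using L2_adapted_scaleR[OF \<phi>] simple_data_scaleR(1)[OF sd]
      tendsto_mult_ennreal_0[OF l1, of "ennreal (c\<^sup>2)"] tendsto_mult_ennreal_0[OF l2, of "ennreal (c\<^sup>2)"]
    by (intro conjI exI[of _ m] exI[of _ s] exI[of _ ?z]) auto
qed

lemma has_ito_simple:
  fixes z :: "nat \<Rightarrow> 'w \<Rightarrow> 'a::euclidean_space"
  assumes sd: "simple_data M W a b m s z" and a: "0 \<le> a"
  shows "has_ito_integral M W a b (simple_value m s z) (simple_integral W m s z)"
proof -
  have "simple_value m s z \<in> L2_adapted M W a b"
    unfolding L2_adapted_iff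
  proof (intro conjI ballI simple_value_measurable[OF sd a])
    show "sqn (path_measure a b) (case_prod (simple_value m s z)) < \<infinity>"
      unfolding sqn_simple_value[OF sd a] by simp
    fix t assume t: "t \<in> {a<..<b}"
    have *: "(\<lambda>\<omega>. indicator {s i<..s (Suc i)} t *\<^sub>R z i \<omega>) \<in> borel_measurable (increment_filtration
      M W a t)" if i: "i < m" for i
    proof (cases "t \<in> {s i<..s (Suc i)}")
      case True
      then show ?thesis using sd i filtration_measurable_mono[of "z i" a "s i" t] by (simp add:
        simple_data_def)
    qed simp
    show "simple_value m s z t \<in> borel_measurable (increment_filtration M W a t)"
      unfolding simple_value_def[abs_def] by (rule borel_measurable_sum) (use * in auto)
  qed
  then show ?thesis unfolding has_ito_integral_iff
    using sd simple_integral_measurable[OF sd a]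
    by (intro conjI exI[of _ "\<lambda>_. m"] exI[of _ "\<lambda>_. s"] exI[of _ "\<lambda>_. z"]) (auto simp: sqn_def)
qed

lemma has_ito_zero:
  assumes "a \<le> b" "0 \<le> a"
  shows "has_ito_integral M W a b (\<lambda>t \<omega>. 0::'a::euclidean_space) (\<lambda>\<omega>. 0)"
proof -
  let ?s = "\<lambda>i::nat. if i = 0 then a else b" and ?z = "\<lambda>i \<omega>. 0::'a"
  have sd: "simple_data M W a b 1 ?s ?z" using assms by (auto simp: simple_data_def)
  have e: "simple_value 1 ?s ?z = (\<lambda>t \<omega>. 0)" "simple_integral W 1 ?s ?z = (\<lambda>\<omega>. 0)"
    by (auto simp: simple_value_def[abs_def] simple_integral_def[abs_def])
  show ?thesis using has_ito_simple[OF sd assms(2)] unfolding e .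
qed

text \<open>A diagonal argument: for each \<open>j\<close> a simple process is chosen within
  \<open>1 / Suc j\<close> of the \<open>j\<close>-th integrand whose integral is equally close to
  the \<open>j\<close>-th integral.\<close>

lemma has_ito_limit:
  fixes \<phi> :: "real \<Rightarrow> 'w \<Rightarrow> 'a::euclidean_space"
  assumes ito: "\<And>j. has_ito_integral M W a b (\<phi>j j) (Xj j)" and a: "0 \<le> a"
    and \<phi>: "\<phi> \<in> L2_adapted M W a b" and X [measurable]: "X \<in> borel_measurable M"
    and l1: "(\<lambda>j. sqn (path_measure a b) (\<lambda>p. case_prod (\<phi>j j) p - case_prod \<phi> p)) \<longlonglongrightarrow> 0"
    and l2: "(\<lambda>j. sqn M (\<lambda>\<omega>. Xj j \<omega> - X \<omega>)) \<longlonglongrightarrow> 0"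
  shows "has_ito_integral M W a b \<phi> X"
proof -
  have \<phi>m: "case_prod \<phi> \<in> borel_measurable (path_measure a b)" using \<phi> by (simp add: L2_adapted_iff)
  have "\<forall>j. \<exists>m s z. simple_data M W a b m s z \<and>
      sqn (path_measure a b) (\<lambda>p. case_prod (simple_value m s z) p - case_prod (\<phi>j j) p) < ennreal
        (1 / Suc j) \<and>
      sqn M (\<lambda>\<omega>. simple_integral W m s z \<omega> - Xj j \<omega>) < ennreal (1 / Suc j)"
  proof
    fix j
    obtain m s z where sd: "\<And>i. simple_data M W a b (m i) (s i) (z i)"
      and l1: "(\<lambda>i. sqn (path_measure a b) (\<lambda>p. case_prod (simple_value (m i) (s i) (z i)) p -
        case_prod (\<phi>j j) p)) \<longlonglongrightarrow> 0"
      and l2: "(\<lambda>i. sqn M (\<lambda>\<omega>. simple_integral W (m i) (s i) (z i) \<omega> - Xj j \<omega>)) \<longlonglongrightarrow> 0"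
      using ito[of j] unfolding has_ito_integral_iff by blast
    have p: "0 < ennreal (1 / Suc j)" by simp
    have "\<forall>\<^sub>F i in sequentially. sqn (path_measure a b) (\<lambda>p. case_prod (simple_value (m i) (s i) (z
      i)) p - case_prod (\<phi>j j) p) < ennreal (1 / Suc j)
      \<and> sqn M (\<lambda>\<omega>. simple_integral W (m i) (s i) (z i) \<omega> - Xj j \<omega>) < ennreal (1 / Suc j)"
      by (intro eventually_conj order_tendstoD(2)[OF l1 p] order_tendstoD(2)[OF l2 p])
    then obtain i where "sqn (path_measure a b) (\<lambda>p. case_prod (simple_value (m i) (s i) (z i)) p -
      case_prod (\<phi>j j) p) < ennreal (1 / Suc j)"
      "sqn M (\<lambda>\<omega>. simple_integral W (m i) (s i) (z i) \<omega> - Xj j \<omega>) < ennreal (1 / Suc j)"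
      by (auto simp: eventually_sequentially)
    with sd[of i] show "\<exists>m s z. simple_data M W a b m s z \<and>
      sqn (path_measure a b) (\<lambda>p. case_prod (simple_value m s z) p - case_prod (\<phi>j j) p) < ennreal
        (1 / Suc j) \<and>
      sqn M (\<lambda>\<omega>. simple_integral W m s z \<omega> - Xj j \<omega>) < ennreal (1 / Suc j)"
      by (intro exI conjI)
  qed
  then obtain m s z where y: "\<And>j. simple_data M W a b (m j) (s j) (z j)"
      "\<And>j. sqn (path_measure a b) (\<lambda>p. case_prod (simple_value (m j) (s j) (z j)) p - case_prod (\<phi>j
        j) p) < ennreal (1 / Suc j)"
      "\<And>j. sqn M (\<lambda>\<omega>. simple_integral W (m j) (s j) (z j) \<omega> - Xj j \<omega>) < ennreal (1 / Suc j)"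
    unfolding choice_iff by blast
  have z: "(\<lambda>j. ennreal (1 / Suc j)) \<longlonglongrightarrow> 0"
    using tendsto_ennrealI[OF LIMSEQ_inverse_real_of_nat] by (simp add: inverse_eq_divide)
  have \<phi>jm: "case_prod (\<phi>j j) \<in> borel_measurable (path_measure a b)" and [measurable]: "Xj j \<in>
    borel_measurable M" for j
    using ito[of j] by (auto simp: has_ito_integral_iff L2_adapted_iff)
  note svm = simple_value_measurable[OF y(1) a]
  note [measurable] = simple_integral_measurable[OF y(1) a]
  have "sqn (path_measure a b) (\<lambda>p. case_prod (simple_value (m j) (s j) (z j)) p - case_prod \<phi> p)
    \<le> 2 * ennreal (1 / Suc j) + 2 * sqn (path_measure a b) (\<lambda>p. case_prod (\<phi>j j) p - case_prod \<phi> p)" for j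
    using sqn_diff_le[OF svm[of j] \<phi>jm[of j] \<phi>m]
    by (rule order_trans) (rule add_mono[OF mult_left_mono[OF less_imp_le[OF y(2)]] order_refl], simp)
  then have c1: "(\<lambda>j. sqn (path_measure a b) (\<lambda>p. case_prod (simple_value (m j) (s j) (z j)) p -
    case_prod \<phi> p)) \<longlonglongrightarrow> 0"
    by (rule tendsto_0_le_sum_ennreal[OF z l1])
  have "sqn M (\<lambda>\<omega>. simple_integral W (m j) (s j) (z j) \<omega> - X \<omega>)
    \<le> 2 * ennreal (1 / Suc j) + 2 * sqn M (\<lambda>\<omega>. Xj j \<omega> - X \<omega>)" for j
  proof (rule order_trans[OF sqn_diff_le[of _ _ "Xj j"]])
    show "2 * sqn M (\<lambda>\<omega>. simple_integral W (m j) (s j) (z j) \<omega> - Xj j \<omega>) + 2 * sqn M (\<lambda>\<omega>. Xj j \<omega> - X \<omega>)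
      \<le> 2 * ennreal (1 / Suc j) + 2 * sqn M (\<lambda>\<omega>. Xj j \<omega> - X \<omega>)"
      by (rule add_mono[OF mult_left_mono[OF less_imp_le[OF y(3)]] order_refl]) simp
  qed measurable
  then have c2: "(\<lambda>j. sqn M (\<lambda>\<omega>. simple_integral W (m j) (s j) (z j) \<omega> - X \<omega>)) \<longlonglongrightarrow> 0"
    by (rule tendsto_0_le_sum_ennreal[OF z l2])
  show ?thesis unfolding has_ito_integral_iff using \<phi> X y(1) c1 c2 by blast
qed

section \<open>Iterated integrals\<close>

abbreviation iter_int :: "real \<Rightarrow> nat \<Rightarrow> real \<Rightarrow> ((nat \<Rightarrow> real) \<Rightarrow> 'a::euclidean_space) \<Rightarrow> ('w \<Rightarrow> 'a) \<Rightarrow> bool" where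
  "iter_int \<equiv> has_iterated_integral M W"

lemma iter_int_measurable: "iter_int S n t g X \<Longrightarrow> X \<in> borel_measurable M"
  by (cases n) (auto simp: has_ito_integral_def)

lemma iter_int_add:
  assumes "0 \<le> S" "iter_int S n t g X" "iter_int S n t h Y"
  shows "iter_int S n t (\<lambda>s. g s + h s) (\<lambda>\<omega>. X \<omega> + Y \<omega>)"
  using assms(2,3)
proof (induction n arbitrary: t g h X Y)
  case (Suc n)
  obtain P Q where P: "AE t1 in time_interval S t. iter_int S n t1 (\<lambda>s. g (cons_pt n t1 s)) (P t1)"
    "has_ito_integral M W S t P X"
    and Q: "AE t1 in time_interval S t. iter_int S n t1 (\<lambda>s. h (cons_pt n t1 s)) (Q t1)"
      "has_ito_integral M W S t Q Y"
    using Suc.prems by auto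
  have "AE t1 in time_interval S t. iter_int S n t1 (\<lambda>s. g (cons_pt n t1 s) + h (cons_pt n t1 s))
    (\<lambda>\<omega>. P t1 \<omega> + Q t1 \<omega>)"
    using P(1) Q(1) by eventually_elim (rule Suc.IH)
  with has_ito_add[OF P(2) Q(2) assms(1)] show ?case
    unfolding has_iterated_integral.simps by (intro exI[of _ "\<lambda>t1 \<omega>. P t1 \<omega> + Q t1 \<omega>"]) simp
qed auto

lemma iter_int_scaleR:
  assumes "0 \<le> S" "iter_int S n t g X"
  shows "iter_int S n t (\<lambda>s. c *\<^sub>R g s) (\<lambda>\<omega>. c *\<^sub>R X \<omega>)"
  using assms(2)
proof (induction n arbitrary: t g X)
  case (Suc n)
  obtain P where P: "AE t1 in time_interval S t. iter_int S n t1 (\<lambda>s. g (cons_pt n t1 s)) (P t1)"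
    "has_ito_integral M W S t P X"
    using Suc.prems by auto
  have "AE t1 in time_interval S t. iter_int S n t1 (\<lambda>s. c *\<^sub>R g (cons_pt n t1 s)) (\<lambda>\<omega>. c *\<^sub>R P t1 \<omega>)"
    using P(1) by eventually_elim (rule Suc.IH)
  with has_ito_scaleR[OF P(2) assms(1), of c] show ?case
    unfolding has_iterated_integral.simps by (intro exI[of _ "\<lambda>t1 \<omega>. c *\<^sub>R P t1 \<omega>"]) simp
qed auto

lemma iter_int_diff:
  assumes "0 \<le> S" "iter_int S n t g X" "iter_int S n t h Y"
  shows "iter_int S n t (\<lambda>s. g s - h s) (\<lambda>\<omega>. X \<omega> - Y \<omega>)"
  using iter_int_add[OF assms(1,2) iter_int_scaleR[OF assms(1,3), of "-1"]] by simp

lemma iter_int_zero: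
  assumes "0 \<le> S" "S \<le> t"
  shows "iter_int S n t (\<lambda>s. 0::'a::euclidean_space) (\<lambda>\<omega>. 0)"
  using assms(2)
proof (induction n arbitrary: t)
  case (Suc n)
  have "AE t1 in time_interval S t. iter_int S n t1 (\<lambda>s. 0::'a) (\<lambda>\<omega>. 0)"
    by (rule AE_I2) (simp add: Suc.IH)
  with has_ito_zero[OF Suc.prems assms(1)] show ?case
    unfolding has_iterated_integral.simps by (intro exI[of _ "\<lambda>t1 \<omega>. 0"]) simp
qed auto

text \<open>Isometry and orthogonality of different orders in one induction: the summand of order
  zero is a constant, and the remaining ones together form a single Ito integral.\<close>

lemma sqn_sum_iter_int:
  fixes g :: "nat \<Rightarrow> (nat \<Rightarrow> real) \<Rightarrow> 'a::euclidean_space"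
  assumes S: "0 \<le> S" and St: "S \<le> t"
    and X: "\<And>n. n < N \<Longrightarrow> iter_int S n t (g n) (X n)"
    and g: "\<And>n. n < N \<Longrightarrow> g n \<in> borel_measurable (simplex_measure n S t)"
  shows "sqn M (\<lambda>\<omega>. \<Sum>n<N. X n \<omega>) = (\<Sum>n<N. sqn (simplex_measure n S t) (g n))"
  using St X g
proof (induction N arbitrary: t g X)
  case 0
  then show ?case by (simp add: sqn_def)
next
  case (Suc N)
  have "\<forall>n. \<exists>P. n < N \<longrightarrow> (AE t1 in time_interval S t. iter_int S n t1 (\<lambda>s. g (Suc n) (cons_pt n t1
    s)) (P t1)) \<and>
      has_ito_integral M W S t P (X (Suc n))"
    using Suc.prems(2)[of "Suc _"] by auto
  then obtain P where P: "\<And>n. n < N \<Longrightarrow> AE t1 in time_interval S t. iter_int S n t1 (\<lambda>s. g (Suc n)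
    (cons_pt n t1 s)) (P n t1)"
    "\<And>n. n < N \<Longrightarrow> has_ito_integral M W S t (P n) (X (Suc n))"
    unfolding choice_iff by blast
  have "k \<le> N \<Longrightarrow> has_ito_integral M W S t (\<lambda>t1 \<omega>. \<Sum>n<k. P n t1 \<omega>) (\<lambda>\<omega>. \<Sum>n<k. X (Suc n) \<omega>)" for k
  proof (induction k)
    case 0
    then show ?case using has_ito_zero[OF Suc.prems(1) S] by simp
  next
    case (Suc k)
    then show ?case using has_ito_add[OF _ P(2)[of k] S] by simp
  qed
  then have Z: "has_ito_integral M W S t (\<lambda>t1 \<omega>. \<Sum>n<N. P n t1 \<omega>) (\<lambda>\<omega>. \<Sum>n<N. X (Suc n) \<omega>)" by blast
  define c where "c = g 0 (\<lambda>_. undefined)"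
  have X0: "AE \<omega> in M. X 0 \<omega> = c" using Suc.prems(2)[of 0] by (simp add: c_def)
  have PL: "(\<lambda>t1 \<omega>. \<Sum>n<N. P n t1 \<omega>) \<in> L2_adapted M W S t" using Z by (simp add: has_ito_integral_def)
  have "sqn M (\<lambda>\<omega>. \<Sum>n<Suc N. X n \<omega>) = sqn M (\<lambda>\<omega>. c + (\<Sum>n<N. X (Suc n) \<omega>))"
    by (rule sqn_cong_AE) (use X0 in \<open>auto simp: sum.lessThan_Suc_shift simp del: sum.lessThan_Suc\<close>)
  also have "\<dots> = ennreal ((norm c)\<^sup>2) + sqn (path_measure S t) (\<lambda>(t1, \<omega>). \<Sum>n<N. P n t1 \<omega>)"
    by (rule has_ito_sqn[OF Z S])
  also have "sqn (path_measure S t) (\<lambda>(t1, \<omega>). \<Sum>n<N. P n t1 \<omega>) = (\<integral>\<^sup>+ t1. sqn M (\<lambda>\<omega>. \<Sum>n<N. P n t1 \<omega>)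
    \<partial>time_interval S t)"
    using PL by (subst sqn_pair) (auto simp: L2_adapted_iff)
  \<comment> \<open>For almost every \<open>t1\<close> the integrands \<open>P n t1\<close> are
    themselves iterated integrals up to \<open>t1\<close>, of orders \<open>n < N\<close>, so the
    induction hypothesis applies to them.\<close>
  also have "\<dots> = (\<integral>\<^sup>+ t1. (\<Sum>n<N. sqn (simplex_measure n S t1) (\<lambda>s. g (Suc n) (cons_pt n t1 s)))
    \<partial>time_interval S t)"
  proof (rule nn_integral_cong_AE)
    have "AE t1 in time_interval S t. \<forall>n<N. iter_int S n t1 (\<lambda>s. g (Suc n) (cons_pt n t1 s)) (P n t1)"
      using P(1) by (auto simp: AE_all_countable)
    then show "AE t1 in time_interval S t. sqn M (\<lambda>\<omega>. \<Sum>n<N. P n t1 \<omega>) = (\<Sum>n<N. sqn (simplex_measure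
      n S t1) (\<lambda>s. g (Suc n) (cons_pt n t1 s)))"
      using AE_space
    proof eventually_elim
      case (elim t1)
      then have "S < t1" "t1 < t" by auto
      then show ?case
        using elim Suc.prems(3)[of "Suc _"] by (intro Suc.IH) (auto intro: simplex_measurable_cons)
    qed
  qed
  also have "\<dots> = (\<Sum>n<N. \<integral>\<^sup>+ t1. sqn (simplex_measure n S t1) (\<lambda>s. g (Suc n) (cons_pt n t1 s))
    \<partial>time_interval S t)"
    using Suc.prems(3) by (intro nn_integral_sum measurable_sqn_cons) auto
  also have "\<dots> = (\<Sum>n<N. sqn (simplex_measure (Suc n) S t) (g (Suc n)))"
    using Suc.prems(3) by (intro sum.cong sqn_simplex_cons[symmetric]) auto
  also have "ennreal ((norm c)\<^sup>2) = sqn (simplex_measure 0 S t) (g 0)"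
    by (simp add: sqn_simplex_0 c_def)
  finally show ?case by (simp add: sum.lessThan_Suc_shift del: sum.lessThan_Suc)
qed

section \<open>Iterated integrals as adapted processes, and their limits\<close>

definition iter_process :: "nat \<Rightarrow> real \<Rightarrow> real \<Rightarrow> ((nat \<Rightarrow> real) \<Rightarrow> 'a::euclidean_space) \<Rightarrow> (real \<Rightarrow> 'w \<Rightarrow>
  'a) \<Rightarrow> bool" where
  "iter_process n S T f X \<longleftrightarrow> X \<in> L2_adapted M W S T \<and>
     (AE t in time_interval S T. iter_int S n t (\<lambda>s. f (cons_pt n t s)) (X t))"

lemma iter_process_add:
  assumes "0 \<le> S" "iter_process n S T f X" "iter_process n S T g Y"
  shows "iter_process n S T (\<lambda>s. f s + g s) (\<lambda>t \<omega>. X t \<omega> + Y t \<omega>)"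
  using assms(2,3) unfolding iter_process_def
  by (auto intro!: L2_adapted_add elim!: eventually_elim2 intro: iter_int_add[OF assms(1)])

lemma iter_process_diff:
  assumes "0 \<le> S" "iter_process n S T f X" "iter_process n S T g Y"
  shows "iter_process n S T (\<lambda>s. f s - g s) (\<lambda>t \<omega>. X t \<omega> - Y t \<omega>)"
  using assms(2,3) unfolding iter_process_def
  by (auto intro!: L2_adapted_diff elim!: eventually_elim2 intro: iter_int_diff[OF assms(1)])

lemma iter_process_zero:
  assumes "0 \<le> S"
  shows "iter_process n S T (\<lambda>s. 0::'a::euclidean_space) (\<lambda>t \<omega>. 0)"
  unfolding iter_process_def
  by (auto intro!: L2_adapted_zero AE_I2 iter_int_zero assms)

lemma sqn_sum_iter_process:
  fixes f :: "nat \<Rightarrow> (nat \<Rightarrow> real) \<Rightarrow> 'a::euclidean_space"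
  assumes S: "0 \<le> S" and X: "\<And>n. n < N \<Longrightarrow> iter_process n S T (f n) (X n)"
    and f: "\<And>n. n < N \<Longrightarrow> f n \<in> borel_measurable (simplex_measure (Suc n) S T)"
  shows "sqn (path_measure S T) (\<lambda>(t, \<omega>). \<Sum>n<N. X n t \<omega>) = (\<Sum>n<N. sqn (simplex_measure (Suc n) S T) (f n))"
proof -
  have XL: "(\<lambda>t \<omega>. \<Sum>n<N. X n t \<omega>) \<in> L2_adapted M W S T"
    using X by (intro L2_adapted_sum) (auto simp: iter_process_def)
  have "sqn (path_measure S T) (\<lambda>(t, \<omega>). \<Sum>n<N. X n t \<omega>) = (\<integral>\<^sup>+ t. sqn M (\<lambda>\<omega>. \<Sum>n<N. X n t \<omega>)
    \<partial>time_interval S T)"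
    using XL by (subst sqn_pair) (auto simp: L2_adapted_iff)
  also have "\<dots> = (\<integral>\<^sup>+ t. (\<Sum>n<N. sqn (simplex_measure n S t) (\<lambda>s. f n (cons_pt n t s))) \<partial>time_interval S T)"
  proof (rule nn_integral_cong_AE)
    have "AE t in time_interval S T. \<forall>n<N. iter_int S n t (\<lambda>s. f n (cons_pt n t s)) (X n t)"
      using X by (auto simp: AE_all_countable iter_process_def)
    then show "AE t in time_interval S T. sqn M (\<lambda>\<omega>. \<Sum>n<N. X n t \<omega>) = (\<Sum>n<N. sqn (simplex_measure n
      S t) (\<lambda>s. f n (cons_pt n t s)))"
      using AE_space
    proof eventually_elim
      case (elim t)
      then show ?case using f by (intro sqn_sum_iter_int S) (auto intro: simplex_measurable_cons)
    qed
  qed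
  also have "\<dots> = (\<Sum>n<N. \<integral>\<^sup>+ t. sqn (simplex_measure n S t) (\<lambda>s. f n (cons_pt n t s)) \<partial>time_interval S T)"
    using f by (intro nn_integral_sum measurable_sqn_cons) auto
  also have "\<dots> = (\<Sum>n<N. sqn (simplex_measure (Suc n) S T) (f n))"
    using f by (intro sum.cong sqn_simplex_cons[symmetric]) auto
  finally show ?thesis .
qed

text \<open>The isometry for a single order is read off the one for sums by placing the process in
  slot \<open>n\<close> of a family that is zero elsewhere.\<close>

lemma sqn_iter_process:
  fixes f :: "(nat \<Rightarrow> real) \<Rightarrow> 'a::euclidean_space"
  assumes S: "0 \<le> S" and X: "iter_process n S T f X"
    and f: "f \<in> borel_measurable (simplex_measure (Suc n) S T)"
  shows "sqn (path_measure S T) (case_prod X) = sqn (simplex_measure (Suc n) S T) f"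
proof -
  let ?f = "\<lambda>k. if k = n then f else (\<lambda>_. 0)" and ?X = "\<lambda>k. if k = n then X else (\<lambda>_ _. 0)"
  have "sqn (path_measure S T) (\<lambda>(t, \<omega>). \<Sum>k<Suc n. ?X k t \<omega>) = (\<Sum>k<Suc n. sqn (simplex_measure (Suc
    k) S T) (?f k))"
    by (rule sqn_sum_iter_process[OF S]) (use iter_process_zero[OF S] X f in auto)
  moreover have "(\<Sum>k<n. ?X k t \<omega>) = 0" for t \<omega> by (rule sum.neutral) auto
  moreover have "(\<Sum>k<n. sqn (simplex_measure (Suc k) S T) (?f k)) = 0" by (rule sum.neutral) (auto
    simp: sqn_def)
  ultimately show ?thesis by simp
qed

text \<open>Closedness of the relation between kernel and integral at order \<open>n\<close>,
  packaged as a predicate so that it can be the induction hypothesis in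
  \<open>iter_process_limit_aux\<close>. The type argument fixes the value space, which occurs only
  in bound variables.\<close>

definition iter_int_closed :: "'a::euclidean_space itself \<Rightarrow> real \<Rightarrow> nat \<Rightarrow> bool" where
  "iter_int_closed _ S n \<longleftrightarrow> (\<forall>t (gj :: nat \<Rightarrow> (nat \<Rightarrow> real) \<Rightarrow> 'a) Xj g X. S \<le> t \<longrightarrow>
     (\<forall>j. iter_int S n t (gj j) (Xj j)) \<longrightarrow> (\<forall>j. gj j \<in> borel_measurable (simplex_measure n S t)) \<longrightarrow>
     g \<in> borel_measurable (simplex_measure n S t) \<longrightarrow> X \<in> borel_measurable M \<longrightarrow>
     (\<lambda>j. sqn (simplex_measure n S t) (\<lambda>s. gj j s - g s)) \<longlonglongrightarrow> 0 \<longrightarrow>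
     (\<lambda>j. sqn M (\<lambda>\<omega>. Xj j \<omega> - X \<omega>)) \<longlonglongrightarrow> 0 \<longrightarrow> iter_int S n t g X)"

text \<open>By the isometry convergent kernels give a Cauchy sequence of processes, hence a limit
  \<open>Z\<close>. That \<open>Z\<close> has the right iterated integrals at almost every time
  follows from closedness at order \<open>n\<close>, applied to slices along a subsequence.\<close>

lemma iter_process_limit_aux:
  fixes f :: "(nat \<Rightarrow> real) \<Rightarrow> 'a::euclidean_space"
  assumes S: "0 \<le> S" and cl: "iter_int_closed TYPE('a) S n"
    and Y: "\<And>j. iter_process n S T (fj j) (Y j)"
    and fj: "\<And>j. fj j \<in> borel_measurable (simplex_measure (Suc n) S T)"
    and f: "f \<in> borel_measurable (simplex_measure (Suc n) S T)"
    and lim: "(\<lambda>j. sqn (simplex_measure (Suc n) S T) (\<lambda>s. fj j s - f s)) \<longlonglongrightarrow> 0"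
  obtains Z where "iter_process n S T f Z" "(\<lambda>j. sqn (path_measure S T) (\<lambda>(t, \<omega>). Y j t \<omega> - Z t \<omega>)) \<longlonglongrightarrow> 0"
proof -
  have YL: "Y j \<in> L2_adapted M W S T" for j using Y by (auto simp: iter_process_def)
  have iso: "sqn (path_measure S T) (\<lambda>(t, \<omega>). Y i t \<omega> - Y j t \<omega>) = sqn (simplex_measure (Suc n) S T)
    (\<lambda>s. fj i s - fj j s)" for i j
    by (rule sqn_iter_process[OF S iter_process_diff[OF S Y Y] borel_measurable_diff[OF fj fj]])
  have "\<exists>N. \<forall>i\<ge>N. \<forall>j\<ge>N. sqn (path_measure S T) (\<lambda>(t, \<omega>). Y i t \<omega> - Y j t \<omega>) < ennreal e" if e: "e >
    0" for e :: real
  proof -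
    have "\<forall>\<^sub>F j in sequentially. sqn (simplex_measure (Suc n) S T) (\<lambda>s. fj j s - f s) < ennreal (e / 8)"
      by (rule order_tendstoD(2)[OF lim]) (use e in simp)
    then obtain N where N: "\<And>j. j \<ge> N \<Longrightarrow> sqn (simplex_measure (Suc n) S T) (\<lambda>s. fj j s - f s) <
      ennreal (e / 8)"
      by (auto simp: eventually_sequentially)
    have "sqn (path_measure S T) (\<lambda>(t, \<omega>). Y i t \<omega> - Y j t \<omega>) < ennreal e" if "i \<ge> N" "j \<ge> N" for i j
    proof -
      have "sqn (path_measure S T) (\<lambda>(t, \<omega>). Y i t \<omega> - Y j t \<omega>) \<le> 2 * sqn (simplex_measure (Suc n) S
        T) (\<lambda>s. fj i s - f s)
         + 2 * sqn (simplex_measure (Suc n) S T) (\<lambda>s. fj j s - f s)"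
        unfolding iso using sqn_diff_le[OF fj[of i] f fj[of j]] by (simp add: sqn_commute[of _ f])
      also have "\<dots> \<le> 2 * ennreal (e / 8) + 2 * ennreal (e / 8)"
        by (intro add_mono mult_left_mono less_imp_le[OF N] that) auto
      also have "\<dots> = ennreal 2 * ennreal (e / 8) + ennreal 2 * ennreal (e / 8)" by simp
      also have "\<dots> = ennreal (2 * (e / 8) + 2 * (e / 8))"
        using e by (simp only: ennreal_mult'[symmetric] ennreal_plus[symmetric])
      also have "\<dots> < ennreal e" using e by (intro ennreal_lessI) auto
      finally show ?thesis .
    qed
    then show ?thesis by blast
  qed
  then obtain Z where Z: "Z \<in> L2_adapted M W S T" "(\<lambda>j. sqn (path_measure S T) (\<lambda>(t, \<omega>). Y j t \<omega> - Z
    t \<omega>)) \<longlonglongrightarrow> 0"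
    by (rule L2_adapted_complete[OF YL]) 
  have Ym: "(\<lambda>(t, \<omega>). Y j t \<omega> - Z t \<omega>) \<in> borel_measurable (path_measure S T)" for j
    using L2_adapted_diff[OF YL[of j] Z(1)] by (simp add: L2_adapted_iff)
  \<comment> \<open>Both slice errors are added, so that one subsequence makes both tend to 0 at
    almost every time.\<close>
  define h where "h = (\<lambda>j t. sqn M (\<lambda>\<omega>. Y j t \<omega> - Z t \<omega>) + sqn (simplex_measure n S t) (\<lambda>s. fj j
    (cons_pt n t s) - f (cons_pt n t s)))"
  have m1: "(\<lambda>t. sqn M (\<lambda>\<omega>. Y j t \<omega> - Z t \<omega>)) \<in> borel_measurable (time_interval S T)" for j
    using borel_measurable_nn_integral[of "\<lambda>t \<omega>. ennreal ((norm (Y j t \<omega> - Z t \<omega>))\<^sup>2)" "time_interval S T"]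
      measurable_compose[OF Ym[of j], of "\<lambda>x. ennreal ((norm x)\<^sup>2)" borel]
    by (simp add: sqn_def case_prod_unfold)
  have m2: "(\<lambda>t. sqn (simplex_measure n S t) (\<lambda>s. fj j (cons_pt n t s) - f (cons_pt n t s))) \<in>
    borel_measurable (time_interval S T)" for j
    using measurable_sqn_cons[OF borel_measurable_diff[OF fj[of j] f]] .
  have hm: "h j \<in> borel_measurable (time_interval S T)" for j
    unfolding h_def by (intro borel_measurable_add m1 m2)
  have "(\<integral>\<^sup>+ t. h j t \<partial>time_interval S T) = sqn (path_measure S T) (\<lambda>(t, \<omega>). Y j t \<omega> - Z t \<omega>) + sqn
    (simplex_measure (Suc n) S T) (\<lambda>s. fj j s - f s)" for j
    unfolding h_def nn_integral_add[OF m1 m2] sqn_simplex_cons[OF borel_measurable_diff[OF fj[of j] f]]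
    by (subst sqn_pair[OF Ym]) simp
  then have "(\<lambda>j. \<integral>\<^sup>+ t. h j t \<partial>time_interval S T) \<longlonglongrightarrow> 0"
    using tendsto_add[OF Z(2) lim] by simp
  then obtain r :: "nat \<Rightarrow> nat" where r: "strict_mono r" "AE t in time_interval S T. (\<lambda>j. h (r j) t) \<longlonglongrightarrow> 0"
    by (rule nn_integral_tendsto_0_AE_subseq[of h, OF hm]) (rule that)
  have "AE t in time_interval S T. \<forall>j. iter_int S n t (\<lambda>s. fj j (cons_pt n t s)) (Y j t)"
    using Y by (simp add: AE_all_countable iter_process_def)
  then have "AE t in time_interval S T. iter_int S n t (\<lambda>s. f (cons_pt n t s)) (Z t)"
    using r(2) AE_space
  proof eventually_elim
    case (elim t)
    then have t: "S < t" "t < T" by auto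
    have "(\<lambda>j. sqn (simplex_measure n S t) (\<lambda>s. fj (r j) (cons_pt n t s) - f (cons_pt n t s))) \<longlonglongrightarrow> 0"
      by (rule tendsto_0_le_ennreal[OF elim(2)]) (simp add: h_def)
    moreover have "(\<lambda>j. sqn M (\<lambda>\<omega>. Y (r j) t \<omega> - Z t \<omega>)) \<longlonglongrightarrow> 0"
      by (rule tendsto_0_le_ennreal[OF elim(2)]) (simp add: h_def)
    moreover have "Z t \<in> borel_measurable M"
      by (rule L2_adapted_at_measurable[OF Z(1) S]) (use t in auto)
    ultimately show ?case
      using cl elim(1) t simplex_measurable_cons[OF fj t] simplex_measurable_cons[OF f t] unfolding
        iter_int_closed_def
      by (elim allE[of _ t] allE[of _ "\<lambda>j s. fj (r j) (cons_pt n t s)"] allE[of _ "\<lambda>j. Y (r j) t"]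
        allE[of _ "\<lambda>s. f (cons_pt n t s)"] allE[of _ "Z t"])
        auto
  qed
  then show ?thesis using that Z by (auto simp: iter_process_def)
qed

text \<open>At order \<open>Suc n\<close> the integrands of the outer integrals are processes of
  order \<open>n\<close>. Their limit comes from \<open>iter_process_limit_aux\<close>, and
  \<open>has_ito_limit\<close> shows that the prescribed \<open>X\<close> is its Ito integral. At
  order zero all the variables are constants.\<close>

lemma iter_int_closed:
  assumes S: "0 \<le> S"
  shows "iter_int_closed TYPE('a::euclidean_space) S n"
proof (induction n)
  case 0
  show ?case unfolding iter_int_closed_def
  proof (intro allI impI)
    fix t and gj :: "nat \<Rightarrow> (nat \<Rightarrow> real) \<Rightarrow> 'a" and Xj g X
    assume h: "\<forall>j. iter_int S 0 t (gj j) (Xj j)" "X \<in> borel_measurable M"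
      "(\<lambda>j. sqn (simplex_measure 0 S t) (\<lambda>s. gj j s - g s)) \<longlonglongrightarrow> 0" "(\<lambda>j. sqn M (\<lambda>\<omega>. Xj j \<omega> - X \<omega>)) \<longlonglongrightarrow> 0"
    note [measurable] = h(2)
    let ?u = "\<lambda>_::nat. undefined :: real"
    have e: "sqn M (\<lambda>\<omega>. Xj j \<omega> - X \<omega>) = sqn M (\<lambda>\<omega>. gj j ?u - X \<omega>)" for j
      by (rule sqn_cong_AE) (use h(1) in auto)
    have "sqn M (\<lambda>\<omega>. g ?u - X \<omega>) \<le> 2 * sqn (simplex_measure 0 S t) (\<lambda>s. gj j s - g s) + 2 * sqn M
      (\<lambda>\<omega>. Xj j \<omega> - X \<omega>)" for j
    proof -
      have "sqn M (\<lambda>\<omega>. g ?u - X \<omega>) \<le> 2 * sqn M (\<lambda>\<omega>. g ?u - gj j ?u) + 2 * sqn M (\<lambda>\<omega>. gj j ?u - X \<omega>)"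
        by (rule sqn_diff_le) auto
      moreover have "sqn M (\<lambda>\<omega>. g ?u - gj j ?u) = sqn (simplex_measure 0 S t) (\<lambda>s. gj j s - g s)"
        unfolding sqn_simplex_0 by (simp add: sqn_def emeasure_space_1 norm_minus_commute)
      ultimately show ?thesis unfolding e by simp
    qed
    then have "(\<lambda>j::nat. sqn M (\<lambda>\<omega>. g ?u - X \<omega>)) \<longlonglongrightarrow> 0"
      by (rule tendsto_0_le_sum_ennreal[OF h(3,4)])
    then have "sqn M (\<lambda>\<omega>. g ?u - X \<omega>) = 0" by (simp add: LIMSEQ_const_iff)
    then show "iter_int S 0 t g X" using h(2) by (subst (asm) sqn_eq_0_iff) (auto elim: eventually_mono)
  qed
next
  case (Suc n)
  show ?case unfolding iter_int_closed_def
  proof (intro allI impI)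
    fix t and gj :: "nat \<Rightarrow> (nat \<Rightarrow> real) \<Rightarrow> 'a" and Xj g X
    assume h: "S \<le> t" "\<forall>j. iter_int S (Suc n) t (gj j) (Xj j)" "\<forall>j. gj j \<in> borel_measurable
      (simplex_measure (Suc n) S t)"
      "g \<in> borel_measurable (simplex_measure (Suc n) S t)" "X \<in> borel_measurable M"
      "(\<lambda>j. sqn (simplex_measure (Suc n) S t) (\<lambda>s. gj j s - g s)) \<longlonglongrightarrow> 0" "(\<lambda>j. sqn M (\<lambda>\<omega>. Xj j \<omega> - X \<omega>)) \<longlonglongrightarrow> 0"
    from h(2) have "\<forall>j. \<exists>P. (AE t1 in time_interval S t. iter_int S n t1 (\<lambda>s. gj j (cons_pt n t1 s))
      (P t1)) \<and> has_ito_integral M W S t P (Xj j)"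
      by simp
    then obtain P where P: "\<And>j. AE t1 in time_interval S t. iter_int S n t1 (\<lambda>s. gj j (cons_pt n t1
      s)) (P j t1)"
      "\<And>j. has_ito_integral M W S t (P j) (Xj j)"
      unfolding choice_iff by blast
    have ip: "iter_process n S t (gj j) (P j)" for j
      using P unfolding iter_process_def by (auto simp: has_ito_integral_def)
    obtain Z where Z: "iter_process n S t g Z" "(\<lambda>j. sqn (path_measure S t) (\<lambda>(t, \<omega>). P j t \<omega> - Z t \<omega>)) \<longlonglongrightarrow> 0"
      by (rule iter_process_limit_aux[OF S Suc.IH, of t gj P g, OF ip h(3)[rule_format] h(4) h(6)])
    have "has_ito_integral M W S t Z X"
      by (rule has_ito_limit[OF P(2) S _ h(5) _ h(7)]) (use Z in \<open>auto simp: iter_process_def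
        case_prod_unfold\<close>)
    then show "iter_int S (Suc n) t g X" using Z(1) unfolding iter_process_def by auto
  qed
qed

lemmas iter_process_limit = iter_process_limit_aux[OF _ iter_int_closed]

end

section \<open>Chaos expansions\<close>

text \<open>These boxes form an intersection-stable generator of the Borel sets of the simplex;
  empty boxes are allowed.\<close>

definition ordered_box :: "nat \<Rightarrow> real \<Rightarrow> real \<Rightarrow> (nat \<Rightarrow> real) \<Rightarrow> (nat \<Rightarrow> real) \<Rightarrow> bool" where
  "ordered_box n S T a b \<longleftrightarrow> (\<forall>i. Suc i < n \<longrightarrow> b (Suc i) \<le> a i) \<and> (\<forall>i<n. S \<le> a i \<and> b i \<le> T)"

definition box_pts :: "nat \<Rightarrow> real \<Rightarrow> real \<Rightarrow> (nat \<Rightarrow> real) \<Rightarrow> (nat \<Rightarrow> real) \<Rightarrow> (nat \<Rightarrow> real) set" where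
  "box_pts n S T a b = {x \<in> simplex_pts n S T. \<forall>i<n. a i < x i \<and> x i \<le> b i}"

definition boxes :: "nat \<Rightarrow> real \<Rightarrow> real \<Rightarrow> (nat \<Rightarrow> real) set set" where
  "boxes n S T = {box_pts n S T a b | a b. ordered_box n S T a b}"

lemma Int_stable_boxes: "Int_stable (boxes n S T)"
proof (rule Int_stableI)
  fix A B assume "A \<in> boxes n S T" "B \<in> boxes n S T"
  then obtain a b a' b' where h: "ordered_box n S T a b" "A = box_pts n S T a b" "ordered_box n S T
    a' b'" "B = box_pts n S T a' b'"
    by (auto simp: boxes_def)
  have "A \<inter> B = box_pts n S T (\<lambda>i. max (a i) (a' i)) (\<lambda>i. min (b i) (b' i))"
    unfolding h box_pts_def by auto
  moreover have "ordered_box n S T (\<lambda>i. max (a i) (a' i)) (\<lambda>i. min (b i) (b' i))"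
    using h(1,3) unfolding ordered_box_def by (auto simp: min_le_iff_disj le_max_iff_disj)
  ultimately show "A \<inter> B \<in> boxes n S T" unfolding boxes_def by blast
qed

lemma boxes_Pow: "boxes n S T \<subseteq> Pow (simplex_pts n S T)"
  by (auto simp: boxes_def box_pts_def)

text \<open>Every point of the set lies in a box with rational corners that respects the ordering:
  first a rational lower corner is put between each coordinate and the next smaller one, then a
  rational upper corner between each coordinate and the lower corner of its predecessor.\<close>

lemma simplex_lower_set_countable_boxes:
  assumes "i < n"
  shows "\<exists>\<B>. countable \<B> \<and> \<B> \<subseteq> boxes n S T \<and> {x \<in> simplex_pts n S T. x i < c} = \<Union>\<B>"
proof -
  let ?Q = "PiE {..<n} (\<lambda>_. \<rat> :: real set)"
  let ?\<B> = "{box_pts n S T a b | a b. a \<in> ?Q \<and> b \<in> ?Q \<and> ordered_box n S T a b \<and> b i < c}"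
  have "countable (?Q \<times> ?Q)" by (intro countable_SIGMA countable_PiE) (auto intro: countable_rat)
  then have "countable ((\<lambda>(a, b). box_pts n S T a b) ` (?Q \<times> ?Q))" by (rule countable_image)
  then have "countable ?\<B>" by (rule countable_subset[rotated]) auto
  moreover have "{x \<in> simplex_pts n S T. x i < c} = \<Union>?\<B>"
  proof (intro set_eqI iffI)
    fix x assume "x \<in> \<Union>?\<B>"
    then show "x \<in> {x \<in> simplex_pts n S T. x i < c}" using assms by (force simp: box_pts_def)
  next
    fix x assume "x \<in> {x \<in> simplex_pts n S T. x i < c}"
    then have x: "x \<in> simplex_pts n S T" "x i < c" by auto
    have lo: "\<exists>q\<in>\<rat>. (if Suc j < n then x (Suc j) else S) < q \<and> q < x j" if "j < n" for j
      using x(1) that by (intro Rats_dense_in_real) (auto simp: simplex_pts_def)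
    then obtain q where q: "\<And>j. j < n \<Longrightarrow> q j \<in> \<rat> \<and> (if Suc j < n then x (Suc j) else S) < q j \<and> q j < x j"
      by metis
    \<comment> \<open>The admissible ceiling for the upper corner \<open>j\<close>: the lower corner
      of the preceding coordinate, or \<open>T\<close> for the first one, and additionally
      \<open>c\<close> in coordinate \<open>i\<close>.\<close>
    define u where "u = (\<lambda>j. min (if j = 0 then T else q (j - 1)) (if j = i then c else T))"
    have "\<exists>p\<in>\<rat>. x j < p \<and> p < u j" if "j < n" for j
    proof (intro Rats_dense_in_real)
      show "x j < u j"
      proof (cases j)
        case 0 then show ?thesis using x that by (auto simp: u_def simplex_pts_def)
      next
        case (Suc k) then show ?thesis using x that q[of k] by (auto simp: u_def simplex_pts_def)
      qed
    qed
    then obtain p where p: "\<And>j. j < n \<Longrightarrow> p j \<in> \<rat> \<and> x j < p j \<and> p j < u j" by metis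
    let ?a = "restrict q {..<n}" and ?b = "restrict p {..<n}"
    have "ordered_box n S T ?a ?b"
      unfolding ordered_box_def
    proof (intro conjI allI impI)
      fix j assume "Suc j < n"
      then show "?b (Suc j) \<le> ?a j" using p[of "Suc j"] by (auto simp: u_def)
    next
      fix j assume j: "j < n"
      have "S < q j" using q[OF j] x(1) by (auto simp: simplex_pts_def split: if_splits intro: less_trans)
      then show "S \<le> ?a j" using j by simp
      have "q (j - 1) < T" if "j \<noteq> 0"
      proof -
        have j': "j - 1 < n" using j by simp
        then have "x (j - 1) < T" using x(1) by (simp add: simplex_pts_def)
        with q[OF j'] show ?thesis by linarith
      qed
      then show "?b j \<le> T" using p[OF j] j by (auto simp: u_def min_def split: if_splits)
    qed
    moreover have "?b i < c" using p[OF assms] assms by (auto simp: u_def)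
    moreover have "?a \<in> ?Q" "?b \<in> ?Q" using p q by auto
    moreover have "x \<in> box_pts n S T ?a ?b" using x p q by (force simp: box_pts_def)
    ultimately show "x \<in> \<Union>?\<B>" by blast
  qed
  ultimately show ?thesis by (intro exI[of _ ?\<B>]) (auto simp: boxes_def)
qed

lemma simplex_countable_boxes:
  assumes "0 < n"
  shows "\<exists>\<B>. countable \<B> \<and> \<B> \<subseteq> boxes n S T \<and> simplex_pts n S T = \<Union>\<B>"
proof -
  have "{x \<in> simplex_pts n S T. x 0 < T} = simplex_pts n S T" using assms by (auto simp: simplex_pts_def)
  then show ?thesis using simplex_lower_set_countable_boxes[OF assms, of S T T] by simp
qed

text \<open>The coordinates are measurable for the sigma-algebra generated by boxes, because their
  lower level sets are countable unions of boxes. Hence so is the inclusion into the cube.\<close>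

lemma sets_simplex_measure_boxes:
  assumes "A \<in> sets (simplex_measure n S T)" and "0 < n"
  shows "A \<in> sigma_sets (simplex_pts n S T) (boxes n S T)"
proof -
  let ?N = "sigma (simplex_pts n S T) (boxes n S T)"
  have sN: "sets ?N = sigma_sets (simplex_pts n S T) (boxes n S T)" "space ?N = simplex_pts n S T"
    using boxes_Pow by (auto simp: sets_measure_of space_measure_of_conv)
  have "(\<lambda>x. x) \<in> ?N \<rightarrow>\<^sub>M PiM {..<n} (\<lambda>_. lborel :: real measure)"
  proof (rule measurable_PiM_single')
    show "(\<lambda>x i. x i) \<in> space ?N \<rightarrow> {..<n} \<rightarrow>\<^sub>E space (lborel :: real measure)"
      unfolding sN(2) by (auto simp: simplex_pts_def)
    fix i assume i: "i \<in> {..<n}"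
    have "(\<lambda>x. x i) \<in> borel_measurable ?N"
      unfolding borel_measurable_iff_less
    proof
      fix c
      obtain \<B> where "countable \<B>" "\<B> \<subseteq> boxes n S T" "{x \<in> simplex_pts n S T. x i < c} = \<Union>\<B>"
        using simplex_lower_set_countable_boxes[of i n S T c] i by auto
      then show "{x \<in> space ?N. x i < c} \<in> sets ?N"
        unfolding sN(2) by (simp only:) (rule sets.countable_Union, auto simp: sN)
    qed
    then show "(\<lambda>x. x i) \<in> ?N \<rightarrow>\<^sub>M lborel" by simp
  qed
  moreover obtain B where B: "B \<in> sets (cube_measure n)" "A = simplex_pts n S T \<inter> B"
    using assms(1) unfolding simplex_measure_def sets_restrict_space by auto
  ultimately have "(\<lambda>x. x) -` B \<inter> space ?N \<in> sets ?N" by (intro measurable_sets)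
  then show ?thesis using B sN by (simp add: Int_commute)
qed

lemma boxes_sets:
  assumes "0 < n" "A \<in> boxes n S T" shows "A \<in> sets (simplex_measure n S T)"
proof -
  obtain a b where A: "A = box_pts n S T a b" using assms by (auto simp: boxes_def)
  have "A = simplex_pts n S T \<inter> PiE {..<n} (\<lambda>i. {a i<..b i})"
    unfolding A box_pts_def by (auto simp: simplex_pts_def)
  moreover have "PiE {..<n} (\<lambda>i. {a i<..b i}) \<in> sets (cube_measure n)" by (rule sets_PiM_I_finite) auto
  ultimately show ?thesis unfolding simplex_measure_def sets_restrict_space by blast
qed

lemma emeasure_simplex_finite: "emeasure (simplex_measure n S T) (simplex_pts n S T) < \<infinity>"
proof -
  have "emeasure (simplex_measure n S T) (simplex_pts n S T) = emeasure (cube_measure n) (simplex_pts n S T)"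
    unfolding simplex_measure_def by (subst emeasure_restrict_space)
      (use sets.sets_into_space[OF simplex_pts_sets[of n S T]] in \<open>auto simp: Int_absorb2\<close>)
  also have "\<dots> \<le> emeasure (cube_measure n) (PiE {..<n} (\<lambda>_. {S..T}))"
    by (intro emeasure_mono sets_PiM_I_finite) (auto simp: simplex_pts_def PiE_iff extensional_def
      less_imp_le)
  also have "\<dots> = (\<Prod>i<n. emeasure lborel {S..T})"
    by (rule lborel_prod.emeasure_PiM) auto
  also have "\<dots> < \<infinity>"
    by (simp add: emeasure_lborel_Icc_eq power_less_top_ennreal)
  finally show ?thesis .
qed

definition coeff_eq :: "real \<Rightarrow> real \<Rightarrow> (nat \<Rightarrow> (nat \<Rightarrow> real) \<Rightarrow> 'a::euclidean_space) \<Rightarrow> (nat \<Rightarrow> (nat \<Rightarrow>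
  real) \<Rightarrow> 'a) \<Rightarrow> bool" where
  "coeff_eq S T f g \<longleftrightarrow> (\<forall>n. AE t in simplex_measure (Suc n) S T. f n t = g n t)"

section \<open>Existence of iterated integrals for all square-integrable kernels\<close>

context brownian
begin

lemma iter_int_sqn_finite:
  assumes "0 \<le> S" "iter_int S n t g X" shows "sqn M X < \<infinity>"
proof (cases n)
  case 0
  then have "sqn M X = sqn M (\<lambda>_. g (\<lambda>_. undefined))" using assms by (intro sqn_cong_AE) simp
  then show ?thesis by (simp add: sqn_def emeasure_space_1)
next
  case (Suc k)
  then obtain Y where "has_ito_integral M W S t Y X" using assms by auto
  then show ?thesis using has_ito_sqn[of S t Y X 0] assms(1) by (auto simp: has_ito_integral_def
    L2_adapted_iff)
qed

text \<open>By the ordering, all intervals but the outermost lie below \<open>a 0\<close>. So the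
  inner integral is a product of increments known at time \<open>a 0\<close>, and the outer
  integrand equals it on \<open>(a 0, b 0]\<close> and vanishes elsewhere. It is a simple process.
  Measurability with respect to the filtration is part of the induction, since it is what makes the
  integrand admissible.\<close>

lemma iter_int_box:
  fixes v :: "'a::euclidean_space"
  assumes S: "0 \<le> S" and St: "S \<le> t" and box: "ordered_box n S t a b" and ab: "\<And>i. i < n \<Longrightarrow> a i \<le> b i"
  shows "(\<lambda>\<omega>. (\<Prod>i<n. W (b i) \<omega> - W (a i) \<omega>) *\<^sub>R v) \<in> borel_measurable (increment_filtration M W S t) \<and>
    iter_int S n t (\<lambda>x. if \<forall>i<n. a i < x i \<and> x i \<le> b i then v else 0) (\<lambda>\<omega>. (\<Prod>i<n. W (b i) \<omega> - W (a
      i) \<omega>) *\<^sub>R v)"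
  using St box ab
proof (induction n arbitrary: a b t)
  case (Suc n)
  define Z where "Z = (\<lambda>\<omega>. (\<Prod>i<n. W (b (Suc i)) \<omega> - W (a (Suc i)) \<omega>) *\<^sub>R v)"
  have a0: "S \<le> a 0" "a 0 \<le> b 0" "b 0 \<le> t" using Suc.prems unfolding ordered_box_def by auto
  have IH: "Z \<in> borel_measurable (increment_filtration M W S t') \<and>
    iter_int S n t' (\<lambda>x. if \<forall>i<n. a (Suc i) < x i \<and> x i \<le> b (Suc i) then v else 0) Z" if "a 0 \<le> t'" for t'
    unfolding Z_def
  proof (rule Suc.IH)
    show "S \<le> t'" using a0 that by simp
    have le: "b (Suc i) \<le> a 0" if "i < n" for i
      using that
    proof (induction i)
      case 0 then show ?case using Suc.prems(2) by (auto simp: ordered_box_def)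
    next
      case (Suc i)
      then have "b (Suc (Suc i)) \<le> a (Suc i)" "a (Suc i) \<le> b (Suc i)" using \<open>ordered_box (Suc n) S t
        a b\<close> Suc.prems \<open>\<And>i. i < Suc n \<Longrightarrow> a i \<le> b i\<close>
        by (auto simp: ordered_box_def)
      then show ?case using Suc by simp
    qed
    show "ordered_box n S t' (\<lambda>i. a (Suc i)) (\<lambda>i. b (Suc i))"
      using Suc.prems(2) le that unfolding ordered_box_def by (auto intro: order_trans)
  qed (use Suc.prems in auto)
  \<comment> \<open>Nodes \<open>S\<close>, \<open>a 0\<close>, \<open>b 0\<close>,
    \<open>t\<close>: of the three pieces only the middle one carries \<open>Z\<close>.\<close>
  let ?s = "\<lambda>i::nat. if i = 0 then S else if i = 1 then a 0 else if i = 2 then b 0 else t"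
  let ?z = "\<lambda>i::nat. if i = 1 then Z else (\<lambda>_. 0)"
  have ZM: "Z \<in> borel_measurable M" using IH[of "a 0"] S filtration_measurable by blast
  have "sqn M Z < \<infinity>" using IH[of "a 0"] iter_int_sqn_finite[OF S] by blast
  then have Zint: "integrable M (\<lambda>\<omega>. (norm (Z \<omega>))\<^sup>2)"
    using ZM by (intro integrableI_bounded) (auto simp: sqn_def)
  have sd: "simple_data M W S t 3 ?s ?z"
    unfolding simple_data_def using a0 Zint IH[of "a 0"]
    by (auto simp: less_Suc_eq numeral_3_eq_3)
  have sv: "simple_value 3 ?s ?z r \<omega> = (if a 0 < r \<and> r \<le> b 0 then Z \<omega> else 0)" for r \<omega>
    by (simp add: simple_value_def numeral_3_eq_3)
  have si: "simple_integral W 3 ?s ?z = (\<lambda>\<omega>. (\<Prod>i<Suc n. W (b i) \<omega> - W (a i) \<omega>) *\<^sub>R v)"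
    by (auto simp: simple_integral_def numeral_3_eq_3 Z_def prod.lessThan_Suc_shift simp del:
      prod.lessThan_Suc)
  have "iter_int S n t1 (\<lambda>x. if \<forall>i<Suc n. a i < cons_pt n t1 x i \<and> cons_pt n t1 x i \<le> b i then v
    else 0) (simple_value 3 ?s ?z t1)"
    if t1: "S < t1" "t1 < t" for t1
  proof -
    have e: "(\<forall>i<Suc n. a i < cons_pt n t1 x i \<and> cons_pt n t1 x i \<le> b i) \<longleftrightarrow> (a 0 < t1 \<and> t1 \<le> b 0) \<and>
      (\<forall>i<n. a (Suc i) < x i \<and> x i \<le> b (Suc i))" for x
      unfolding All_less_Suc2 by (simp add: cons_pt_def)
    show ?thesis
    proof (cases "a 0 < t1 \<and> t1 \<le> b 0")
      case True
      have "simple_value 3 ?s ?z t1 = Z" by (rule ext, unfold sv, simp add: True)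
      then show ?thesis unfolding e using True IH[of t1] by simp
    next
      case False
      have "simple_value 3 ?s ?z t1 = (\<lambda>_. 0)" by (rule ext, unfold sv, simp only: False if_False)
      then show ?thesis unfolding e using False iter_int_zero[OF S less_imp_le[OF t1(1)], of n] by
        (simp only: simp_thms if_False)
    qed
  qed
  then have "iter_int S (Suc n) t (\<lambda>x. if \<forall>i<Suc n. a i < x i \<and> x i \<le> b i then v else 0) (\<lambda>\<omega>.
    (\<Prod>i<Suc n. W (b i) \<omega> - W (a i) \<omega>) *\<^sub>R v)"
    unfolding has_iterated_integral.simps using has_ito_simple[OF sd S] unfolding si
    by (intro exI[of _ "simple_value 3 ?s ?z"] conjI AE_I2) auto
  moreover have "(\<lambda>\<omega>. (W (b 0) \<omega> - W (a 0) \<omega>) *\<^sub>R Z \<omega>) \<in> borel_measurable (increment_filtration M W S t)"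
    using a0 IH[of t] by (intro borel_measurable_scaleR increment_measurable_filtration) auto
  then have "(\<lambda>\<omega>. (\<Prod>i<Suc n. W (b i) \<omega> - W (a i) \<omega>) *\<^sub>R v) \<in> borel_measurable (increment_filtration M W S t)"
    by (simp add: Z_def prod.lessThan_Suc_shift mult.assoc del: prod.lessThan_Suc)
  ultimately show ?case by blast
qed auto

definition representable :: "nat \<Rightarrow> real \<Rightarrow> real \<Rightarrow> ((nat \<Rightarrow> real) \<Rightarrow> 'a::euclidean_space) \<Rightarrow> bool" where
  "representable n S T f \<longleftrightarrow> f \<in> borel_measurable (simplex_measure (Suc n) S T) \<and> (\<exists>X. iter_process n S T f X)"

text \<open>Kernels that agree on the simplex are at distance zero, so closedness applied to a
  constant sequence exchanges one for the other.\<close>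

lemma iter_int_cong_simplex:
  assumes S: "0 \<le> S" and St: "S \<le> t" and X: "iter_int S n t f X" and eq: "\<And>x. x \<in> simplex_pts n S t
    \<Longrightarrow> f x = g x"
    and f: "f \<in> borel_measurable (simplex_measure n S t)"
  shows "iter_int S n t g X"
proof -
  have g: "g \<in> borel_measurable (simplex_measure n S t)"
    using f eq by (subst measurable_cong[of _ g f]) auto
  have 0: "sqn (simplex_measure n S t) (\<lambda>s. f s - g s) = 0"
    unfolding sqn_def by (subst nn_integral_cong[of _ _ "\<lambda>_. 0"]) (auto simp: eq)
  have "sqn M (\<lambda>\<omega>. X \<omega> - X \<omega>) = 0" by (simp add: sqn_def)
  then show ?thesis
    using iter_int_closed[OF S, of n, where ?'a='a] X f g 0 iter_int_measurable[OF X] St unfolding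
      iter_int_closed_def
    by (elim allE[of _ t] allE[of _ "\<lambda>_. f"] allE[of _ "\<lambda>_. X"] allE[of _ g] allE[of _ X]) auto
qed

text \<open>A box in the simplex of dimension \<open>Suc n\<close> gives an iterated integral of
  order \<open>Suc n\<close> up to \<open>T\<close>. The integrand of its outer Ito integral is
  precisely the process of order \<open>n\<close> that is wanted.\<close>

lemma representable_box:
  fixes v :: "'a::euclidean_space"
  assumes S: "0 \<le> S" and ST: "S \<le> T" and B: "B \<in> boxes (Suc n) S T"
  shows "representable n S T (\<lambda>x. indicator B x *\<^sub>R v)"
proof -
  obtain a b where ob: "ordered_box (Suc n) S T a b" and Be: "B = box_pts (Suc n) S T a b" using B
    by (auto simp: boxes_def)
  have [measurable]: "B \<in> sets (simplex_measure (Suc n) S T)" by (rule boxes_sets[OF _ B]) simp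
  have m: "(\<lambda>x. indicator B x *\<^sub>R v) \<in> borel_measurable (simplex_measure (Suc n) S T)" by measurable
  have "\<exists>X. iter_process n S T (\<lambda>x. indicator B x *\<^sub>R v) X"
  proof (cases "\<forall>i<Suc n. a i \<le> b i")
    case True
    let ?f = "\<lambda>x. if \<forall>i<Suc n. a i < x i \<and> x i \<le> b i then v else 0"
    have eq: "?f x = indicator B x *\<^sub>R v" if "x \<in> simplex_pts (Suc n) S T" for x
      using that by (auto simp: Be box_pts_def)
    have fm: "?f \<in> borel_measurable (simplex_measure (Suc n) S T)"
      using m eq by (subst measurable_cong[of _ _ "\<lambda>x. indicator B x *\<^sub>R v"]) auto
    have "iter_int S (Suc n) T ?f (\<lambda>\<omega>. (\<Prod>i<Suc n. W (b i) \<omega> - W (a i) \<omega>) *\<^sub>R v)"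
      using iter_int_box[OF S ST ob, of v] True by blast
    then have "iter_int S (Suc n) T (\<lambda>x. indicator B x *\<^sub>R v) (\<lambda>\<omega>. (\<Prod>i<Suc n. W (b i) \<omega> - W (a i) \<omega>) *\<^sub>R v)"
      by (rule iter_int_cong_simplex[OF S ST _ eq fm])
    then show ?thesis unfolding iter_process_def by (auto simp: has_ito_integral_def)
  next
    case False
    then have "B = {}" unfolding Be box_pts_def by (force simp: not_le)
    then show ?thesis using iter_process_zero[OF S, of n T] by auto
  qed
  with m show ?thesis by (simp add: representable_def)
qed

lemma representable_add:
  "0 \<le> S \<Longrightarrow> representable n S T f \<Longrightarrow> representable n S T g \<Longrightarrow> representable n S T (\<lambda>x. f x + g x)"
  unfolding representable_def by (blast intro: borel_measurable_add iter_process_add)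

lemma representable_diff:
  "0 \<le> S \<Longrightarrow> representable n S T f \<Longrightarrow> representable n S T g \<Longrightarrow> representable n S T (\<lambda>x. f x - g x)"
  unfolding representable_def by (blast intro: borel_measurable_diff iter_process_diff)

lemma representable_zero: "0 \<le> S \<Longrightarrow> representable n S T (\<lambda>x. 0)"
  unfolding representable_def using iter_process_zero by auto

lemma representable_sum:
  assumes "0 \<le> S" "finite I" "\<And>i. i \<in> I \<Longrightarrow> representable n S T (f i)"
  shows "representable n S T (\<lambda>x. \<Sum>i\<in>I. f i x)"
  using assms(2,3) by (induction I) (auto intro: representable_zero representable_add assms(1))

lemma representable_limit:
  fixes f :: "(nat \<Rightarrow> real) \<Rightarrow> 'a::euclidean_space"
  assumes S: "0 \<le> S" and fj: "\<And>j. representable n S T (fj j)" and f: "f \<in> borel_measurable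
    (simplex_measure (Suc n) S T)"
    and lim: "\<And>x. x \<in> simplex_pts (Suc n) S T \<Longrightarrow> (\<lambda>j. fj j x) \<longlonglongrightarrow> f x"
    and g: "g \<in> borel_measurable (simplex_measure (Suc n) S T)" "sqn (simplex_measure (Suc n) S T) g < \<infinity>"
    and bd: "\<And>j x. x \<in> simplex_pts (Suc n) S T \<Longrightarrow> norm (fj j x - f x) \<le> norm (g x :: real)"
  shows "representable n S T f"
proof -
  have fjm: "fj j \<in> borel_measurable (simplex_measure (Suc n) S T)" for j using fj by (simp add:
    representable_def)
  obtain X where X: "\<And>j. iter_process n S T (fj j) (X j)" using fj unfolding representable_def by metis
  have "(\<lambda>j. sqn (simplex_measure (Suc n) S T) (\<lambda>x. fj j x - f x)) \<longlonglongrightarrow> (\<integral>\<^sup>+ x. 0 \<partial>simplex_measure (Suc n) S T)"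
    unfolding sqn_def
  proof (rule nn_integral_dominated_convergence)
    show "(\<lambda>x. ennreal ((norm (fj j x - f x))\<^sup>2)) \<in> borel_measurable (simplex_measure (Suc n) S T)" for j
      using fjm f by measurable
    show "(\<lambda>x. ennreal ((norm (g x))\<^sup>2)) \<in> borel_measurable (simplex_measure (Suc n) S T)" using
      g(1) by measurable
    show "AE x in simplex_measure (Suc n) S T. ennreal ((norm (fj j x - f x))\<^sup>2) \<le> ennreal ((norm (g
      x))\<^sup>2)" for j
      by (rule AE_I2, rule ennreal_leI, rule power_mono, rule bd) simp_all
    show "(\<integral>\<^sup>+ x. ennreal ((norm (g x))\<^sup>2) \<partial>simplex_measure (Suc n) S T) < \<infinity>" using g(2) by (simp
      add: sqn_def)
    show "AE x in simplex_measure (Suc n) S T. (\<lambda>j. ennreal ((norm (fj j x - f x))\<^sup>2)) \<longlonglongrightarrow> 0"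
    proof (rule AE_I2)
      fix x assume "x \<in> space (simplex_measure (Suc n) S T)"
      then have "(\<lambda>j. fj j x) \<longlonglongrightarrow> f x" using lim by simp
      then have "(\<lambda>j. ennreal ((norm (fj j x - f x))\<^sup>2)) \<longlonglongrightarrow> ennreal ((norm (f x - f x))\<^sup>2)"
        by (intro tendsto_ennrealI tendsto_intros)
      then show "(\<lambda>j. ennreal ((norm (fj j x - f x))\<^sup>2)) \<longlonglongrightarrow> 0" by simp
    qed
  qed simp
  then have l: "(\<lambda>j. sqn (simplex_measure (Suc n) S T) (\<lambda>x. fj j x - f x)) \<longlonglongrightarrow> 0" by simp
  obtain Z where "iter_process n S T f Z"
    by (rule iter_process_limit[OF S S X fjm f l])
  then show ?thesis using f by (auto simp: representable_def)
qed

lemma sqn_const_simplex: "sqn (simplex_measure n S T) (\<lambda>_. c) < \<infinity>"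
  using emeasure_simplex_finite[of n S T] by (simp add: sqn_def ennreal_mult_less_top)

text \<open>A Dynkin argument over the intersection-stable boxes. Complements need the whole simplex
  to be representable, which is obtained separately as a countable union of boxes.\<close>

lemma representable_sets:
  fixes v :: "'a::euclidean_space"
  assumes S: "0 \<le> S" and ST: "S \<le> T" and A: "A \<in> sets (simplex_measure (Suc n) S T)"
  shows "representable n S T (\<lambda>x. indicator A x *\<^sub>R v)"
proof -
  let ?\<Delta> = "simplex_pts (Suc n) S T"
  have bnd: "norm (indicator A x *\<^sub>R v - indicator B x *\<^sub>R v) \<le> norm (norm v)" for A B and x :: "nat \<Rightarrow> real"
    by (auto simp: indicator_def)
  have limit: "representable n S T (\<lambda>x. indicator A x *\<^sub>R v)"
    if "\<And>j. representable n S T (\<lambda>x. indicator (Aj j) x *\<^sub>R v)" "A \<in> sets (simplex_measure (Suc n) S T)"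
      "\<And>x. (\<lambda>j. indicator (Aj j) x :: real) \<longlonglongrightarrow> indicator A x" for Aj A
    by (rule representable_limit[OF S that(1) _ _ _ sqn_const_simplex bnd])
      (use that in \<open>auto intro!: tendsto_scaleR\<close>)
  \<comment> \<open>Inclusion and exclusion of the last box. The sets
    \<open>Bi i \<inter> Bi k\<close> are boxes again, so the induction hypothesis, general in
    \<open>Bi\<close>, covers their union too.\<close>
  have fin_union: "representable n S T (\<lambda>x. indicator (\<Union>i<k. Bi i) x *\<^sub>R v)" if "\<And>i. Bi i \<in> boxes
    (Suc n) S T" for k and Bi :: "nat \<Rightarrow> (nat \<Rightarrow> real) set"
    using that
  proof (induction k arbitrary: Bi)
    case 0
    then show ?case using representable_zero[OF S] by simp
  next
    case (Suc k)
    have "representable n S T (\<lambda>x. indicator (\<Union>i<k. Bi i) x *\<^sub>R v + indicator (Bi k) x *\<^sub>R v -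
      indicator (\<Union>i<k. Bi i \<inter> Bi k) x *\<^sub>R v)"
      by (intro representable_diff[OF S] representable_add[OF S] Suc.IH Suc.prems representable_box[OF S ST]
          Int_stableD[OF Int_stable_boxes])
    moreover have "indicator (\<Union>i<k. Bi i) x *\<^sub>R v + indicator (Bi k) x *\<^sub>R v - indicator (\<Union>i<k. Bi i
      \<inter> Bi k) x *\<^sub>R v
      = indicator (\<Union>i<Suc k. Bi i) x *\<^sub>R v" for x
      by (auto simp: indicator_def lessThan_Suc)
    ultimately show ?case by simp
  qed
  have whole: "representable n S T (\<lambda>x. indicator ?\<Delta> x *\<^sub>R v)"
  proof -
    obtain \<B> where B: "countable \<B>" "\<B> \<subseteq> boxes (Suc n) S T" "?\<Delta> = \<Union>\<B>" using
      simplex_countable_boxes[of "Suc n" S T] by auto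
    show ?thesis
    proof (cases "\<B> = {}")
      case True
      then show ?thesis using B representable_zero[OF S] by simp
    next
      case False
      then have r: "range (from_nat_into \<B>) = \<B>" using B(1) by (rule range_from_nat_into)
      show ?thesis
      proof (rule limit)
        show "representable n S T (\<lambda>x. indicator (\<Union>i<j. from_nat_into \<B> i) x *\<^sub>R v)" for j
          by (rule fin_union) (use r B in blast)
        show "?\<Delta> \<in> sets (simplex_measure (Suc n) S T)" using sets.top[of "simplex_measure (Suc n) S
          T"] by simp
        have "?\<Delta> = (\<Union>i. from_nat_into \<B> i)" using B r by simp
        then show "(\<lambda>j. indicator (\<Union>i<j. from_nat_into \<B> i) x :: real) \<longlonglongrightarrow> indicator ?\<Delta> x" for x
          using LIMSEQ_indicator_UN[of "from_nat_into \<B>" x] by simp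
      qed
    qed
  qed
  have "A \<in> sigma_sets ?\<Delta> (boxes (Suc n) S T)" using sets_simplex_measure_boxes[OF A] by simp
  with Int_stable_boxes boxes_Pow show ?thesis
  proof (induction rule: sigma_sets_induct_disjoint)
    case (basic A) then show ?case by (rule representable_box[OF S ST])
  next
    case empty then show ?case using representable_zero[OF S] by simp
  next
    case (compl A)
    have "A \<subseteq> ?\<Delta>" using compl(1) boxes_Pow by (rule sigma_sets_into_sp[rotated])
    then have e: "indicator (?\<Delta> - A) x *\<^sub>R v = indicator ?\<Delta> x *\<^sub>R v - indicator A x *\<^sub>R v" for x by
      (auto simp: indicator_def)
    show ?case unfolding e by (rule representable_diff[OF S whole compl(2)])
  next
    case (union A)
    have sub: "sigma_sets ?\<Delta> (boxes (Suc n) S T) \<subseteq> sets (simplex_measure (Suc n) S T)"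
      using sets.sigma_sets_subset[of "boxes (Suc n) S T" "simplex_measure (Suc n) S T"]
        boxes_sets[of "Suc n" _ S T] by auto
    show ?case
    proof (rule limit)
      show "representable n S T (\<lambda>x. indicator (\<Union>i<j. A i) x *\<^sub>R v)" for j
      proof -
        have "representable n S T (\<lambda>x. \<Sum>i<j. indicator (A i) x *\<^sub>R v)"
          by (rule representable_sum[OF S]) (use union(3) in auto)
        moreover have "(\<Sum>i<j. indicator (A i) x *\<^sub>R v) = indicator (\<Union>i<j. A i) x *\<^sub>R v" for x
        proof -
          have "indicator (\<Union>i<j. A i) x = (\<Sum>i<j. indicator (A i) x :: real)"
            by (rule indicator_UN_disjoint) (use union(1) in \<open>auto simp: disjoint_family_on_def\<close>)
          then show ?thesis by (simp add: scaleR_sum_left)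
        qed
        ultimately show ?thesis by simp
      qed
      show "(\<Union>i. A i) \<in> sets (simplex_measure (Suc n) S T)" using union(2) sub by blast
      show "(\<lambda>j. indicator (\<Union>i<j. A i) x :: real) \<longlonglongrightarrow> indicator (\<Union>i. A i) x" for x
        by (rule LIMSEQ_indicator_UN)
    qed
  qed
qed

lemma L2_simplex_iff: "f \<in> L2_simplex n S T \<longleftrightarrow> f \<in> borel_measurable (simplex_measure n S T) \<and> sqn
  (simplex_measure n S T) f < \<infinity>"
  by (simp add: L2_simplex_def sqn_def)

text \<open>Simple functions are finite combinations of representable indicators, and approximate
  \<open>f\<close> pointwise under a square-integrable bound.\<close>

lemma representable_L2:
  fixes f :: "(nat \<Rightarrow> real) \<Rightarrow> 'a::euclidean_space"
  assumes S: "0 \<le> S" and ST: "S \<le> T" and f: "f \<in> L2_simplex (Suc n) S T"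
  shows "representable n S T f"
proof -
  let ?N = "simplex_measure (Suc n) S T"
  have fm: "f \<in> borel_measurable ?N" and ff: "sqn ?N f < \<infinity>" using f by (auto simp: L2_simplex_iff)
  obtain F where F: "\<And>i. simple_function ?N (F i)" "\<And>x. x \<in> space ?N \<Longrightarrow> (\<lambda>i. F i x) \<longlonglongrightarrow> f x"
      "\<And>i x. x \<in> space ?N \<Longrightarrow> dist (F i x) 0 \<le> 2 * dist (f x) 0"
    using borel_measurable_implies_sequence_metric[OF fm, of 0] by blast
  show ?thesis
  proof (rule representable_limit[OF S _ fm])
    \<comment> \<open>The approximants are bounded by \<open>2 * norm (f x)\<close>, so their
      differences from \<open>f\<close> are bounded by three times the norm of
      \<open>f\<close>.\<close>
    show "(\<lambda>x. 3 * norm (f x)) \<in> borel_measurable ?N" using fm by measurable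
    have "sqn ?N (\<lambda>x. 3 *\<^sub>R norm (f x)) = ennreal (3\<^sup>2) * sqn ?N (\<lambda>x. norm (f x))"
      by (rule sqn_scaleR) (use fm in measurable)
    also have "sqn ?N (\<lambda>x. norm (f x)) = sqn ?N f" by (simp add: sqn_def)
    finally show "sqn ?N (\<lambda>x. 3 * norm (f x)) < \<infinity>" using ff by (simp add: ennreal_mult_less_top)
    show "norm (F j x - f x) \<le> norm (3 * norm (f x))" if "x \<in> simplex_pts (Suc n) S T" for j x
      using F(3)[of x j] that norm_triangle_ineq4[of "F j x" "f x"] by simp
    show "representable n S T (F j)" for j
    proof -
      let ?G = "\<lambda>x. \<Sum>y\<in>F j ` space ?N. indicator (F j -` {y} \<inter> space ?N) x *\<^sub>R y"
      have fin: "finite (F j ` space ?N)" using F(1) by (rule simple_functionD)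
      have G: "representable n S T ?G"
        by (intro representable_sum[OF S fin] representable_sets[OF S ST simple_functionD(2)[OF F(1)]])
      have e: "?G x = F j x" if "x \<in> space ?N" for x
      proof -
        have "?G x = (\<Sum>y\<in>F j ` space ?N. if y = F j x then y else 0)"
          using that by (intro sum.cong) auto
        then show ?thesis using that fin by (simp add: sum.delta)
      qed
      have Fm: "F j \<in> borel_measurable ?N" by (rule borel_measurable_simple_function[OF F(1)])
      \<comment> \<open>The combination of indicators equals \<open>F j\<close> only on the simplex.
        The limit of a constant sequence transfers representability across this.\<close>
      show ?thesis
        by (rule representable_limit[OF S, of n T "\<lambda>_. ?G", OF G Fm _ _ sqn_const_simplex[of "Suc n"
          S T 0]]) (use e in auto)
    qed
  qed (use F(2) in auto)
qed

text \<open>Existence makes the choice in \<open>wiener_process\<close> meaningful. By the isometry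
  any two admissible choices agree almost everywhere.\<close>

lemma wiener_process_iter_process:
  fixes f :: "(nat \<Rightarrow> real) \<Rightarrow> 'a::euclidean_space"
  assumes "0 \<le> S" "S \<le> T" "f \<in> L2_simplex (Suc n) S T"
  shows "iter_process n S T f (wiener_process M W S T n f)"
proof -
  obtain X where "iter_process n S T f X" using representable_L2[OF assms] by (auto simp: representable_def)
  then show ?thesis
    unfolding wiener_process_def iter_process_def by (rule someI[of "\<lambda>X. X \<in> L2_adapted M W S T \<and> _ X"])
qed

section \<open>Chaos expansions of processes: isometry, uniqueness, existence\<close>

lemma has_chaos_expansion_iff:
  fixes \<xi> :: "real \<Rightarrow> 'w \<Rightarrow> 'a::euclidean_space"
  shows "has_chaos_expansion M W S T \<xi> f \<longleftrightarrow> \<xi> \<in> L2_adapted M W S T \<and> (\<forall>n. f n \<in> L2_simplex (Suc n) S T) \<and>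
    (\<lambda>N. sqn (path_measure S T) (\<lambda>(t, \<omega>). \<xi> t \<omega> - (\<Sum>n<N. wiener_process M W S T n (f n) t \<omega>))) \<longlonglongrightarrow> 0"
  by (simp add: has_chaos_expansion_def sqn_def case_prod_unfold)

lemma wiener_process_L2_adapted:
  assumes "0 \<le> S" "S \<le> T" "f \<in> L2_simplex (Suc n) S T"
  shows "wiener_process M W S T n f \<in> L2_adapted M W S T"
  using wiener_process_iter_process[OF assms] by (simp add: iter_process_def)

lemma chaos_sum_L2_adapted:
  assumes "0 \<le> S" "S \<le> T" "\<And>n. f n \<in> L2_simplex (Suc n) S T"
  shows "(\<lambda>t \<omega>. \<Sum>n<N. wiener_process M W S T n (f n) t \<omega>) \<in> L2_adapted M W S T"
  by (intro L2_adapted_sum wiener_process_L2_adapted assms)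

text \<open>Parseval's identity for the difference of two expansions. It is exact for the partial
  sums by orthogonality, and these converge in mean square.\<close>

lemma has_chaos_isometry:
  fixes \<xi> \<eta> :: "real \<Rightarrow> 'w \<Rightarrow> 'a::euclidean_space"
  assumes S: "0 \<le> S" and ST: "S \<le> T" and \<xi>: "has_chaos_expansion M W S T \<xi> f" and \<eta>:
    "has_chaos_expansion M W S T \<eta> g"
  shows "(\<lambda>N. \<Sum>n<N. sqn (simplex_measure (Suc n) S T) (\<lambda>s. f n s - g n s)) \<longlonglongrightarrow> sqn (path_measure S T)
    (\<lambda>(t, \<omega>). \<xi> t \<omega> - \<eta> t \<omega>)"
proof -
  let ?X = "\<lambda>n. wiener_process M W S T n (f n)" and ?Y = "\<lambda>n. wiener_process M W S T n (g n)"
  have fL: "f n \<in> L2_simplex (Suc n) S T" and gL: "g n \<in> L2_simplex (Suc n) S T" for n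
    using \<xi> \<eta> by (auto simp: has_chaos_expansion_iff)
  have dL: "(\<lambda>t \<omega>. \<xi> t \<omega> - \<eta> t \<omega>) \<in> L2_adapted M W S T"
    using \<xi> \<eta> by (auto simp: has_chaos_expansion_iff intro: L2_adapted_diff)
  have e: "sqn (path_measure S T) (\<lambda>(t, \<omega>). \<Sum>n<N. ?X n t \<omega> - ?Y n t \<omega>) = (\<Sum>n<N. sqn (simplex_measure
    (Suc n) S T) (\<lambda>s. f n s - g n s))" for N
    by (rule sqn_sum_iter_process[OF S iter_process_diff[OF S wiener_process_iter_process[OF S ST
      fL] wiener_process_iter_process[OF S ST gL]]])
      (use fL gL in \<open>auto simp: L2_simplex_iff intro!: borel_measurable_diff\<close>)
  have pL: "(\<lambda>t \<omega>. \<Sum>n<N. ?X n t \<omega> - ?Y n t \<omega>) \<in> L2_adapted M W S T" for N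
    by (intro L2_adapted_sum L2_adapted_diff wiener_process_L2_adapted S ST fL gL)
  have m1: "(\<lambda>(t, \<omega>). \<xi> t \<omega> - (\<Sum>n<N. ?X n t \<omega>)) \<in> borel_measurable (path_measure S T)" for N
    by (rule L2_adapted_measurable[OF L2_adapted_diff[OF _ chaos_sum_L2_adapted[OF S ST fL]]]) (use
      \<xi> in \<open>simp add: has_chaos_expansion_iff\<close>)
  have m2: "(\<lambda>(t, \<omega>). \<eta> t \<omega> - (\<Sum>n<N. ?Y n t \<omega>)) \<in> borel_measurable (path_measure S T)" for N
    by (rule L2_adapted_measurable[OF L2_adapted_diff[OF _ chaos_sum_L2_adapted[OF S ST gL]]]) (use
      \<eta> in \<open>simp add: has_chaos_expansion_iff\<close>)
  have "(\<lambda>N. sqn (path_measure S T) (\<lambda>(t, \<omega>). \<Sum>n<N. ?X n t \<omega> - ?Y n t \<omega>)) \<longlonglongrightarrow> sqn (path_measure S T)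
    (\<lambda>(t, \<omega>). \<xi> t \<omega> - \<eta> t \<omega>)"
  proof (rule sqn_tendsto)
    show "(\<lambda>(t, \<omega>). \<Sum>n<N. ?X n t \<omega> - ?Y n t \<omega>) \<in> borel_measurable (path_measure S T)" for N by (rule
      L2_adapted_measurable[OF pL])
    show "(\<lambda>(t, \<omega>). \<xi> t \<omega> - \<eta> t \<omega>) \<in> borel_measurable (path_measure S T)" by (rule
      L2_adapted_measurable[OF dL])
    show "sqn (path_measure S T) (\<lambda>(t, \<omega>). \<xi> t \<omega> - \<eta> t \<omega>) < \<infinity>" using dL by (simp add: L2_adapted_iff)
    show "(\<lambda>N. sqn (path_measure S T) (\<lambda>x. (case x of (t, \<omega>) \<Rightarrow> \<Sum>n<N. ?X n t \<omega> - ?Y n t \<omega>) - (case x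
      of (t, \<omega>) \<Rightarrow> \<xi> t \<omega> - \<eta> t \<omega>))) \<longlonglongrightarrow> 0"
    proof (rule tendsto_0_le_sum_ennreal)
      show "(\<lambda>N. sqn (path_measure S T) (\<lambda>(t, \<omega>). \<xi> t \<omega> - (\<Sum>n<N. ?X n t \<omega>))) \<longlonglongrightarrow> 0" using \<xi> by (simp
        add: has_chaos_expansion_iff)
      show "(\<lambda>N. sqn (path_measure S T) (\<lambda>(t, \<omega>). \<eta> t \<omega> - (\<Sum>n<N. ?Y n t \<omega>))) \<longlonglongrightarrow> 0" using \<eta> by (simp
        add: has_chaos_expansion_iff)
      fix N
      have "sqn (path_measure S T) (\<lambda>x. (case x of (t, \<omega>) \<Rightarrow> \<Sum>n<N. ?X n t \<omega> - ?Y n t \<omega>) - (case x of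
        (t, \<omega>) \<Rightarrow> \<xi> t \<omega> - \<eta> t \<omega>))
        = sqn (path_measure S T) (\<lambda>x. - (case x of (t, \<omega>) \<Rightarrow> \<xi> t \<omega> - (\<Sum>n<N. ?X n t \<omega>)) + (case x of
          (t, \<omega>) \<Rightarrow> \<eta> t \<omega> - (\<Sum>n<N. ?Y n t \<omega>)))"
        by (rule arg_cong[where f = "sqn _"]) (auto simp: sum_subtractf)
      also have "\<dots> \<le> 2 * sqn (path_measure S T) (\<lambda>x. - (case x of (t, \<omega>) \<Rightarrow> \<xi> t \<omega> - (\<Sum>n<N. ?X n t
        \<omega>))) + 2 * sqn (path_measure S T) (\<lambda>(t, \<omega>). \<eta> t \<omega> - (\<Sum>n<N. ?Y n t \<omega>))"
        by (rule sqn_add_le[OF borel_measurable_uminus[OF m1] m2])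
      finally show "sqn (path_measure S T) (\<lambda>x. (case x of (t, \<omega>) \<Rightarrow> \<Sum>n<N. ?X n t \<omega> - ?Y n t \<omega>) -
        (case x of (t, \<omega>) \<Rightarrow> \<xi> t \<omega> - \<eta> t \<omega>))
        \<le> 2 * sqn (path_measure S T) (\<lambda>(t, \<omega>). \<xi> t \<omega> - (\<Sum>n<N. ?X n t \<omega>)) + 2 * sqn (path_measure S
          T) (\<lambda>(t, \<omega>). \<eta> t \<omega> - (\<Sum>n<N. ?Y n t \<omega>))"
        unfolding sqn_minus .
    qed
  qed
  then show ?thesis unfolding e .
qed

text \<open>The squared distance is a sum of nonnegative terms, one per order, so it vanishes
  exactly when all of them do. This turns every equation between kernels into one between
  coefficient families.\<close>

lemma chaos_ae_equal_iff:
  fixes \<xi> \<eta> :: "real \<Rightarrow> 'w \<Rightarrow> 'a::euclidean_space"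
  assumes S: "0 \<le> S" and ST: "S \<le> T" and \<xi>: "has_chaos_expansion M W S T \<xi> f" and \<eta>:
    "has_chaos_expansion M W S T \<eta> g"
  shows "ae_equal M S T \<xi> \<eta> \<longleftrightarrow> coeff_eq S T f g"
proof -
  let ?a = "\<lambda>n. sqn (simplex_measure (Suc n) S T) (\<lambda>s. f n s - g n s)"
  have fm: "f n \<in> borel_measurable (simplex_measure (Suc n) S T)" and gm: "g n \<in> borel_measurable
    (simplex_measure (Suc n) S T)" for n
    using \<xi> \<eta> by (auto simp: has_chaos_expansion_iff L2_simplex_iff)
  have dm: "(\<lambda>(t, \<omega>). \<xi> t \<omega> - \<eta> t \<omega>) \<in> borel_measurable (path_measure S T)"
    by (rule L2_adapted_measurable[OF L2_adapted_diff]) (use \<xi> \<eta> in \<open>auto simp: has_chaos_expansion_iff\<close>)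
  note lim = has_chaos_isometry[OF assms]
  have "ae_equal M S T \<xi> \<eta> \<longleftrightarrow> sqn (path_measure S T) (\<lambda>(t, \<omega>). \<xi> t \<omega> - \<eta> t \<omega>) = 0"
    unfolding sqn_eq_0_iff[OF dm] ae_equal_def by (simp add: case_prod_unfold)
  also have "\<dots> \<longleftrightarrow> (\<forall>n. ?a n = 0)"
  proof
    assume z: "sqn (path_measure S T) (\<lambda>(t, \<omega>). \<xi> t \<omega> - \<eta> t \<omega>) = 0"
    show "\<forall>n. ?a n = 0"
    proof
      fix k
      have "?a k \<le> 0"
      proof (rule LIMSEQ_le_const[OF lim[unfolded z]], intro exI[of _ "Suc k"] allI impI)
        fix N assume "Suc k \<le> N"
        then show "?a k \<le> (\<Sum>n<N. ?a n)"
          using member_le_sum[of k "{..<N}" ?a] by auto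
      qed
      then show "?a k = 0" by simp
    qed
  next
    assume "\<forall>n. ?a n = 0"
    then have "(\<lambda>N. \<Sum>n<N. ?a n) = (\<lambda>N. 0)" by simp
    then show "sqn (path_measure S T) (\<lambda>(t, \<omega>). \<xi> t \<omega> - \<eta> t \<omega>) = 0"
      using lim by (simp add: LIMSEQ_const_iff)
  qed
  also have "\<dots> \<longleftrightarrow> coeff_eq S T f g"
    unfolding coeff_eq_def using sqn_eq_0_iff[OF borel_measurable_diff[OF fm gm]] by simp
  finally show ?thesis .
qed

text \<open>The processes for \<open>f n\<close>, \<open>g n\<close> and their sum are chosen
  independently of each other, so additivity holds only almost everywhere. It follows because the
  combination of the three has the zero kernel and hence norm zero.\<close>

lemma has_chaos_add:
  fixes \<xi> \<eta> :: "real \<Rightarrow> 'w \<Rightarrow> 'a::euclidean_space"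
  assumes S: "0 \<le> S" and ST: "S \<le> T" and \<xi>: "has_chaos_expansion M W S T \<xi> f" and \<eta>:
    "has_chaos_expansion M W S T \<eta> g"
  shows "has_chaos_expansion M W S T (\<lambda>t \<omega>. \<xi> t \<omega> + \<eta> t \<omega>) (\<lambda>n s. f n s + g n s)"
proof -
  let ?X = "\<lambda>n. wiener_process M W S T n (f n)" and ?Y = "\<lambda>n. wiener_process M W S T n (g n)"
  let ?Z = "\<lambda>n. wiener_process M W S T n (\<lambda>s. f n s + g n s)"
  have fL: "f n \<in> L2_simplex (Suc n) S T" and gL: "g n \<in> L2_simplex (Suc n) S T" for n
    using \<xi> \<eta> by (auto simp: has_chaos_expansion_iff)
  have hL: "(\<lambda>s. f n s + g n s) \<in> L2_simplex (Suc n) S T" for n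
  proof -
    have m: "f n \<in> borel_measurable (simplex_measure (Suc n) S T)" "g n \<in> borel_measurable
      (simplex_measure (Suc n) S T)"
      using fL gL by (auto simp: L2_simplex_iff)
    show ?thesis unfolding L2_simplex_iff
      using borel_measurable_add[OF m] le_less_trans[OF sqn_add_le[OF m]] fL[of n] gL[of n]
      by (auto simp: L2_simplex_iff ennreal_mult_less_top)
  qed
  have \<xi>L: "\<xi> \<in> L2_adapted M W S T" "\<eta> \<in> L2_adapted M W S T" using \<xi> \<eta> by (auto simp: has_chaos_expansion_iff)
  have "AE x in path_measure S T. (case x of (t, \<omega>) \<Rightarrow> (\<Sum>n<N. ?X n t \<omega>) + (\<Sum>n<N. ?Y n t \<omega>)) = (case x
    of (t, \<omega>) \<Rightarrow> \<Sum>n<N. ?Z n t \<omega>)" for N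
  proof -
    have "AE x in path_measure S T. (case x of (t, \<omega>) \<Rightarrow> ?X n t \<omega> + ?Y n t \<omega> - ?Z n t \<omega>) = 0" for n
    proof -
      have ip: "iter_process n S T (\<lambda>s. f n s + g n s - (f n s + g n s)) (\<lambda>t \<omega>. ?X n t \<omega> + ?Y n t \<omega>
        - ?Z n t \<omega>)"
        by (intro iter_process_diff iter_process_add S wiener_process_iter_process ST fL gL hL)
      have "sqn (path_measure S T) (\<lambda>(t, \<omega>). ?X n t \<omega> + ?Y n t \<omega> - ?Z n t \<omega>) = sqn (simplex_measure
        (Suc n) S T) (\<lambda>s. f n s + g n s - (f n s + g n s))"
        by (rule sqn_iter_process[OF S ip]) simp
      also have "\<dots> = 0" by (simp add: sqn_def)
      finally have z: "sqn (path_measure S T) (\<lambda>(t, \<omega>). ?X n t \<omega> + ?Y n t \<omega> - ?Z n t \<omega>) = 0" .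
      have "(\<lambda>(t, \<omega>). ?X n t \<omega> + ?Y n t \<omega> - ?Z n t \<omega>) \<in> borel_measurable (path_measure S T)"
        by (rule L2_adapted_measurable) (use ip in \<open>simp add: iter_process_def\<close>)
      from z[unfolded sqn_eq_0_iff[OF this]] show ?thesis .
    qed
    then have "AE x in path_measure S T. \<forall>n. (case x of (t, \<omega>) \<Rightarrow> ?X n t \<omega> + ?Y n t \<omega> - ?Z n t \<omega>) = 0"
      by (simp add: AE_all_countable)
    then show ?thesis
      by eventually_elim (auto simp: sum.distrib[symmetric] intro!: sum.cong)
  qed
  note sums_eq = this
  have e: "sqn (path_measure S T) (\<lambda>(t, \<omega>). \<xi> t \<omega> + \<eta> t \<omega> - (\<Sum>n<N. ?Z n t \<omega>))
     = sqn (path_measure S T) (\<lambda>x. (case x of (t, \<omega>) \<Rightarrow> \<xi> t \<omega> - (\<Sum>n<N. ?X n t \<omega>)) + (case x of (t, \<omega>)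
       \<Rightarrow> \<eta> t \<omega> - (\<Sum>n<N. ?Y n t \<omega>)))" for N
  proof (rule sqn_cong_AE)
    show "AE x in path_measure S T. (case x of (t, \<omega>) \<Rightarrow> \<xi> t \<omega> + \<eta> t \<omega> - (\<Sum>n<N. ?Z n t \<omega>)) =
      (case x of (t, \<omega>) \<Rightarrow> \<xi> t \<omega> - (\<Sum>n<N. ?X n t \<omega>)) + (case x of (t, \<omega>) \<Rightarrow> \<eta> t \<omega> - (\<Sum>n<N. ?Y n t \<omega>))"
      using sums_eq[of N] by eventually_elim (auto simp: algebra_simps)
  qed
  have m1: "(\<lambda>(t, \<omega>). \<xi> t \<omega> - (\<Sum>n<N. ?X n t \<omega>)) \<in> borel_measurable (path_measure S T)" for N
    by (rule L2_adapted_measurable[OF L2_adapted_diff[OF \<xi>L(1) chaos_sum_L2_adapted[OF S ST fL]]])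
  have m2: "(\<lambda>(t, \<omega>). \<eta> t \<omega> - (\<Sum>n<N. ?Y n t \<omega>)) \<in> borel_measurable (path_measure S T)" for N
    by (rule L2_adapted_measurable[OF L2_adapted_diff[OF \<xi>L(2) chaos_sum_L2_adapted[OF S ST gL]]])
  have "(\<lambda>N. sqn (path_measure S T) (\<lambda>(t, \<omega>). \<xi> t \<omega> + \<eta> t \<omega> - (\<Sum>n<N. ?Z n t \<omega>))) \<longlonglongrightarrow> 0"
    unfolding e
  proof (rule tendsto_0_le_sum_ennreal)
    show "(\<lambda>N. sqn (path_measure S T) (\<lambda>(t, \<omega>). \<xi> t \<omega> - (\<Sum>n<N. ?X n t \<omega>))) \<longlonglongrightarrow> 0" using \<xi> by (simp
      add: has_chaos_expansion_iff)
    show "(\<lambda>N. sqn (path_measure S T) (\<lambda>(t, \<omega>). \<eta> t \<omega> - (\<Sum>n<N. ?Y n t \<omega>))) \<longlonglongrightarrow> 0" using \<eta> by (simp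
      add: has_chaos_expansion_iff)
  qed (rule sqn_add_le[OF m1 m2])
  then show ?thesis unfolding has_chaos_expansion_iff using hL L2_adapted_add[OF \<xi>L] by blast
qed

text \<open>By orthogonality the squared distance between two partial sums is at most a block of the
  convergent series of the \<open>c n\<close>, so the partial sums are Cauchy.\<close>

lemma chaos_exists:
  fixes f :: "nat \<Rightarrow> (nat \<Rightarrow> real) \<Rightarrow> 'a::euclidean_space"
  assumes S: "0 \<le> S" and ST: "S \<le> T" and f: "\<And>n. f n \<in> borel_measurable (simplex_measure (Suc n) S T)"
    and c: "\<And>n. sqn (simplex_measure (Suc n) S T) (f n) \<le> ennreal (c n)" "summable c" "\<And>n. 0 \<le> c n"
  shows "\<exists>\<xi>. has_chaos_expansion M W S T \<xi> f"
proof -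
  let ?X = "\<lambda>n. wiener_process M W S T n (f n)"
  have fL: "f n \<in> L2_simplex (Suc n) S T" for n
    unfolding L2_simplex_iff using f le_less_trans[OF c(1)[of n]] by simp
  have SL: "(\<lambda>t \<omega>. \<Sum>n<N. ?X n t \<omega>) \<in> L2_adapted M W S T" for N by (rule chaos_sum_L2_adapted[OF S ST fL])
  have bd: "sqn (path_measure S T) (\<lambda>(t, \<omega>). (\<Sum>n<j. ?X n t \<omega>) - (\<Sum>n<i. ?X n t \<omega>)) \<le> ennreal
    (\<Sum>n=i..<j. c n)" if "i \<le> j" for i j
  proof -
    \<comment> \<open>Zeroing the first \<open>i\<close> slots presents a difference of partial sums
      as a chaos sum, to which the isometry applies.\<close>
    let ?f = "\<lambda>n. if n < i then (\<lambda>_. 0) else f n" and ?Z = "\<lambda>n. if n < i then (\<lambda>_ _. 0) else ?X n"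
    have "(\<Sum>n<j. ?X n t \<omega>) - (\<Sum>n<i. ?X n t \<omega>) = (\<Sum>n<j. ?Z n t \<omega>)" for t \<omega>
    proof -
      have "(\<Sum>n<j. ?X n t \<omega>) - (\<Sum>n<i. ?X n t \<omega>) = (\<Sum>n\<in>{..<j} - {..<i}. ?X n t \<omega>)"
        using that by (intro sum_diff[symmetric]) auto
      also have "\<dots> = (\<Sum>n<j. ?Z n t \<omega>)"
        by (rule sum.mono_neutral_cong_left) auto
      finally show ?thesis .
    qed
    then have "sqn (path_measure S T) (\<lambda>(t, \<omega>). (\<Sum>n<j. ?X n t \<omega>) - (\<Sum>n<i. ?X n t \<omega>)) = sqn
      (path_measure S T) (\<lambda>(t, \<omega>). \<Sum>n<j. ?Z n t \<omega>)"
      by simp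
    also have "\<dots> = (\<Sum>n<j. sqn (simplex_measure (Suc n) S T) (?f n))"
      by (rule sqn_sum_iter_process[OF S]) (auto intro: iter_process_zero S
        wiener_process_iter_process ST fL f)
    also have "\<dots> = (\<Sum>n=i..<j. sqn (simplex_measure (Suc n) S T) (f n))"
      by (rule sum.mono_neutral_cong_right) (auto simp: sqn_def)
    also have "\<dots> \<le> (\<Sum>n=i..<j. ennreal (c n))" by (intro sum_mono c)
    also have "\<dots> = ennreal (\<Sum>n=i..<j. c n)" by (rule sum_ennreal) (use c in auto)
    finally show ?thesis .
  qed
  have C: "\<exists>N. \<forall>i\<ge>N. \<forall>j\<ge>N. sqn (path_measure S T) (\<lambda>(t, \<omega>). (\<Sum>n<i. ?X n t \<omega>) - (\<Sum>n<j. ?X n t \<omega>)) <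
    ennreal e" if e: "e > 0" for e :: real
  proof -
    obtain N where N: "\<And>m n. m \<ge> N \<Longrightarrow> norm (\<Sum>k=m..<n. c k) < e"
      using c(2) e unfolding summable_Cauchy by metis
    have le: "sqn (path_measure S T) (\<lambda>(t, \<omega>). (\<Sum>n<j. ?X n t \<omega>) - (\<Sum>n<i. ?X n t \<omega>)) < ennreal e" if
      "N \<le> i" "i \<le> j" for i j
      using bd[OF that(2)] by (rule le_less_trans) (use N[OF that(1), of j] e in \<open>auto intro!: ennreal_lessI\<close>)
    have "sqn (path_measure S T) (\<lambda>(t, \<omega>). (\<Sum>n<i. ?X n t \<omega>) - (\<Sum>n<j. ?X n t \<omega>)) < ennreal e" if "N \<le>
      i" "N \<le> j" for i j
    proof (cases "i \<le> j")
      case True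
      then show ?thesis using le[OF that(1) True]
        sqn_commute[of "path_measure S T" "\<lambda>(t, \<omega>). (\<Sum>n<i. ?X n t \<omega>)" "\<lambda>(t, \<omega>). (\<Sum>n<j. ?X n t \<omega>)"]
        by (simp add: case_prod_unfold)
    next
      case False
      then show ?thesis using le[OF that(2), of i] by simp
    qed
    then show ?thesis by blast
  qed
  obtain \<eta> where \<eta>: "\<eta> \<in> L2_adapted M W S T"
    "(\<lambda>N. sqn (path_measure S T) (\<lambda>(t, \<omega>). (\<Sum>n<N. ?X n t \<omega>) - \<eta> t \<omega>)) \<longlonglongrightarrow> 0"
    by (rule L2_adapted_complete[of "\<lambda>N t \<omega>. \<Sum>n<N. ?X n t \<omega>", OF SL C], assumption, rule that)
  have "sqn (path_measure S T) (\<lambda>(t, \<omega>). (\<Sum>n<N. ?X n t \<omega>) - \<eta> t \<omega>) = sqn (path_measure S T) (\<lambda>(t,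
    \<omega>). \<eta> t \<omega> - (\<Sum>n<N. ?X n t \<omega>))" for N
    using sqn_commute[of "path_measure S T" "\<lambda>(t, \<omega>). (\<Sum>n<N. ?X n t \<omega>)" "\<lambda>(t, \<omega>). \<eta> t \<omega>"] by (simp
      add: case_prod_unfold)
  then show ?thesis using \<eta> fL unfolding has_chaos_expansion_iff by auto
qed

end

section \<open>Convolution of chaos coefficients\<close>

lemma power2_norm_matrix: "(norm (A::real^'n^'m))\<^sup>2 = (\<Sum>i\<in>UNIV. \<Sum>j\<in>UNIV. (A $ i $ j)\<^sup>2)"
  by (simp add: norm_vec_def L2_set_def real_sqrt_pow2 sum_nonneg)

lemma norm_matrix_mult_le: "norm (A ** B) \<le> norm (A::real^'n^'m) * norm (B::real^'p^'n)"
proof (rule power2_le_imp_le)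
  have "(norm (A ** B))\<^sup>2 = (\<Sum>i\<in>UNIV. \<Sum>j\<in>UNIV. (\<Sum>k\<in>UNIV. A $ i $ k * B $ k $ j)\<^sup>2)"
    by (simp add: power2_norm_matrix matrix_matrix_mult_def)
  also have "\<dots> \<le> (\<Sum>i\<in>UNIV. \<Sum>j\<in>UNIV. (\<Sum>k\<in>UNIV. (A $ i $ k)\<^sup>2) * (\<Sum>k\<in>UNIV. (B $ k $ j)\<^sup>2))"
    by (intro sum_mono Cauchy_Schwarz_ineq_sum)
  also have "\<dots> = (\<Sum>i\<in>UNIV. \<Sum>k\<in>UNIV. (A $ i $ k)\<^sup>2) * (\<Sum>j\<in>UNIV. \<Sum>k\<in>UNIV. (B $ k $ j)\<^sup>2)"
    by (simp add: sum_product)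
  also have "(\<Sum>j\<in>UNIV. \<Sum>k\<in>UNIV. (B $ k $ j)\<^sup>2) = (\<Sum>k\<in>UNIV. \<Sum>j\<in>UNIV. (B $ k $ j)\<^sup>2)"
    by (rule sum.swap)
  finally show "(norm (A ** B))\<^sup>2 \<le> (norm A * norm B)\<^sup>2"
    by (simp add: power_mult_distrib power2_norm_matrix)
qed simp

lemma bounded_bilinear_matrix_mult: "bounded_bilinear (\<lambda>(A::real^'n^'m) (B::real^'p^'n). A ** B)"
proof
  show "\<exists>K. \<forall>A B. norm ((A::real^'n^'m) ** (B::real^'p^'n)) \<le> norm A * norm B * K"
    by (intro exI[of _ 1]) (simp add: norm_matrix_mult_le)
qed (simp_all add: vec_eq_iff matrix_matrix_mult_def algebra_simps sum.distrib sum_distrib_left)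

lemma borel_measurable_matrix_mult [measurable (raw)]:
  fixes f :: "'a \<Rightarrow> real^'n^'m" and g :: "'a \<Rightarrow> real^'p^'n"
  assumes "f \<in> borel_measurable M" "g \<in> borel_measurable M"
  shows "(\<lambda>x. f x ** g x) \<in> borel_measurable M"
  by (rule borel_measurable_continuous_Pair[OF assms])
    (intro bounded_bilinear.continuous_on[OF bounded_bilinear_matrix_mult] continuous_intros)

text \<open>A null set in one coordinate is a null cylinder in the cube. It is applied to the shared
  time of a product and to the cutting point \<open>U\<close>.\<close>

lemma AE_cube_component:
  assumes "AE x in lborel. P (x::real)" "i < n"
  shows "AE y in cube_measure n. P (y i)"
proof -
  obtain N where N: "{x. \<not> P x} \<subseteq> N" "N \<in> sets lborel" "emeasure lborel N = 0"
    using assms(1) by (auto elim!: AE_E)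
  let ?A = "\<lambda>j. if j = i then N else UNIV"
  have "emeasure (cube_measure n) (PiE {..<n} ?A) = (\<Prod>j<n. emeasure lborel (?A j))"
    by (rule lborel_prod.emeasure_PiM) (use N in auto)
  also have "\<dots> = 0" using assms(2) N by (intro prod_zero) (auto intro!: bexI[of _ i])
  finally have "PiE {..<n} ?A \<in> null_sets (cube_measure n)"
    using N by (intro null_setsI sets_PiM_I_finite) auto
  then show ?thesis
    by (rule AE_I') (use N assms(2) in \<open>auto simp: space_PiM PiE_iff dest: extensional_arb\<close>)
qed

section \<open>The product of coefficients and its norm estimate\<close>

definition head_pt :: "nat \<Rightarrow> (nat \<Rightarrow> real) \<Rightarrow> nat \<Rightarrow> real" where
  "head_pt m t = (\<lambda>i\<in>{..m}. t i)"

definition tail_pt :: "nat \<Rightarrow> nat \<Rightarrow> (nat \<Rightarrow> real) \<Rightarrow> nat \<Rightarrow> real" where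
  "tail_pt m n t = (\<lambda>i\<in>{..n}. t (m + i))"

lemma tri_prod_eq: "tri_prod m n f g t = f (head_pt m t) ** g (tail_pt m n t)"
  by (simp add: tri_prod_def head_pt_def tail_pt_def)

lemma head_pt_simplex: "t \<in> simplex_pts (Suc (m + n)) S T \<Longrightarrow> head_pt m t \<in> simplex_pts (Suc m) S T"
  by (auto simp: simplex_pts_def head_pt_def)

lemma tail_pt_simplex: "t \<in> simplex_pts (Suc (m + n)) S T \<Longrightarrow> tail_pt m n t \<in> simplex_pts (Suc n) S T"
  by (auto simp: simplex_pts_def tail_pt_def)

lemma head_tail_simplex:
  assumes "t \<in> simplex_pts (Suc (m + n)) S T" "head_pt m t \<in> simplex_pts (Suc m) S' T'" "tail_pt m n
    t \<in> simplex_pts (Suc n) S' T'"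
  shows "t \<in> simplex_pts (Suc (m + n)) S' T'"
proof -
  have "S' < t i \<and> t i < T'" if "i < Suc (m + n)" for i
  proof (cases "i \<le> m")
    case True
    then show ?thesis using assms(2) by (auto simp: simplex_pts_def head_pt_def dest: spec[of _ i])
  next
    case False
    then have "i - m < Suc n" "m + (i - m) = i" using that by auto
    then show ?thesis using assms(3) by (auto simp: simplex_pts_def tail_pt_def dest: spec[of _ "i - m"])
  qed
  then show ?thesis using assms(1) by (simp add: simplex_pts_def)
qed

lemma head_pt_measurable: "head_pt m \<in> simplex_measure (Suc (m + n)) S T \<rightarrow>\<^sub>M simplex_measure (Suc m) S T"
  unfolding simplex_measure_def
proof (rule measurable_restrict_space3)
  show "head_pt m \<in> cube_measure (Suc (m + n)) \<rightarrow>\<^sub>M cube_measure (Suc m)"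
    unfolding head_pt_def[abs_def] lessThan_Suc_atMost by (rule measurable_restrict) auto
qed (auto intro: head_pt_simplex)

lemma tail_pt_measurable: "tail_pt m n \<in> simplex_measure (Suc (m + n)) S T \<rightarrow>\<^sub>M simplex_measure (Suc n) S T"
  unfolding simplex_measure_def
proof (rule measurable_restrict_space3)
  show "tail_pt m n \<in> cube_measure (Suc (m + n)) \<rightarrow>\<^sub>M cube_measure (Suc n)"
    unfolding tail_pt_def[abs_def] lessThan_Suc_atMost by (rule measurable_restrict) auto
qed (auto intro: tail_pt_simplex)

lemma tri_prod_measurable:
  assumes "f \<in> borel_measurable (simplex_measure (Suc m) S T)" "g \<in> borel_measurable
    (simplex_measure (Suc n) S T)"
  shows "tri_prod m n f g \<in> borel_measurable (simplex_measure (Suc (m + n)) S T)"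
  unfolding tri_prod_eq[abs_def]
  by (intro borel_measurable_matrix_mult measurable_compose[OF head_pt_measurable assms(1)]
    measurable_compose[OF tail_pt_measurable assms(2)])

text \<open>The quantity under the essential supremum in the norm of \<open>\<V>\<^sub>n\<^sub>+\<^sub>1\<close>, but with the
  Frobenius norm, which is equivalent to the operator norm and easier to integrate.\<close>

definition slice_sqn :: "real \<Rightarrow> nat \<Rightarrow> ((nat \<Rightarrow> real) \<Rightarrow> 'a::euclidean_space) \<Rightarrow> real \<Rightarrow> ennreal" where
  "slice_sqn T n f t = sqn (simplex_measure n t T) (\<lambda>s. f (snoc_pt n s t))"

lemma slice_sqn_0: "slice_sqn T 0 f t = ennreal ((norm (f (snoc_pt 0 (\<lambda>_. undefined) t)))\<^sup>2)"
  by (simp add: slice_sqn_def sqn_simplex_0)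

lemma append_pt_simplex:
  assumes "append_pt m n x y \<in> simplex_pts (m + n) S T" "x \<in> space (cube_measure m)" "y \<in> space
    (cube_measure n)" "0 < n"
  shows "y \<in> simplex_pts n S T" "x \<in> simplex_pts m (y 0) T"
proof -
  let ?z = "append_pt m n x y"
  have a: "S < ?z i \<and> ?z i < T" if "i < m + n" for i using assms(1) that by (simp add: simplex_pts_def)
  have b: "?z j < ?z i" if "i < j" "j < m + n" for i j using assms(1) that by (simp add: simplex_pts_def)
  have ex: "?z i = x i" if "i < m" for i using that by (simp add: append_pt_def)
  have ey: "?z (m + i) = y i" if "i < n" for i using that by (simp add: append_pt_def)
  show "y \<in> simplex_pts n S T"
    using assms(3) a[of "m + _"] b[of "m + _" "m + _"] by (auto simp: simplex_pts_def space_PiM ey[symmetric])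
  have "x i < T \<and> y 0 < x i" if "i < m" for i
    using a[of i] b[of i "m + 0"] that assms(4) ex[OF that] ey[of 0] by simp
  moreover have "x j < x i" if "i < j" "j < m" for i j
    using b[of i j] that ex[of i] ex[of j] by simp
  ultimately show "x \<in> simplex_pts m (y 0) T"
    using assms(2) by (auto simp: simplex_pts_def space_PiM)
qed

text \<open>Fix the last time \<open>t\<close>. The remaining points split as \<open>x\<close>
  followed by \<open>y\<close>, where \<open>y 0\<close> is the time shared by the factors.
  Integrating over \<open>x\<close> first gives the slice of \<open>f\<close> at its last time
  \<open>y 0\<close>, bounded by \<open>a\<^sup>2\<close> for almost every \<open>y 0\<close>, and
  what remains is the slice of \<open>g\<close> at \<open>t\<close>. For \<open>n = 0\<close> the
  shared time is \<open>t\<close> itself and \<open>g\<close> contributes a constant factor.\<close>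

lemma slice_sqn_tri_prod:
  fixes f g :: "(nat \<Rightarrow> real) \<Rightarrow> real^'d^'d"
  assumes f: "f \<in> borel_measurable (simplex_measure (Suc m) S T)" and g: "g \<in> borel_measurable
    (simplex_measure (Suc n) S T)"
    and fa: "AE t in time_interval S T. slice_sqn T m f t \<le> ennreal (a\<^sup>2)"
    and gb: "AE t in time_interval S T. slice_sqn T n g t \<le> ennreal (b\<^sup>2)"
  shows "AE t in time_interval S T. slice_sqn T (m + n) (tri_prod m n f g) t \<le> ennreal ((a * b)\<^sup>2)"
proof (cases n)
  case 0
  show ?thesis using fa gb AE_space
  proof eventually_elim
    case (elim t)
    then have t: "S < t" "t < T" by auto
    let ?y = "snoc_pt 0 (\<lambda>_. undefined) t"
    have e: "head_pt m (snoc_pt m s t) = snoc_pt m s t" "tail_pt m 0 (snoc_pt m s t) = ?y" for s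
      by (auto simp: head_pt_def tail_pt_def snoc_pt_def fun_eq_iff)
    have gy: "ennreal ((norm (g ?y))\<^sup>2) \<le> ennreal (b\<^sup>2)" using elim 0 by (simp add: slice_sqn_0)
    have "slice_sqn T (m + n) (tri_prod m n f g) t = (\<integral>\<^sup>+ s. ennreal ((norm (f (snoc_pt m s t) ** g
      ?y))\<^sup>2) \<partial>simplex_measure m t T)"
      by (simp add: slice_sqn_def sqn_def tri_prod_eq 0 e)
    also have "\<dots> \<le> (\<integral>\<^sup>+ s. ennreal ((norm (g ?y))\<^sup>2) * ennreal ((norm (f (snoc_pt m s t)))\<^sup>2)
      \<partial>simplex_measure m t T)"
    proof (rule nn_integral_mono)
      fix s
      have "(norm (f (snoc_pt m s t) ** g ?y))\<^sup>2 \<le> (norm (f (snoc_pt m s t)) * norm (g ?y))\<^sup>2"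
        by (intro power_mono norm_matrix_mult_le) simp
      then show "ennreal ((norm (f (snoc_pt m s t) ** g ?y))\<^sup>2) \<le> ennreal ((norm (g ?y))\<^sup>2) *
        ennreal ((norm (f (snoc_pt m s t)))\<^sup>2)"
        by (simp add: ennreal_mult'[symmetric] power_mult_distrib mult.commute ennreal_leI)
    qed
    also have "\<dots> = ennreal ((norm (g ?y))\<^sup>2) * slice_sqn T m f t"
      unfolding slice_sqn_def sqn_def
      by (rule nn_integral_cmult) (use simplex_measurable_snoc[OF f t] in measurable)
    also have "\<dots> \<le> ennreal (b\<^sup>2) * ennreal (a\<^sup>2)" using elim gy by (intro mult_mono) auto
    also have "\<dots> = ennreal ((a * b)\<^sup>2)" by (simp add: ennreal_mult'[symmetric] power_mult_distrib
      mult.commute)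
    finally show ?case .
  qed
next
  case (Suc k)
  then have n0: "0 < n" by simp
  \<comment> \<open>The bound on \<open>f\<close> is needed at the shared time, hence for almost
    every \<open>y\<close> in the cube rather than for almost every real.\<close>
  have fa': "AE y in cube_measure n. S < y 0 \<and> y 0 < T \<longrightarrow> slice_sqn T m f (y 0) \<le> ennreal (a\<^sup>2)"
    by (rule AE_cube_component) (use fa n0 in \<open>auto simp: AE_time_interval\<close>)
  show ?thesis using gb AE_space
  proof eventually_elim
    case (elim t)
    then have t: "S < t" "t < T" by auto
    let ?h = "tri_prod m n f g"
    let ?H = "\<lambda>z. ennreal ((norm (zero_ext (simplex_pts (m + n) t T) (\<lambda>s. ?h (snoc_pt (m + n) s t)) z))\<^sup>2)"
    have hm: "zero_ext (simplex_pts (m + n) t T) (\<lambda>s. ?h (snoc_pt (m + n) s t)) \<in> borel_measurable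
      (cube_measure (m + n))"
      unfolding zero_ext_measurable by (rule simplex_measurable_snoc[OF tri_prod_measurable[OF f g] t])
    have gm: "zero_ext (simplex_pts n t T) (\<lambda>s. g (snoc_pt n s t)) \<in> borel_measurable (cube_measure n)"
      unfolding zero_ext_measurable by (rule simplex_measurable_snoc[OF g t])
    have "slice_sqn T (m + n) ?h t = (\<integral>\<^sup>+ z. ?H z \<partial>cube_measure (m + n))"
      unfolding slice_sqn_def sqn_simplex unfolding sqn_def ..
    also have "\<dots> = (\<integral>\<^sup>+ y. \<integral>\<^sup>+ x. ?H (append_pt m n x y) \<partial>cube_measure m \<partial>cube_measure n)"
      by (rule nn_integral_append_pt) (use hm in measurable)
    also have "\<dots> \<le> (\<integral>\<^sup>+ y. ennreal (a\<^sup>2) * ennreal ((norm (zero_ext (simplex_pts n t T) (\<lambda>s. g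
      (snoc_pt n s t)) y))\<^sup>2) \<partial>cube_measure n)"
    proof (rule nn_integral_mono_AE)
      show "AE y in cube_measure n. (\<integral>\<^sup>+ x. ?H (append_pt m n x y) \<partial>cube_measure m)
         \<le> ennreal (a\<^sup>2) * ennreal ((norm (zero_ext (simplex_pts n t T) (\<lambda>s. g (snoc_pt n s t)) y))\<^sup>2)"
        using fa' AE_space
      proof eventually_elim
        case (elim y)
        let ?gy = "ennreal ((norm (zero_ext (simplex_pts n t T) (\<lambda>s. g (snoc_pt n s t)) y))\<^sup>2)"
        let ?fx = "\<lambda>x. ennreal ((norm (zero_ext (simplex_pts m (y 0) T) (\<lambda>s. f (snoc_pt m s (y 0))) x))\<^sup>2)"
        have bnd: "?H (append_pt m n x y) \<le> ?gy * ?fx x" if x: "x \<in> space (cube_measure m)" for x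
        proof (cases "append_pt m n x y \<in> simplex_pts (m + n) t T")
          case True
          have s: "y \<in> simplex_pts n t T" "x \<in> simplex_pts m (y 0) T" using append_pt_simplex[OF
            True x elim(2) n0] by auto
          have h: "head_pt m (snoc_pt (m + n) (append_pt m n x y) t) = snoc_pt m x (y 0)"
            using n0 by (auto simp: head_pt_def snoc_pt_def append_pt_def fun_eq_iff)
          have tl: "tail_pt m n (snoc_pt (m + n) (append_pt m n x y) t) = snoc_pt n y t"
            by (auto simp: tail_pt_def snoc_pt_def append_pt_def fun_eq_iff)
          have "(norm (f (snoc_pt m x (y 0)) ** g (snoc_pt n y t)))\<^sup>2 \<le> (norm (f (snoc_pt m x (y
            0))) * norm (g (snoc_pt n y t)))\<^sup>2"
            by (intro power_mono norm_matrix_mult_le) simp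
          then show ?thesis using True s
            by (simp add: zero_ext_def tri_prod_eq h tl ennreal_mult'[symmetric] power_mult_distrib
              mult.commute ennreal_leI)
        qed (simp add: zero_ext_def)
        show ?case
        proof (cases "y \<in> simplex_pts n t T")
          case True
          then have y0: "S < y 0" "y 0 < T" using t n0 by (auto simp: simplex_pts_def)
          have "(\<integral>\<^sup>+ x. ?H (append_pt m n x y) \<partial>cube_measure m) \<le> (\<integral>\<^sup>+ x. ?gy * ?fx x \<partial>cube_measure m)"
            by (rule nn_integral_mono) (rule bnd)
          also have "\<dots> = ?gy * slice_sqn T m f (y 0)"
            unfolding slice_sqn_def sqn_simplex unfolding sqn_def
          proof (rule nn_integral_cmult)
            have "zero_ext (simplex_pts m (y 0) T) (\<lambda>s. f (snoc_pt m s (y 0))) \<in> borel_measurable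
              (cube_measure m)"
              unfolding zero_ext_measurable by (rule simplex_measurable_snoc[OF f y0])
            then show "?fx \<in> borel_measurable (cube_measure m)" by measurable
          qed
          also have "\<dots> \<le> ?gy * ennreal (a\<^sup>2)" using elim y0 by (intro mult_left_mono) auto
          finally show ?thesis by (simp add: mult.commute)
        next
          case False
          then have "?gy = 0" by (simp add: zero_ext_def)
          then have "(\<integral>\<^sup>+ x. ?H (append_pt m n x y) \<partial>cube_measure m) \<le> (\<integral>\<^sup>+ x. 0 \<partial>cube_measure m)"
            by (intro nn_integral_mono) (use bnd in fastforce)
          then show ?thesis by simp
        qed
      qed
    qed
    also have "\<dots> = ennreal (a\<^sup>2) * slice_sqn T n g t"
      unfolding slice_sqn_def sqn_simplex unfolding sqn_def
      by (rule nn_integral_cmult) (use gm in measurable)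
    also have "\<dots> \<le> ennreal (a\<^sup>2) * ennreal (b\<^sup>2)" using elim by (intro mult_left_mono) auto
    also have "\<dots> = ennreal ((a * b)\<^sup>2)" by (simp add: ennreal_mult'[symmetric] power_mult_distrib)
    finally show ?case .
  qed
qed

lemma sqn_sum_Minkowski:
  fixes f :: "'i \<Rightarrow> 'x \<Rightarrow> 'b::euclidean_space"
  assumes "finite I" "\<And>i. i \<in> I \<Longrightarrow> f i \<in> borel_measurable M" "\<And>i. i \<in> I \<Longrightarrow> sqn M (f i) \<le> ennreal ((c i)\<^sup>2)"
    "\<And>i. i \<in> I \<Longrightarrow> 0 \<le> c i"
  shows "sqn M (\<lambda>x. \<Sum>i\<in>I. f i x) \<le> ennreal ((\<Sum>i\<in>I. c i)\<^sup>2)"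
  using assms
proof (induction I)
  case empty
  then show ?case by (simp add: sqn_def)
next
  case (insert i I)
  have "sqn M (\<lambda>x. f i x + (\<Sum>i\<in>I. f i x)) \<le> ennreal ((c i + (\<Sum>i\<in>I. c i))\<^sup>2)"
    by (rule sqn_Minkowski) (use insert in \<open>auto intro: sum_nonneg\<close>)
  then show ?case using insert by simp
qed

text \<open>The condition on the coefficients of a star kernel, with a summable majorant of the
  slices in place of a sum of essential suprema. \<open>volterra_coeffs_iff\<close> shows the
  equivalence with the norms of the statement.\<close>

definition volterra_coeffs :: "real \<Rightarrow> real \<Rightarrow> (nat \<Rightarrow> (nat \<Rightarrow> real) \<Rightarrow> real^'d^'d) \<Rightarrow> bool" where
  "volterra_coeffs S T f \<longleftrightarrow> (\<forall>n. f n \<in> borel_measurable (simplex_measure (Suc n) S T)) \<and>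
     (\<exists>c. (\<forall>n. 0 < c n) \<and> summable c \<and> (\<forall>n. AE t in time_interval S T. slice_sqn T n (f n) t \<le>
       ennreal ((c n)\<^sup>2)))"

text \<open>The coefficients of the star product, as a product on coefficient families; all the
  algebra takes place here.\<close>

definition coeff_conv :: "(nat \<Rightarrow> (nat \<Rightarrow> real) \<Rightarrow> real^'d^'d) \<Rightarrow> (nat \<Rightarrow> (nat \<Rightarrow> real) \<Rightarrow> real^'d^'d) \<Rightarrow>
  nat \<Rightarrow> (nat \<Rightarrow> real) \<Rightarrow> real^'d^'d" where
  "coeff_conv f g n t = (\<Sum>k\<le>n. tri_prod (n - k) k (f (n - k)) (g k) t)"

lemma volterra_coeffs_measurable:
  "volterra_coeffs S T f \<Longrightarrow> f n \<in> borel_measurable (simplex_measure (Suc n) S T)"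
  by (simp add: volterra_coeffs_def)

lemma coeff_conv_measurable:
  assumes "\<And>n. f n \<in> borel_measurable (simplex_measure (Suc n) S T)" "\<And>n. g n \<in> borel_measurable
    (simplex_measure (Suc n) S T)"
  shows "coeff_conv f g n \<in> borel_measurable (simplex_measure (Suc n) S T)"
  unfolding coeff_conv_def[abs_def]
proof (rule borel_measurable_sum)
  fix k assume "k \<in> {..n}"
  then show "tri_prod (n - k) k (f (n - k)) (g k) \<in> borel_measurable (simplex_measure (Suc n) S T)"
    using tri_prod_measurable[OF assms(1)[of "n - k"] assms(2)[of k]] by simp
qed

text \<open>The majorant of the product is the Cauchy product of the majorants, which is summable.
  Minkowski's inequality adds the terms of one order within each slice.\<close>

lemma volterra_coeffs_conv:
  assumes f: "volterra_coeffs S T f" and g: "volterra_coeffs S T g"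
  shows "volterra_coeffs S T (coeff_conv f g)"
proof -
  obtain a where a: "\<And>n. 0 < a n" "summable a" "\<And>n. AE t in time_interval S T. slice_sqn T n (f n) t
    \<le> ennreal ((a n)\<^sup>2)"
    using f by (auto simp: volterra_coeffs_def)
  obtain b where b: "\<And>n. 0 < b n" "summable b" "\<And>n. AE t in time_interval S T. slice_sqn T n (g n) t
    \<le> ennreal ((b n)\<^sup>2)"
    using g by (auto simp: volterra_coeffs_def)
  note fm = volterra_coeffs_measurable[OF f] and gm = volterra_coeffs_measurable[OF g]
  let ?c = "\<lambda>n. \<Sum>k\<le>n. a (n - k) * b k"
  have "AE t in time_interval S T. slice_sqn T n (coeff_conv f g n) t \<le> ennreal ((?c n)\<^sup>2)" for n
  proof -
    have "AE t in time_interval S T. \<forall>k\<in>{..n}. slice_sqn T n (tri_prod (n - k) k (f (n - k)) (g k))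
      t \<le> ennreal ((a (n - k) * b k)\<^sup>2)"
    proof (rule AE_ball_countable[THEN iffD2])
      show "\<forall>k\<in>{..n}. AE t in time_interval S T. slice_sqn T n (tri_prod (n - k) k (f (n - k)) (g
        k)) t \<le> ennreal ((a (n - k) * b k)\<^sup>2)"
      proof
        fix k assume "k \<in> {..n}"
        then show "AE t in time_interval S T. slice_sqn T n (tri_prod (n - k) k (f (n - k)) (g k)) t
          \<le> ennreal ((a (n - k) * b k)\<^sup>2)"
          using slice_sqn_tri_prod[OF fm gm a(3)[of "n - k"] b(3)[of k]] by simp
      qed
    qed simp
    then show ?thesis using AE_space
    proof eventually_elim
      case (elim t)
      then have t: "S < t" "t < T" by auto
      have "sqn (simplex_measure n t T) (\<lambda>s. \<Sum>k\<in>{..n}. tri_prod (n - k) k (f (n - k)) (g k) (snoc_pt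
        n s t)) \<le> ennreal ((?c n)\<^sup>2)"
      proof (rule sqn_sum_Minkowski)
        fix k assume k: "k \<in> {..n}"
        have "tri_prod (n - k) k (f (n - k)) (g k) \<in> borel_measurable (simplex_measure (Suc n) S T)"
          using tri_prod_measurable[OF fm[of "n - k"] gm[of k]] k by simp
        from simplex_measurable_snoc[OF this t]
        show "(\<lambda>s. tri_prod (n - k) k (f (n - k)) (g k) (snoc_pt n s t)) \<in> borel_measurable
          (simplex_measure n t T)" .
        show "sqn (simplex_measure n t T) (\<lambda>s. tri_prod (n - k) k (f (n - k)) (g k) (snoc_pt n s t))
          \<le> ennreal ((a (n - k) * b k)\<^sup>2)"
          using elim(1) k by (auto simp: slice_sqn_def)
        show "0 \<le> a (n - k) * b k" using a(1) b(1) by (simp add: less_imp_le)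
      qed simp
      then show ?case by (simp add: slice_sqn_def coeff_conv_def)
    qed
  qed
  moreover have "summable (\<lambda>n. \<Sum>k\<le>n. b k * a (n - k))"
    using a b by (intro summable_Cauchy_product) (auto simp: less_imp_le)
  then have "summable ?c" by (simp add: mult.commute)
  moreover have "0 < ?c n" for n using a(1) b(1) by (intro sum_pos) auto
  ultimately show ?thesis unfolding volterra_coeffs_def using coeff_conv_measurable[OF fm gm]
    by (intro conjI allI exI[of _ ?c])
qed

lemma volterra_coeffs_add:
  assumes f: "volterra_coeffs S T f" and g: "volterra_coeffs S T g"
  shows "volterra_coeffs S T (\<lambda>n t. f n t + g n t)"
proof -
  obtain a where a: "\<And>n. 0 < a n" "summable a" "\<And>n. AE t in time_interval S T. slice_sqn T n (f n) t
    \<le> ennreal ((a n)\<^sup>2)"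
    using f by (auto simp: volterra_coeffs_def)
  obtain b where b: "\<And>n. 0 < b n" "summable b" "\<And>n. AE t in time_interval S T. slice_sqn T n (g n) t
    \<le> ennreal ((b n)\<^sup>2)"
    using g by (auto simp: volterra_coeffs_def)
  note fm = volterra_coeffs_measurable[OF f] and gm = volterra_coeffs_measurable[OF g]
  have "AE t in time_interval S T. slice_sqn T n (\<lambda>t. f n t + g n t) t \<le> ennreal ((a n + b n)\<^sup>2)" for n
    using a(3)[of n] b(3)[of n] AE_space
  proof eventually_elim
    case (elim t)
    then have t: "S < t" "t < T" by auto
    show ?case unfolding slice_sqn_def
      using elim by (intro sqn_Minkowski simplex_measurable_snoc[OF fm t] simplex_measurable_snoc[OF
        gm t] less_imp_le[OF a(1)] less_imp_le[OF b(1)])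
        (auto simp: slice_sqn_def)
  qed
  then show ?thesis unfolding volterra_coeffs_def
    using summable_add[OF a(2) b(2)] a(1) b(1) borel_measurable_add[OF fm gm]
    by (intro conjI allI exI[of _ "\<lambda>n. a n + b n"]) (auto intro: add_pos_pos)
qed

lemma volterra_coeffs_dominated:
  assumes f: "volterra_coeffs S T f" and g: "\<And>n. g n \<in> borel_measurable (simplex_measure (Suc n) S T)"
    and le: "\<And>n t. t \<in> simplex_pts (Suc n) S T \<Longrightarrow> norm (g n t) \<le> norm (f n t)"
  shows "volterra_coeffs S T g"
proof -
  obtain a where a: "\<And>n. 0 < a n" "summable a" "\<And>n. AE t in time_interval S T. slice_sqn T n (f n) t
    \<le> ennreal ((a n)\<^sup>2)"
    using f by (auto simp: volterra_coeffs_def)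
  have "AE t in time_interval S T. slice_sqn T n (g n) t \<le> ennreal ((a n)\<^sup>2)" for n
    using a(3)[of n] AE_space
  proof eventually_elim
    case (elim t)
    then have t: "S < t" "t < T" by auto
    have "slice_sqn T n (g n) t \<le> slice_sqn T n (f n) t"
      unfolding slice_sqn_def sqn_def
    proof (rule nn_integral_mono)
      fix s assume "s \<in> space (simplex_measure n t T)"
      then have s: "s \<in> simplex_pts n t T" by simp
      then have "s \<in> space (cube_measure n)" using sets.sets_into_space[OF simplex_pts_sets] by blast
      then have "snoc_pt n s t \<in> simplex_pts (Suc n) S T" using s t by (simp add: snoc_pt_in_simplex_iff)
      then show "ennreal ((norm (g n (snoc_pt n s t)))\<^sup>2) \<le> ennreal ((norm (f n (snoc_pt n s t)))\<^sup>2)"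
        by (intro ennreal_leI power_mono le) auto
    qed
    with elim show ?case by simp
  qed
  then show ?thesis unfolding volterra_coeffs_def using a(1,2) g by blast
qed

lemma slice_sqn_integral:
  assumes "f \<in> borel_measurable (simplex_measure (Suc n) S T)"
  shows "sqn (simplex_measure (Suc n) S T) f = (\<integral>\<^sup>+ t. slice_sqn T n f t \<partial>time_interval S T)"
  unfolding slice_sqn_def by (rule sqn_simplex_snoc[OF assms])

lemma slice_sqn_measurable:
  assumes "f \<in> borel_measurable (simplex_measure (Suc n) S T)"
  shows "slice_sqn T n f \<in> borel_measurable (time_interval S T)"
  unfolding slice_sqn_def[abs_def] by (rule measurable_sqn_snoc[OF assms])

text \<open>The squared norm is the integral of the slices. So vanishing almost everywhere is a
  slice bound with constant 0, and norm estimates can be used to prove almost everywhere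
  equalities.\<close>

lemma AE_eq_0_iff_slice:
  assumes f: "f \<in> borel_measurable (simplex_measure (Suc n) S T)"
  shows "(AE t in simplex_measure (Suc n) S T. f t = 0) \<longleftrightarrow> (AE t in time_interval S T. slice_sqn T n f t = 0)"
  unfolding sqn_eq_0_iff[OF f, symmetric] slice_sqn_integral[OF f]
  by (rule nn_integral_0_iff_AE[OF slice_sqn_measurable[OF f]])

lemma volterra_coeffs_cong:
  assumes f: "volterra_coeffs S T f" and g: "\<And>n. g n \<in> borel_measurable (simplex_measure (Suc n) S T)"
    and eq: "coeff_eq S T f g"
  shows "volterra_coeffs S T g"
proof -
  obtain a where a: "\<And>n. 0 < a n" "summable a" "\<And>n. AE t in time_interval S T. slice_sqn T n (f n) t
    \<le> ennreal ((a n)\<^sup>2)"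
    using f by (auto simp: volterra_coeffs_def)
  note fm = volterra_coeffs_measurable[OF f]
  have "AE t in time_interval S T. slice_sqn T n (g n) t \<le> ennreal ((a n)\<^sup>2)" for n
  proof -
    have "AE t in simplex_measure (Suc n) S T. f n t - g n t = 0" using eq by (auto simp: coeff_eq_def)
    then have "AE t in time_interval S T. slice_sqn T n (\<lambda>t. f n t - g n t) t = 0"
      using AE_eq_0_iff_slice[OF borel_measurable_diff[OF fm g]] by blast
    then show ?thesis using a(3)[of n] AE_space
    proof eventually_elim
      case (elim t)
      then have t: "S < t" "t < T" by auto
      note m = simplex_measurable_snoc[OF fm t] simplex_measurable_snoc[OF g t]
      have "AE s in simplex_measure n t T. f n (snoc_pt n s t) - g n (snoc_pt n s t) = 0"
        using elim(1) unfolding slice_sqn_def sqn_eq_0_iff[OF borel_measurable_diff[OF m]] .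
      then have "slice_sqn T n (g n) t = slice_sqn T n (f n) t"
        unfolding slice_sqn_def by (intro sqn_cong_AE) (auto elim: eventually_mono)
      with elim show ?case by simp
    qed
  qed
  then show ?thesis unfolding volterra_coeffs_def using a(1,2) g by blast
qed

section \<open>Algebra of coefficient families up to null sets\<close>

lemma coeff_eq_refl: "coeff_eq S T f f"
  by (simp add: coeff_eq_def)

lemma coeff_eq_sym:
  assumes "coeff_eq S T f g" shows "coeff_eq S T g f"
  unfolding coeff_eq_def
proof
  fix n
  have "AE t in simplex_measure (Suc n) S T. f n t = g n t" using assms by (simp add: coeff_eq_def)
  then show "AE t in simplex_measure (Suc n) S T. g n t = f n t" by eventually_elim simp
qed

lemma coeff_eq_trans:
  assumes "coeff_eq S T f g" "coeff_eq S T g h" shows "coeff_eq S T f h"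
  unfolding coeff_eq_def
proof
  fix n
  have "AE t in simplex_measure (Suc n) S T. f n t = g n t" "AE t in simplex_measure (Suc n) S T. g
    n t = h n t"
    using assms by (simp_all add: coeff_eq_def)
  then show "AE t in simplex_measure (Suc n) S T. f n t = h n t" by eventually_elim simp
qed

lemma coeff_eq_add:
  "coeff_eq S T f f' \<Longrightarrow> coeff_eq S T g g' \<Longrightarrow> coeff_eq S T (\<lambda>n t. f n t + g n t) (\<lambda>n t. f' n t + g' n t)"
  unfolding coeff_eq_def
proof
  fix n assume "\<forall>n. AE t in simplex_measure (Suc n) S T. f n t = f' n t" "\<forall>n. AE t in
    simplex_measure (Suc n) S T. g n t = g' n t"
  then have "AE t in simplex_measure (Suc n) S T. f n t = f' n t" "AE t in simplex_measure (Suc n) S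
    T. g n t = g' n t" by auto
  then show "AE t in simplex_measure (Suc n) S T. f n t + g n t = f' n t + g' n t" by eventually_elim simp
qed

text \<open>The norm estimate with a vanishing product of constants. It does the work of tracing
  null sets through the head and tail maps.\<close>

lemma tri_prod_AE_0:
  assumes f: "f \<in> borel_measurable (simplex_measure (Suc m) S T)" and g: "g \<in> borel_measurable
    (simplex_measure (Suc n) S T)"
    and fa: "AE t in time_interval S T. slice_sqn T m f t \<le> ennreal (a\<^sup>2)"
    and gb: "AE t in time_interval S T. slice_sqn T n g t \<le> ennreal (b\<^sup>2)" and "a * b = 0"
  shows "AE t in simplex_measure (Suc (m + n)) S T. tri_prod m n f g t = 0"
  unfolding AE_eq_0_iff_slice[OF tri_prod_measurable[OF f g]]
  using slice_sqn_tri_prod[OF f g fa gb] by (auto simp: assms(5) elim: eventually_mono)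

lemma coeff_conv_add_left: "coeff_conv (\<lambda>n t. f n t + g n t) h n t = coeff_conv f h n t + coeff_conv g h n t"
  by (simp add: coeff_conv_def tri_prod_eq bounded_bilinear.add_left[OF
    bounded_bilinear_matrix_mult] sum.distrib)

lemma coeff_conv_add_right: "coeff_conv f (\<lambda>n t. g n t + h n t) n t = coeff_conv f g n t + coeff_conv f h n t"
  by (simp add: coeff_conv_def tri_prod_eq bounded_bilinear.add_right[OF
    bounded_bilinear_matrix_mult] sum.distrib)

lemma coeff_conv_diff_left: "coeff_conv (\<lambda>n t. f n t - g n t) h n t = coeff_conv f h n t - coeff_conv g h n t"
  by (simp add: coeff_conv_def tri_prod_eq bounded_bilinear.diff_left[OF
    bounded_bilinear_matrix_mult] sum_subtractf)

lemma coeff_conv_diff_right: "coeff_conv f (\<lambda>n t. g n t - h n t) n t = coeff_conv f g n t -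
  coeff_conv f h n t"
  by (simp add: coeff_conv_def tri_prod_eq bounded_bilinear.diff_right[OF
    bounded_bilinear_matrix_mult] sum_subtractf)

lemma coeff_conv_AE_0:
  assumes f: "\<And>n. f n \<in> borel_measurable (simplex_measure (Suc n) S T)" and g: "\<And>n. g n \<in>
    borel_measurable (simplex_measure (Suc n) S T)"
    and a: "\<And>n. AE t in time_interval S T. slice_sqn T n (f n) t \<le> ennreal ((a n)\<^sup>2)"
    and b: "\<And>n. AE t in time_interval S T. slice_sqn T n (g n) t \<le> ennreal ((b n)\<^sup>2)"
    and 0: "\<And>m n. a m * b n = 0"
  shows "coeff_eq S T (coeff_conv f g) (\<lambda>n t. 0)"
  unfolding coeff_eq_def
proof
  fix n
  have "AE t in simplex_measure (Suc n) S T. \<forall>k\<in>{..n}. tri_prod (n - k) k (f (n - k)) (g k) t = 0"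
  proof (rule AE_ball_countable[THEN iffD2], simp, rule ballI)
    fix k assume "k \<in> {..n}"
    then have e: "n - k + k = n" by simp
    have "AE t in simplex_measure (Suc (n - k + k)) S T. tri_prod (n - k) k (f (n - k)) (g k) t = 0"
      by (rule tri_prod_AE_0[OF f g a b 0])
    then show "AE t in simplex_measure (Suc n) S T. tri_prod (n - k) k (f (n - k)) (g k) t = 0"
      unfolding e .
  qed
  then show "AE t in simplex_measure (Suc n) S T. coeff_conv f g n t = 0"
    by eventually_elim (auto simp: coeff_conv_def)
qed

text \<open>The convolution is well defined on classes. Write the difference as
  \<open>(f - f') g + f' (g - g')\<close>; in each summand one factor has majorant 0, and the
  estimate makes the product vanish almost everywhere.\<close>

lemma coeff_eq_conv:
  assumes f: "volterra_coeffs S T f" "volterra_coeffs S T f'" "coeff_eq S T f f'"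
    and g: "volterra_coeffs S T g" "volterra_coeffs S T g'" "coeff_eq S T g g'"
  shows "coeff_eq S T (coeff_conv f g) (coeff_conv f' g')"
proof -
  note m = volterra_coeffs_measurable
  have z: "AE t in time_interval S T. slice_sqn T n (\<lambda>t. h n t - h' n t) t \<le> ennreal (0\<^sup>2)"
    if h: "volterra_coeffs S T h" "volterra_coeffs S T h'" "coeff_eq S T h h'" for n and h h' ::
      "nat \<Rightarrow> (nat \<Rightarrow> real) \<Rightarrow> real^'a^'a"
    using h(3) AE_eq_0_iff_slice[OF borel_measurable_diff[OF m[OF h(1)] m[OF h(2)]], of n]
    by (auto simp: coeff_eq_def elim: eventually_mono)
  obtain b where b: "\<And>n. AE t in time_interval S T. slice_sqn T n (g n) t \<le> ennreal ((b n)\<^sup>2)"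
    using g(1) by (auto simp: volterra_coeffs_def)
  obtain a where a: "\<And>n. AE t in time_interval S T. slice_sqn T n (f' n) t \<le> ennreal ((a n)\<^sup>2)"
    using f(2) by (auto simp: volterra_coeffs_def)
  have "coeff_eq S T (coeff_conv (\<lambda>n t. f n t - f' n t) g) (\<lambda>n t. 0)"
    by (rule coeff_conv_AE_0[OF borel_measurable_diff[OF m[OF f(1)] m[OF f(2)]] m[OF g(1)] z[OF f] b]) simp
  moreover have "coeff_eq S T (coeff_conv f' (\<lambda>n t. g n t - g' n t)) (\<lambda>n t. 0)"
    by (rule coeff_conv_AE_0[OF m[OF f(2)] borel_measurable_diff[OF m[OF g(1)] m[OF g(2)]] a z[OF g]]) simp
  ultimately show ?thesis unfolding coeff_eq_def coeff_conv_diff_left coeff_conv_diff_right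
  proof (intro allI)
    fix n
    assume h: "\<forall>n. AE t in simplex_measure (Suc n) S T. coeff_conv f g n t - coeff_conv f' g n t = 0"
      "\<forall>n. AE t in simplex_measure (Suc n) S T. coeff_conv f' g n t - coeff_conv f' g' n t = 0"
    show "AE t in simplex_measure (Suc n) S T. coeff_conv f g n t = coeff_conv f' g' n t"
      using spec[OF h(1), of n] spec[OF h(2), of n] by eventually_elim simp
  qed
qed

text \<open>Both sides sum the same triple products \<open>G\<close> over all ways to cut the point
  into three consecutive blocks that share end points. The rearrangement is the one for a triple
  product of power series, and the identity holds at every point.\<close>

lemma coeff_conv_assoc: "coeff_conv (coeff_conv f g) h n t = coeff_conv f (coeff_conv g h) n t"
proof -
  define G where "G = (\<lambda>a b c. f c (\<lambda>i\<in>{..c}. t i) ** g b (\<lambda>i\<in>{..b}. t (c + i)) ** h a (\<lambda>i\<in>{..a}. t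
    (c + b + i)))"
  have "coeff_conv (coeff_conv f g) h n t = (\<Sum>k\<le>n. \<Sum>j\<le>n - k. G k j (n - k - j))"
    unfolding coeff_conv_def
  proof (rule sum.cong[OF refl])
    fix k assume k: "k \<in> {..n}"
    have "f (n - k - j) (head_pt (n - k - j) (head_pt (n - k) t)) ** g j (tail_pt (n - k - j) j
      (head_pt (n - k) t)) ** h k (tail_pt (n - k) k t)
      = G k j (n - k - j)" if j: "j \<in> {..n - k}" for j
    proof -
      have "head_pt (n - k - j) (head_pt (n - k) t) = (\<lambda>i\<in>{..n - k - j}. t i)"
        using j by (auto simp: head_pt_def fun_eq_iff)
      moreover have "tail_pt (n - k - j) j (head_pt (n - k) t) = (\<lambda>i\<in>{..j}. t (n - k - j + i))"
        using j by (auto simp: head_pt_def tail_pt_def fun_eq_iff)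
      moreover have "tail_pt (n - k) k t = (\<lambda>i\<in>{..k}. t (n - k - j + j + i))"
        using le_add_diff_inverse2[of j "n - k"] j by (simp add: tail_pt_def del: diff_diff_left)
      ultimately show ?thesis unfolding G_def by simp
    qed
    then show "tri_prod (n - k) k (\<lambda>t. \<Sum>ka\<le>n - k. tri_prod (n - k - ka) ka (f (n - k - ka)) (g ka)
      t) (h k) t = (\<Sum>j\<le>n - k. G k j (n - k - j))"
      unfolding tri_prod_eq bounded_bilinear.sum_left[OF bounded_bilinear_matrix_mult] by (intro
        sum.cong) auto
  qed
  also have "\<dots> = (\<Sum>k\<le>n. \<Sum>j\<le>k. G j (k - j) (n - k))"
    using fps_mult_assoc_lemma[of G n] by (simp add: atLeast0AtMost)
  also have "\<dots> = coeff_conv f (coeff_conv g h) n t"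
    unfolding coeff_conv_def
  proof (rule sum.cong[OF refl])
    fix k assume k: "k \<in> {..n}"
    have "f (n - k) (head_pt (n - k) t) ** (g (k - j) (head_pt (k - j) (tail_pt (n - k) k t)) ** h j
      (tail_pt (k - j) j (tail_pt (n - k) k t)))
      = G j (k - j) (n - k)" if j: "j \<in> {..k}" for j
    proof -
      have "head_pt (k - j) (tail_pt (n - k) k t) = (\<lambda>i\<in>{..k - j}. t (n - k + i))"
        using j by (auto simp: head_pt_def tail_pt_def fun_eq_iff)
      moreover have "tail_pt (k - j) j (tail_pt (n - k) k t) = (\<lambda>i\<in>{..j}. t (n - k + (k - j) + i))"
        using j by (auto simp: tail_pt_def fun_eq_iff add.assoc)
      ultimately show ?thesis unfolding G_def by (simp add: head_pt_def matrix_mul_assoc)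
    qed
    then show "(\<Sum>j\<le>k. G j (k - j) (n - k)) = tri_prod (n - k) k (f (n - k)) (\<lambda>t. \<Sum>ka\<le>k. tri_prod (k
      - ka) ka (g (k - ka)) (h ka) t) t"
      unfolding tri_prod_eq bounded_bilinear.sum_right[OF bounded_bilinear_matrix_mult] by (intro
        sum.cong) auto
  qed
  finally show ?thesis .
qed

section \<open>Restriction to a subinterval and extension by zero\<close>

lemma simplex_pts_mono: "S \<le> S' \<Longrightarrow> T' \<le> T \<Longrightarrow> simplex_pts n S' T' \<subseteq> simplex_pts n S T"
  by (force simp: simplex_pts_def)

lemma simplex_measurable_zero_ext:
  fixes f :: "(nat \<Rightarrow> real) \<Rightarrow> 'b::euclidean_space"
  assumes "f \<in> borel_measurable (simplex_measure n S' T')"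
  shows "zero_ext (simplex_pts n S' T') f \<in> borel_measurable (simplex_measure n S T)"
  unfolding simplex_measure_def[of n S T] by (rule measurable_restrict_space1) (use assms in \<open>simp
    add: zero_ext_measurable\<close>)

lemma simplex_measurable_mono:
  fixes f :: "(nat \<Rightarrow> real) \<Rightarrow> 'b::euclidean_space"
  assumes "f \<in> borel_measurable (simplex_measure n S T)" "S \<le> S'" "T' \<le> T"
  shows "f \<in> borel_measurable (simplex_measure n S' T')"
proof -
  have "zero_ext (simplex_pts n S T) f \<in> borel_measurable (simplex_measure n S' T')"
    by (rule simplex_measurable_zero_ext[OF assms(1)])
  then show ?thesis
    using simplex_pts_mono[OF assms(2,3), of n] by (subst measurable_cong[of _ _ "zero_ext
      (simplex_pts n S T) f"]) (auto simp: zero_ext_def)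
qed

lemma sqn_simplex_mono:
  assumes "T' \<le> T" shows "sqn (simplex_measure n t T') f \<le> sqn (simplex_measure n t T) f"
  unfolding sqn_simplex unfolding sqn_def
  by (intro nn_integral_mono ennreal_leI power_mono) (use simplex_pts_mono[OF order_refl assms] in
    \<open>auto simp: zero_ext_def\<close>)

lemma volterra_coeffs_mono:
  assumes f: "volterra_coeffs S T f" and "S \<le> S'" "T' \<le> T"
  shows "volterra_coeffs S' T' f"
proof -
  obtain a where a: "\<And>n. 0 < a n" "summable a" "\<And>n. AE t in time_interval S T. slice_sqn T n (f n) t
    \<le> ennreal ((a n)\<^sup>2)"
    using f by (auto simp: volterra_coeffs_def)
  have "AE t in time_interval S' T'. slice_sqn T' n (f n) t \<le> ennreal ((a n)\<^sup>2)" for n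
    using a(3)[of n] assms(2,3) sqn_simplex_mono[OF assms(3)] unfolding AE_time_interval slice_sqn_def
    by (auto elim!: eventually_mono intro: order_trans)
  then show ?thesis unfolding volterra_coeffs_def
    using a(1,2) simplex_measurable_mono[OF volterra_coeffs_measurable[OF f] assms(2,3)] by blast
qed

definition coeff_ext :: "real \<Rightarrow> real \<Rightarrow> (nat \<Rightarrow> (nat \<Rightarrow> real) \<Rightarrow> 'b::zero) \<Rightarrow> nat \<Rightarrow> (nat \<Rightarrow> real) \<Rightarrow> 'b" where
  "coeff_ext S T f n = zero_ext (simplex_pts (Suc n) S T) (f n)"

text \<open>A slice of the extension at \<open>t\<close> is the original slice when \<open>t\<close>
  lies in the small interval and zero otherwise, so the same majorant serves.\<close>

lemma volterra_coeffs_ext: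
  assumes f: "volterra_coeffs S' T' f" and "S \<le> S'" "T' \<le> T"
  shows "volterra_coeffs S T (coeff_ext S' T' f)"
proof -
  obtain a where a: "\<And>n. 0 < a n" "summable a" "\<And>n. AE t in time_interval S' T'. slice_sqn T' n (f
    n) t \<le> ennreal ((a n)\<^sup>2)"
    using f by (auto simp: volterra_coeffs_def)
  have "slice_sqn T n (coeff_ext S' T' f n) t = (if S' < t \<and> t < T' then slice_sqn T' n (f n) t else
    0)" for n t
    unfolding slice_sqn_def sqn_simplex unfolding sqn_def
  proof -
    have e: "zero_ext (simplex_pts n t T) (\<lambda>s. coeff_ext S' T' f n (snoc_pt n s t)) s =
      (if S' < t \<and> t < T' then zero_ext (simplex_pts n t T') (\<lambda>s. f n (snoc_pt n s t)) s else 0)"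
      if "s \<in> space (cube_measure n)" for s
      using that simplex_pts_mono[OF order_refl[of t] assms(3), of n]
      by (auto simp: zero_ext_def coeff_ext_def snoc_pt_in_simplex_iff)
    have "(\<integral>\<^sup>+ s. ennreal ((norm (zero_ext (simplex_pts n t T) (\<lambda>s. coeff_ext S' T' f n (snoc_pt n s
      t)) s))\<^sup>2) \<partial>cube_measure n)
      = (\<integral>\<^sup>+ s. ennreal ((norm (if S' < t \<and> t < T' then zero_ext (simplex_pts n t T') (\<lambda>s. f n
        (snoc_pt n s t)) s else 0))\<^sup>2) \<partial>cube_measure n)"
      by (rule nn_integral_cong) (simp only: e)
    then show "(\<integral>\<^sup>+ s. ennreal ((norm (zero_ext (simplex_pts n t T) (\<lambda>s. coeff_ext S' T' f n
      (snoc_pt n s t)) s))\<^sup>2) \<partial>cube_measure n)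
      = (if S' < t \<and> t < T' then \<integral>\<^sup>+ s. ennreal ((norm (zero_ext (simplex_pts n t T') (\<lambda>s. f n
        (snoc_pt n s t)) s))\<^sup>2) \<partial>cube_measure n else 0)"
      by (cases "S' < t \<and> t < T'") (simp_all only: simp_thms if_True if_False norm_zero zero_power2
        ennreal_0 nn_integral_0_iff_AE nn_integral_const mult_zero_left)
  qed
  then have "AE t in time_interval S T. slice_sqn T n (coeff_ext S' T' f n) t \<le> ennreal ((a n)\<^sup>2)" for n
    using a(3)[of n] unfolding AE_time_interval by (auto elim!: eventually_mono)
  then show ?thesis unfolding volterra_coeffs_def
    using a(1,2) simplex_measurable_zero_ext[OF volterra_coeffs_measurable[OF f]] by (auto simp:
      coeff_ext_def)
qed

text \<open>Extension by zero is multiplicative: a point of the large simplex lies in the small one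
  exactly when, at any cut, both its head and its tail do.\<close>

lemma coeff_ext_conv:
  assumes t: "t \<in> simplex_pts (Suc n) S T"
  shows "coeff_conv (coeff_ext S' T' f) (coeff_ext S' T' g) n t = coeff_ext S' T' (coeff_conv f g) n t"
proof -
  have "tri_prod (n - k) k (coeff_ext S' T' f (n - k)) (coeff_ext S' T' g k) t
     = (if t \<in> simplex_pts (Suc n) S' T' then tri_prod (n - k) k (f (n - k)) (g k) t else 0)" if "k \<le> n" for k
  proof -
    have e: "n - k + k = n" using that by simp
    show ?thesis
      using head_pt_simplex[of t "n - k" k S' T'] tail_pt_simplex[of t "n - k" k S' T']
        head_tail_simplex[of t "n - k" k S T S' T'] t
      unfolding e by (auto simp: tri_prod_eq coeff_ext_def zero_ext_def
        bounded_bilinear.zero_left[OF bounded_bilinear_matrix_mult]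
          bounded_bilinear.zero_right[OF bounded_bilinear_matrix_mult])
  qed
  then show ?thesis by (simp add: coeff_conv_def coeff_ext_def zero_ext_def)
qed

lemma coeff_eq_ext:
  assumes "coeff_eq S' T' f g"
  shows "coeff_eq S T (coeff_ext S' T' f) (coeff_ext S' T' g)"
  unfolding coeff_eq_def AE_simplex
proof
  fix n
  have "AE t in cube_measure (Suc n). t \<in> simplex_pts (Suc n) S' T' \<longrightarrow> f n t = g n t"
    using assms by (simp add: coeff_eq_def AE_simplex)
  then show "AE t in cube_measure (Suc n). t \<in> simplex_pts (Suc n) S T \<longrightarrow> coeff_ext S' T' f n t =
    coeff_ext S' T' g n t"
    by eventually_elim (auto simp: coeff_ext_def zero_ext_def)
qed

definition is_resolvent_coeffs :: "real \<Rightarrow> real \<Rightarrow> (nat \<Rightarrow> (nat \<Rightarrow> real) \<Rightarrow> real^'d^'d) \<Rightarrow> (nat \<Rightarrow> (nat \<Rightarrow>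
  real) \<Rightarrow> real^'d^'d) \<Rightarrow> bool" where
  "is_resolvent_coeffs S T k r \<longleftrightarrow> volterra_coeffs S T r \<and>
     coeff_eq S T r (\<lambda>n t. k n t + coeff_conv k r n t) \<and> coeff_eq S T r (\<lambda>n t. k n t + coeff_conv r k n t)"

text \<open>Extension by zero respects sums and products, so the resolvent identities survive it.
  This places the resolvents of different subintervals in the one algebra over
  \<open>(S,T)\<close>.\<close>

lemma is_resolvent_coeffs_ext:
  assumes "is_resolvent_coeffs S' T' k r" "S \<le> S'" "T' \<le> T"
  shows "is_resolvent_coeffs S T (coeff_ext S' T' k) (coeff_ext S' T' r)"
proof -
  have *: "coeff_eq S T (coeff_ext S' T' r) (\<lambda>n t. coeff_ext S' T' k n t + coeff_conv (coeff_ext S'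
    T' f) (coeff_ext S' T' g) n t)"
    if "coeff_eq S' T' r (\<lambda>n t. k n t + coeff_conv f g n t)" for f g
  proof -
    have "coeff_eq S T (coeff_ext S' T' (\<lambda>n t. k n t + coeff_conv f g n t)) (\<lambda>n t. coeff_ext S' T' k
      n t + coeff_conv (coeff_ext S' T' f) (coeff_ext S' T' g) n t)"
      unfolding coeff_eq_def AE_simplex by (auto simp: coeff_ext_conv intro!: AE_I2) (auto simp:
        coeff_ext_def zero_ext_def)
    with coeff_eq_ext[OF that] show ?thesis by (rule coeff_eq_trans)
  qed
  show ?thesis using assms * volterra_coeffs_ext by (auto simp: is_resolvent_coeffs_def)
qed

text \<open>A coefficient behaves like a matrix entry whose row is its first, largest time and whose
  column is its last, smallest time. \<open>vanish_first\<close> says which rows are zero and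
  \<open>vanish_last\<close> says which columns are.\<close>

definition vanish_first :: "real \<Rightarrow> real \<Rightarrow> (real \<Rightarrow> bool) \<Rightarrow> (nat \<Rightarrow> (nat \<Rightarrow> real) \<Rightarrow> 'b::zero) \<Rightarrow> bool" where
  "vanish_first S T P f \<longleftrightarrow> (\<forall>n. \<forall>t\<in>simplex_pts (Suc n) S T. P (t 0) \<longrightarrow> f n t = 0)"

definition vanish_last :: "real \<Rightarrow> real \<Rightarrow> (real \<Rightarrow> bool) \<Rightarrow> (nat \<Rightarrow> (nat \<Rightarrow> real) \<Rightarrow> 'b::zero) \<Rightarrow> bool" where
  "vanish_last S T P f \<longleftrightarrow> (\<forall>n. \<forall>t\<in>simplex_pts (Suc n) S T. P (t n) \<longrightarrow> f n t = 0)"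

lemma coeff_conv_eq_0I:
  assumes "t \<in> simplex_pts (Suc n) S T"
    and "\<And>k. k \<le> n \<Longrightarrow> head_pt (n - k) t \<in> simplex_pts (Suc (n - k)) S T \<Longrightarrow> tail_pt (n - k) k t \<in>
      simplex_pts (Suc k) S T \<Longrightarrow>
      f (n - k) (head_pt (n - k) t) = 0 \<or> g k (tail_pt (n - k) k t) = 0"
  shows "coeff_conv f g n t = 0"
  unfolding coeff_conv_def
proof (rule sum.neutral, rule ballI)
  fix k assume k: "k \<in> {..n}"
  then have e: "n - k + k = n" by simp
  have "f (n - k) (head_pt (n - k) t) = 0 \<or> g k (tail_pt (n - k) k t) = 0"
    using assms(1) k head_pt_simplex[of t "n - k" k S T] tail_pt_simplex[of t "n - k" k S T]
      unfolding e by (intro assms(2)) auto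
  then show "tri_prod (n - k) k (f (n - k)) (g k) t = 0"
    by (auto simp: tri_prod_eq bounded_bilinear.zero_left[OF bounded_bilinear_matrix_mult]
          bounded_bilinear.zero_right[OF bounded_bilinear_matrix_mult])
qed

text \<open>The shared time is a column of the left factor and a row of the right one. If every time
  is excluded on one side or the other, each term of the product is zero.\<close>

lemma coeff_conv_vanish:
  assumes "vanish_last S T P f" "vanish_first S T Q g" "\<And>x. P x \<or> Q x" "t \<in> simplex_pts (Suc n) S T"
  shows "coeff_conv f g n t = 0"
proof (rule coeff_conv_eq_0I[OF assms(4)])
  fix k assume k: "k \<le> n" "head_pt (n - k) t \<in> simplex_pts (Suc (n - k)) S T" "tail_pt (n - k) k t \<in>
    simplex_pts (Suc k) S T"
  have "head_pt (n - k) t (n - k) = t (n - k)" "tail_pt (n - k) k t 0 = t (n - k)" by (auto simp: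
    head_pt_def tail_pt_def)
  then show "f (n - k) (head_pt (n - k) t) = 0 \<or> g k (tail_pt (n - k) k t) = 0"
    using assms(1,2) assms(3)[of "t (n - k)"] k by (auto simp: vanish_first_def vanish_last_def)
qed

lemma vanish_first_conv:
  assumes "vanish_first S T P f" shows "vanish_first S T P (coeff_conv f g)"
  unfolding vanish_first_def
proof (intro allI ballI impI)
  fix n t assume t: "t \<in> simplex_pts (Suc n) S T" "P (t 0)"
  show "coeff_conv f g n t = 0"
    by (rule coeff_conv_eq_0I[OF t(1)]) (use assms t in \<open>auto simp: vanish_first_def head_pt_def\<close>)
qed

lemma vanish_last_conv:
  assumes "vanish_last S T P g" shows "vanish_last S T P (coeff_conv f g)"
  unfolding vanish_last_def
proof (intro allI ballI impI)
  fix n t assume t: "t \<in> simplex_pts (Suc n) S T" "P (t n)"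
  show "coeff_conv f g n t = 0"
  proof (rule coeff_conv_eq_0I[OF t(1)])
    fix k assume k: "k \<le> n" "tail_pt (n - k) k t \<in> simplex_pts (Suc k) S T"
    have "tail_pt (n - k) k t k = t n" using k by (simp add: tail_pt_def)
    then show "f (n - k) (head_pt (n - k) t) = 0 \<or> g k (tail_pt (n - k) k t) = 0"
      using assms t k by (auto simp: vanish_last_def)
  qed
qed

lemma vanish_first_add: "vanish_first S T P f \<Longrightarrow> vanish_first S T P g \<Longrightarrow> vanish_first S T P (\<lambda>n t. f n
  t + g n t :: 'b::monoid_add)"
  by (auto simp: vanish_first_def)

lemma vanish_last_add: "vanish_last S T P f \<Longrightarrow> vanish_last S T P g \<Longrightarrow> vanish_last S T P (\<lambda>n t. f n t +
  g n t :: 'b::monoid_add)"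
  by (auto simp: vanish_last_def)

lemma simplex_last_le_first: "t \<in> simplex_pts (Suc n) S T \<Longrightarrow> t n \<le> t 0"
  by (cases n) (auto simp: simplex_pts_def less_imp_le)

text \<open>In the proof \<open>a\<close> and \<open>d\<close> are the diagonal blocks of the kernel cut at \<open>U\<close>, \<open>c\<close> is the
  off-diagonal one, and \<open>e = (1 + q) c (1 + p)\<close> is expanded because the algebra has no unit.\<close>

lemma resolvent_coeffs_glue:
  fixes k r1 r2 :: "nat \<Rightarrow> (nat \<Rightarrow> real) \<Rightarrow> real^'d^'d"
  assumes k: "volterra_coeffs S T k" and SU: "S < U" and UT: "U < T"
    and r1: "is_resolvent_coeffs S U k r1" and r2: "is_resolvent_coeffs U T k r2"
  shows "\<exists>r. is_resolvent_coeffs S T k r"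
proof -
  define a where "a = coeff_ext S U k"
  define p where "p = coeff_ext S U r1"
  define d where "d = coeff_ext U T k"
  define q where "q = coeff_ext U T r2"
  \<comment> \<open>The off-diagonal block takes the first time in \<open>[U, T)\<close> and the
    last in \<open>(S, U)\<close>. The diagonal blocks come from simplices over open intervals and
    hence exclude the time \<open>U\<close> altogether.\<close>
  define c where "c = (\<lambda>n t. if U \<le> t 0 \<and> t n < U then k n t else 0)"
  let ?D = "\<lambda>n. simplex_pts (Suc n) S T"
  have kSU: "volterra_coeffs S U k" and kUT: "volterra_coeffs U T k"
    using volterra_coeffs_mono[OF k] SU UT by auto
  have V: "volterra_coeffs S T a" "volterra_coeffs S T p" "volterra_coeffs S T d" "volterra_coeffs S T q"
    unfolding a_def p_def d_def q_def using kSU kUT r1 r2 SU UT by (auto intro!: volterra_coeffs_ext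
      simp: is_resolvent_coeffs_def)
  have Vc: "volterra_coeffs S T c"
  proof (rule volterra_coeffs_dominated[OF k])
    fix n
    have [measurable]: "(\<lambda>t. t i) \<in> borel_measurable (simplex_measure (Suc n) S T)" if "i < Suc n" for i
      unfolding simplex_measure_def using that by (intro measurable_restrict_space1
        measurable_component_singleton) auto
    have [measurable]: "k n \<in> borel_measurable (simplex_measure (Suc n) S T)" by (rule
      volterra_coeffs_measurable[OF k])
    show "c n \<in> borel_measurable (simplex_measure (Suc n) S T)"
      unfolding c_def by measurable
  qed (auto simp: c_def)
  have va: "vanish_first S T (\<lambda>x. U \<le> x) a" "vanish_first S T (\<lambda>x. U \<le> x) p"
    by (auto simp: vanish_first_def a_def p_def coeff_ext_def zero_ext_def) (auto simp: simplex_pts_def)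
  then have val: "vanish_last S T (\<lambda>x. U \<le> x) a" "vanish_last S T (\<lambda>x. U \<le> x) p"
    unfolding vanish_first_def vanish_last_def using simplex_last_le_first order_trans by meson+
  have vdl: "vanish_last S T (\<lambda>x. x \<le> U) d" "vanish_last S T (\<lambda>x. x \<le> U) q"
    by (auto simp: vanish_last_def d_def q_def coeff_ext_def zero_ext_def) (auto simp: simplex_pts_def)
  then have vd: "vanish_first S T (\<lambda>x. x < U) d" "vanish_first S T (\<lambda>x. x < U) q"
    unfolding vanish_first_def vanish_last_def using simplex_last_le_first order_trans less_imp_le by meson+
  have vc: "vanish_first S T (\<lambda>x. x < U) c" "vanish_last S T (\<lambda>x. U \<le> x) c"
    by (auto simp: vanish_first_def vanish_last_def c_def)
  let ?cp = "coeff_conv c p" and ?qc = "coeff_conv q c" and ?qcp = "coeff_conv (coeff_conv q c) p"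
  define e where "e = (\<lambda>n t. c n t + (?cp n t + (?qc n t + ?qcp n t)))"
  have Ve: "volterra_coeffs S T e"
    unfolding e_def by (intro volterra_coeffs_add volterra_coeffs_conv V Vc)
  have ve: "vanish_first S T (\<lambda>x. x < U) e" "vanish_last S T (\<lambda>x. U \<le> x) e"
    unfolding e_def by (intro vanish_first_add vanish_first_conv vanish_last_add vanish_last_conv vc vd val)+
  define r where "r = (\<lambda>n t. p n t + (q n t + e n t))"
  define k' where "k' = (\<lambda>n t. a n t + (c n t + d n t))"
  have Vr: "volterra_coeffs S T r" and Vk': "volterra_coeffs S T k'"
    unfolding r_def k'_def by (intro volterra_coeffs_add V Vc Ve)+
  have kk': "coeff_eq S T k k'"
    unfolding coeff_eq_def AE_simplex
  proof
    fix n
    \<comment> \<open>Points whose last time equals \<open>U\<close> belong to none of the three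
      blocks; they form a null set. A first time equal to \<open>U\<close> needs no exception, for
      then the point lies in \<open>c\<close> unless its last time is \<open>U\<close> too.\<close>
    have "AE t in lborel. (t::real) \<noteq> U" by (rule AE_lborel_singleton)
    from AE_cube_component[OF this, of n "Suc n"] have "AE t in cube_measure (Suc n). t n \<noteq> U" by simp
    then show "AE t in cube_measure (Suc n). t \<in> ?D n \<longrightarrow> k n t = k' n t"
    proof eventually_elim
      case (elim t)
      show ?case
      proof
        assume t: "t \<in> ?D n"
        have bd: "t i \<le> t 0" "t n \<le> t i" "S < t i" "t i < T" if "i < Suc n" for i
          using t that by (cases "i = 0"; cases "i = n"; auto simp: simplex_pts_def less_imp_le)+
        consider "t 0 < U" | "U \<le> t 0" "t n < U" | "U < t n" using elim by linarith
        then show "k n t = k' n t"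
        proof cases
          case 1
          then have "t \<in> simplex_pts (Suc n) S U" "t \<notin> simplex_pts (Suc n) U T"
            using t bd(1) by (force simp: simplex_pts_def)+
          then show ?thesis using 1 by (simp add: k'_def a_def c_def d_def coeff_ext_def zero_ext_def)
        next
          case 2
          then have "t \<notin> simplex_pts (Suc n) S U" "t \<notin> simplex_pts (Suc n) U T"
            by (force simp: simplex_pts_def)+
          then show ?thesis using 2 by (simp add: k'_def a_def c_def d_def coeff_ext_def zero_ext_def)
        next
          case 3
          then have "t \<notin> simplex_pts (Suc n) S U" "t \<in> simplex_pts (Suc n) U T"
            using t bd(1)[of n] bd(2) by (force simp: simplex_pts_def)+
          then show ?thesis using 3 by (simp add: k'_def a_def c_def d_def coeff_ext_def zero_ext_def)
        qed
      qed
    qed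
  qed
  \<comment> \<open>The products of blocks that vanish by their position. Of \<open>k' r\<close>
    this leaves \<open>a p\<close>, \<open>c p\<close>, \<open>d q\<close> and \<open>d e\<close>;
    of \<open>r k'\<close> it leaves \<open>p a\<close>, \<open>q c\<close>, \<open>q d\<close> and
    \<open>e a\<close>.\<close>
  have z: "coeff_conv a q n t = 0" "coeff_conv a e n t = 0" "coeff_conv c q n t = 0" "coeff_conv c e
    n t = 0" "coeff_conv d p n t = 0"
    "coeff_conv p c n t = 0" "coeff_conv p d n t = 0" "coeff_conv q a n t = 0" "coeff_conv e c n t =
      0" "coeff_conv e d n t = 0"
    if "t \<in> ?D n" for n t
    by (rule coeff_conv_vanish[OF _ _ _ that], (rule val vdl vc ve), (rule va vd vc ve), auto)+
  have pe: "coeff_eq S T p (\<lambda>n t. a n t + coeff_conv a p n t)" "coeff_eq S T p (\<lambda>n t. a n t +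
    coeff_conv p a n t)"
    and qe: "coeff_eq S T q (\<lambda>n t. d n t + coeff_conv d q n t)" "coeff_eq S T q (\<lambda>n t. d n t +
      coeff_conv q d n t)"
    using is_resolvent_coeffs_ext[OF r1, of S T] is_resolvent_coeffs_ext[OF r2, of S T] SU UT
    by (auto simp: is_resolvent_coeffs_def a_def p_def d_def q_def)
  note vconv = volterra_coeffs_conv and vadd = volterra_coeffs_add
  note Vap = vadd[OF V(1) vconv[OF V(2) V(1)]] and Vdq = vadd[OF V(3) vconv[OF V(3) V(4)]]
  note Vqc = vconv[OF V(4) Vc]
  note Vdc = vadd[OF vconv[OF V(3) Vc] vconv[OF V(3) Vqc]]
  note distr = coeff_conv_add_left[abs_def] coeff_conv_add_right[abs_def] coeff_conv_assoc[abs_def]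
  \<comment> \<open>For the identity with \<open>k' r\<close>, the equation
    \<open>q = d + d q\<close> is multiplied on the right by \<open>c\<close> and the result by
    \<open>p\<close>. This resolves the terms of \<open>e\<close> that begin with
    \<open>q\<close>.\<close>
  have qce: "coeff_eq S T ?qc (\<lambda>n t. coeff_conv d c n t + coeff_conv d ?qc n t)"
    using coeff_eq_conv[OF V(4) Vdq qe(1) Vc Vc coeff_eq_refl] by (simp add: distr)
  have qcpe: "coeff_eq S T ?qcp (\<lambda>n t. coeff_conv d ?cp n t + coeff_conv d ?qcp n t)"
    using coeff_eq_conv[OF Vqc Vdc qce V(2) V(2) coeff_eq_refl] by (simp add: distr)
  \<comment> \<open>For the identity with \<open>r k'\<close>, the equation
    \<open>p = a + p a\<close> is multiplied on the left by \<open>c\<close> and by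
    \<open>q c\<close>, which resolves the terms of \<open>e\<close> that end with
    \<open>p\<close>.\<close>
  have cpe: "coeff_eq S T ?cp (\<lambda>n t. coeff_conv c a n t + coeff_conv ?cp a n t)"
    using coeff_eq_conv[OF Vc Vc coeff_eq_refl V(2) Vap pe(2)] by (simp add: distr)
  have qcpe': "coeff_eq S T ?qcp (\<lambda>n t. coeff_conv ?qc a n t + coeff_conv ?qcp a n t)"
    using coeff_eq_conv[OF Vqc Vqc coeff_eq_refl V(2) Vap pe(2)] by (simp add: distr)
  have "coeff_eq S T r (\<lambda>n t. k' n t + coeff_conv k' r n t)"
    unfolding coeff_eq_def
  proof
    fix n
    have "AE t in simplex_measure (Suc n) S T. p n t = a n t + coeff_conv a p n t"
      "AE t in simplex_measure (Suc n) S T. q n t = d n t + coeff_conv d q n t"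
      "AE t in simplex_measure (Suc n) S T. ?qc n t = coeff_conv d c n t + coeff_conv d ?qc n t"
      "AE t in simplex_measure (Suc n) S T. ?qcp n t = coeff_conv d ?cp n t + coeff_conv d ?qcp n t"
      using pe(1) qe(1) qce qcpe by (simp_all add: coeff_eq_def)
    then show "AE t in simplex_measure (Suc n) S T. r n t = k' n t + coeff_conv k' r n t"
      using AE_space
    proof eventually_elim
      case (elim t)
      then have t: "t \<in> ?D n" by simp
      have "coeff_conv k' r n t = coeff_conv a p n t + coeff_conv c p n t + coeff_conv d q n t +
        coeff_conv d e n t"
        unfolding k'_def r_def coeff_conv_add_left coeff_conv_add_right using z[OF t] by simp
      also have "coeff_conv d e n t = coeff_conv d c n t + coeff_conv d ?cp n t + coeff_conv d ?qc n
        t + coeff_conv d ?qcp n t"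
        unfolding e_def coeff_conv_add_right by simp
      finally have kr: "coeff_conv k' r n t = coeff_conv a p n t + ?cp n t + coeff_conv d q n t +
        (coeff_conv d c n t + coeff_conv d ?cp n t + coeff_conv d ?qc n t + coeff_conv d ?qcp n t)" .
      show ?case unfolding kr unfolding r_def e_def k'_def using elim(1-4) by (simp add: algebra_simps)
    qed
  qed
  moreover have "coeff_eq S T r (\<lambda>n t. k' n t + coeff_conv r k' n t)"
    unfolding coeff_eq_def
  proof
    fix n
    have "AE t in simplex_measure (Suc n) S T. p n t = a n t + coeff_conv p a n t"
      "AE t in simplex_measure (Suc n) S T. q n t = d n t + coeff_conv q d n t"
      "AE t in simplex_measure (Suc n) S T. ?cp n t = coeff_conv c a n t + coeff_conv ?cp a n t"
      "AE t in simplex_measure (Suc n) S T. ?qcp n t = coeff_conv ?qc a n t + coeff_conv ?qcp a n t"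
      using pe(2) qe(2) cpe qcpe' by (simp_all add: coeff_eq_def)
    then show "AE t in simplex_measure (Suc n) S T. r n t = k' n t + coeff_conv r k' n t"
      using AE_space
    proof eventually_elim
      case (elim t)
      then have t: "t \<in> ?D n" by simp
      have "coeff_conv r k' n t = coeff_conv p a n t + ?qc n t + coeff_conv q d n t + coeff_conv e a n t"
        unfolding k'_def r_def coeff_conv_add_left coeff_conv_add_right using z[OF t] by simp
      also have "coeff_conv e a n t = coeff_conv c a n t + coeff_conv ?cp a n t + coeff_conv ?qc a n
        t + coeff_conv ?qcp a n t"
        unfolding e_def coeff_conv_add_left by simp
      finally have kr: "coeff_conv r k' n t = coeff_conv p a n t + ?qc n t + coeff_conv q d n t +
        (coeff_conv c a n t + coeff_conv ?cp a n t + coeff_conv ?qc a n t + coeff_conv ?qcp a n t)" .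
      show ?case unfolding kr unfolding r_def e_def k'_def using elim(1-4) by (simp add: algebra_simps)
    qed
  qed
  \<comment> \<open>The block sum \<open>k'\<close> equals \<open>k\<close> only off a null set, so
    replacing it inside the products rests on \<open>coeff_eq_conv\<close>.\<close>
  moreover have "coeff_eq S T (\<lambda>n t. k' n t + coeff_conv k' r n t) (\<lambda>n t. k n t + coeff_conv k r n t)"
    "coeff_eq S T (\<lambda>n t. k' n t + coeff_conv r k' n t) (\<lambda>n t. k n t + coeff_conv r k n t)"
    by (intro coeff_eq_add coeff_eq_conv Vr Vk' k coeff_eq_refl coeff_eq_sym[OF kk'])+
  ultimately have "is_resolvent_coeffs S T k r"
    unfolding is_resolvent_coeffs_def using Vr coeff_eq_trans by blast
  then show ?thesis by blast
qed

section \<open>Kernels and resolvents\<close>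

lemma norm_matrix_vector_mult_le: "norm (A *v x) \<le> norm (A::real^'n^'m) * norm x"
proof (rule power2_le_imp_le)
  have "(norm (A *v x))\<^sup>2 = (\<Sum>i\<in>UNIV. (\<Sum>j\<in>UNIV. A $ i $ j * x $ j)\<^sup>2)"
    by (simp add: norm_vec_def L2_set_def real_sqrt_pow2 sum_nonneg matrix_vector_mult_def)
  also have "\<dots> \<le> (\<Sum>i\<in>UNIV. (\<Sum>j\<in>UNIV. (A $ i $ j)\<^sup>2) * (\<Sum>j\<in>UNIV. (x $ j)\<^sup>2))"
    by (intro sum_mono Cauchy_Schwarz_ineq_sum)
  also have "\<dots> = (norm A * norm x)\<^sup>2"
    by (simp add: power_mult_distrib power2_norm_matrix sum_distrib_right[symmetric])
      (simp add: norm_vec_def L2_set_def real_sqrt_pow2 sum_nonneg)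
  finally show "(norm (A *v x))\<^sup>2 \<le> (norm A * norm x)\<^sup>2" .
qed simp

lemma op_norm_nonneg: "0 \<le> op_norm A"
  unfolding op_norm_def by (rule onorm_pos_le) simp

lemma op_norm_le_norm: "op_norm A \<le> norm A"
  unfolding op_norm_def by (rule onorm_le) (rule norm_matrix_vector_mult_le)

text \<open>Each of the \<open>CARD('d)\<close> squared many entries is at most the operator norm in
  absolute value; the root of their number gives the constant.\<close>

lemma norm_le_op_norm: "norm (A :: real^'d^'d) \<le> real CARD('d) * op_norm A"
proof (rule power2_le_imp_le)
  have "(A $ i $ j)\<^sup>2 \<le> (op_norm A)\<^sup>2" for i j
    using matrix_component_le_onorm[of A i j] by (intro abs_le_square_iff[THEN iffD1]) (simp add: op_norm_def)
  then have "(norm A)\<^sup>2 \<le> (\<Sum>i\<in>(UNIV::'d set). \<Sum>j\<in>(UNIV::'d set). (op_norm A)\<^sup>2)"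
    unfolding power2_norm_matrix by (intro sum_mono) auto
  then show "(norm A)\<^sup>2 \<le> (real CARD('d) * op_norm A)\<^sup>2"
    by (simp add: power_mult_distrib power2_eq_square mult_ac)
qed (simp add: op_norm_nonneg)

text \<open>The operator norm is continuous, being Lipschitz with constant 1 for the Frobenius
  norm.\<close>

lemma op_norm_measurable [measurable]: "op_norm \<in> borel_measurable borel"
proof (rule borel_measurable_continuous_onI)
  have le: "op_norm A \<le> op_norm B + norm (A - B)" for A B :: "real^'d^'d"
  proof -
    have "op_norm A = onorm (\<lambda>x. B *v x + (A - B) *v x)"
      by (simp add: op_norm_def matrix_vector_mult_add_rdistrib[symmetric])
    also have "\<dots> \<le> op_norm B + op_norm (A - B)"
      unfolding op_norm_def by (rule onorm_triangle) simp_all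
    finally show ?thesis using op_norm_le_norm[of "A - B"] by linarith
  qed
  have "\<bar>op_norm A - op_norm B\<bar> \<le> dist A B" for A B :: "real^'d^'d"
    using le[of A B] le[of B A] by (simp add: dist_norm norm_minus_commute abs_le_iff)
  then show "continuous_on UNIV (op_norm :: real^'d^'d \<Rightarrow> real)"
    unfolding continuous_on_iff dist_real_def by (metis dist_commute le_less_trans)
qed

lemma ennreal_sqrt_measurable [measurable]: "ennreal_sqrt \<in> borel_measurable borel"
  unfolding ennreal_sqrt_def[abs_def] by measurable

lemma ennreal_sqrt_le_iff: "0 \<le> c \<Longrightarrow> ennreal_sqrt x \<le> ennreal c \<longleftrightarrow> x \<le> ennreal (c\<^sup>2)"
proof (cases x)
  case (real r)
  assume "0 \<le> c"
  then have "sqrt r \<le> c \<longleftrightarrow> r \<le> c\<^sup>2" using real by (metis real_sqrt_le_iff real_sqrt_abs abs_of_nonneg)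
  with real \<open>0 \<le> c\<close> show ?thesis by (simp add: ennreal_sqrt_def)
qed (simp add: ennreal_sqrt_def top_unique)

text \<open>The case distinction in the norm disappears: for \<open>n = 0\<close> the slice is a
  squared point value, and the square root undoes the square.\<close>

lemma volterra_norm_eq:
  "volterra_norm S T n k = esssup (time_interval S T) (\<lambda>t. ennreal_sqrt (slice_sqn T n (\<lambda>x. op_norm
    (k x)) t))"
proof (cases "n = 0")
  case True
  then show ?thesis unfolding volterra_norm_def
    by (simp add: slice_sqn_0 op_norm_nonneg ennreal_sqrt_def)
next
  case False
  then show ?thesis unfolding volterra_norm_def slice_sqn_def sqn_def by simp
qed

lemma volterra_norm_measurable:
  assumes "k \<in> borel_measurable (simplex_measure (Suc n) S T)"
  shows "(\<lambda>t. ennreal_sqrt (slice_sqn T n (\<lambda>x. op_norm (k x)) t)) \<in> borel_measurable (time_interval S T)"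
proof -
  have "(\<lambda>x. op_norm (k x)) \<in> borel_measurable (simplex_measure (Suc n) S T)" using assms by measurable
  from slice_sqn_measurable[OF this] show ?thesis by measurable
qed

lemma volterra_norm_le:
  assumes k: "k \<in> borel_measurable (simplex_measure (Suc n) S T)" and c: "0 \<le> c"
    and le: "AE t in time_interval S T. slice_sqn T n k t \<le> ennreal (c\<^sup>2)"
  shows "volterra_norm S T n k \<le> ennreal c"
  unfolding volterra_norm_eq
proof (rule esssup_I[OF volterra_norm_measurable[OF k]])
  show "AE t in time_interval S T. ennreal_sqrt (slice_sqn T n (\<lambda>x. op_norm (k x)) t) \<le> ennreal c"
    using le
  proof eventually_elim
    case (elim t)
    have "slice_sqn T n (\<lambda>x. op_norm (k x)) t \<le> slice_sqn T n k t"
      unfolding slice_sqn_def sqn_def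
      by (intro nn_integral_mono ennreal_leI power_mono) (auto simp: op_norm_nonneg op_norm_le_norm)
    with elim show ?case using c by (simp add: ennreal_sqrt_le_iff)
  qed
qed

lemma slice_sqn_le_volterra_norm:
  fixes k :: "(nat \<Rightarrow> real) \<Rightarrow> real^'d^'d"
  assumes k: "k \<in> borel_measurable (simplex_measure (Suc n) S T)" and fin: "volterra_norm S T n k < \<infinity>"
  shows "AE t in time_interval S T. slice_sqn T n k t \<le> ennreal ((real CARD('d) * enn2real
    (volterra_norm S T n k))\<^sup>2)"
proof -
  define c where "c = enn2real (volterra_norm S T n k)"
  have c: "volterra_norm S T n k = ennreal c" "0 \<le> c" using fin by (auto simp: c_def less_top[symmetric])
  have "AE t in time_interval S T. ennreal_sqrt (slice_sqn T n (\<lambda>x. op_norm (k x)) t) \<le> ennreal c"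
    using esssup_AE[of "\<lambda>t. ennreal_sqrt (slice_sqn T n (\<lambda>x. op_norm (k x)) t)"  "time_interval S T"] c(1)
    unfolding volterra_norm_eq by simp
  then have "AE t in time_interval S T. slice_sqn T n k t \<le> ennreal ((real CARD('d) * c)\<^sup>2)"
    using AE_space
  proof eventually_elim
    case (elim t)
    then have t: "S < t" "t < T" by auto
    note m = simplex_measurable_snoc[OF k t]
    have "slice_sqn T n k t \<le> (\<integral>\<^sup>+ s. ennreal ((real CARD('d))\<^sup>2) * ennreal ((norm (op_norm (k
      (snoc_pt n s t))))\<^sup>2) \<partial>simplex_measure n t T)"
      unfolding slice_sqn_def sqn_def
    proof (rule nn_integral_mono)
      fix s
      have "(norm (k (snoc_pt n s t)))\<^sup>2 \<le> (real CARD('d) * op_norm (k (snoc_pt n s t)))\<^sup>2"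
        by (intro power_mono norm_le_op_norm) simp
      then show "ennreal ((norm (k (snoc_pt n s t)))\<^sup>2) \<le> ennreal ((real CARD('d))\<^sup>2) * ennreal
        ((norm (op_norm (k (snoc_pt n s t))))\<^sup>2)"
        by (simp add: ennreal_mult'[symmetric] power_mult_distrib ennreal_leI del: of_nat_power)
    qed
    also have "\<dots> = ennreal ((real CARD('d))\<^sup>2) * slice_sqn T n (\<lambda>x. op_norm (k x)) t"
      unfolding slice_sqn_def sqn_def by (rule nn_integral_cmult) (use m in measurable)
    also have "\<dots> \<le> ennreal ((real CARD('d))\<^sup>2) * ennreal (c\<^sup>2)"
      using elim(1) c(2) by (intro mult_left_mono) (simp_all add: ennreal_sqrt_le_iff)
    also have "\<dots> = ennreal ((real CARD('d) * c)\<^sup>2)"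
      by (simp add: ennreal_mult'[symmetric] power_mult_distrib del: of_nat_power)
    finally show ?case .
  qed
  then show ?thesis by (simp add: c_def)
qed

text \<open>Norm equivalence in both directions. Bounds on Frobenius slices dominate the operator
  norms directly, while the converse costs the factor \<open>CARD('d)\<close>.\<close>

lemma volterra_coeffs_iff:
  fixes f :: "nat \<Rightarrow> (nat \<Rightarrow> real) \<Rightarrow> real^'d^'d"
  shows "volterra_coeffs S T f \<longleftrightarrow> (\<forall>n. f n \<in> volterra_space S T n) \<and> (\<Sum>n. volterra_norm S T n (f n)) < \<infinity>"
proof
  assume f: "volterra_coeffs S T f"
  then obtain c where c: "\<And>n. 0 < c n" "summable c" "\<And>n. AE t in time_interval S T. slice_sqn T n (f
    n) t \<le> ennreal ((c n)\<^sup>2)"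
    by (auto simp: volterra_coeffs_def)
  note fm = volterra_coeffs_measurable[OF f]
  have le: "volterra_norm S T n (f n) \<le> ennreal (c n)" for n
    by (rule volterra_norm_le[OF fm less_imp_le[OF c(1)] c(3)])
  have "(\<Sum>n. volterra_norm S T n (f n)) \<le> (\<Sum>n. ennreal (c n))" by (intro suminf_le le) auto
  also have "\<dots> < \<infinity>" using c(1,2) by (simp add: suminf_ennreal2 less_imp_le)
  finally show "(\<forall>n. f n \<in> volterra_space S T n) \<and> (\<Sum>n. volterra_norm S T n (f n)) < \<infinity>"
    using fm le_less_trans[OF le] by (auto simp: volterra_space_def)
next
  assume h: "(\<forall>n. f n \<in> volterra_space S T n) \<and> (\<Sum>n. volterra_norm S T n (f n)) < \<infinity>"
  then have fm: "f n \<in> borel_measurable (simplex_measure (Suc n) S T)" and fin: "volterra_norm S T n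
    (f n) < \<infinity>" for n
    by (auto simp: volterra_space_def)
  define v where "v = (\<lambda>n. enn2real (volterra_norm S T n (f n)))"
  \<comment> \<open>The added geometric term makes the majorant strictly positive and keeps it
    summable.\<close>
  define c where "c = (\<lambda>n. real CARD('d) * v n + (1/2)^n)"
  have "summable v"
    unfolding v_def using h fin by (intro summable_suminf_not_top) (auto simp: less_top[symmetric])
  then have "summable c"
    unfolding c_def by (intro summable_add summable_mult summable_geometric) auto
  moreover have "0 < c n" for n by (simp add: c_def v_def add_nonneg_pos)
  moreover have "AE t in time_interval S T. slice_sqn T n (f n) t \<le> ennreal ((c n)\<^sup>2)" for n
    using slice_sqn_le_volterra_norm[OF fm fin, of n]
  proof eventually_elim
    case (elim t)
    have "(real CARD('d) * v n)\<^sup>2 \<le> (c n)\<^sup>2" by (intro power_mono) (auto simp: c_def v_def)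
    with elim show ?case unfolding v_def by (meson ennreal_leI order_trans)
  qed
  ultimately show "volterra_coeffs S T f" unfolding volterra_coeffs_def using fm by blast
qed

lemma is_resolvent_coeffs_cong:
  assumes r: "is_resolvent_coeffs S T k r" and k: "volterra_coeffs S T k" "volterra_coeffs S T k'"
    "coeff_eq S T k k'"
    and r': "volterra_coeffs S T r'" "coeff_eq S T r r'"
  shows "is_resolvent_coeffs S T k' r'"
proof -
  have V: "volterra_coeffs S T r" using r by (simp add: is_resolvent_coeffs_def)
  have "coeff_eq S T (\<lambda>n t. k n t + coeff_conv k r n t) (\<lambda>n t. k' n t + coeff_conv k' r' n t)"
    "coeff_eq S T (\<lambda>n t. k n t + coeff_conv r k n t) (\<lambda>n t. k' n t + coeff_conv r' k' n t)"
    by (intro coeff_eq_add coeff_eq_conv k r' V)+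
  then show ?thesis using r r' unfolding is_resolvent_coeffs_def
    by (meson coeff_eq_sym coeff_eq_trans)
qed

section \<open>From coefficient families back to kernels\<close>

context brownian
begin

lemma ae_equal_refl: "ae_equal M S T \<xi> \<xi>"
  by (simp add: ae_equal_def)

text \<open>The chosen coefficients agree almost everywhere with those of any other expansion,
  because both expand the same process.\<close>

lemma chaos_coeff_eq:
  assumes S: "0 \<le> S" "S \<le> T" and f: "has_chaos_expansion M W S T \<xi> f"
  shows "has_chaos_expansion M W S T \<xi> (chaos_coeff M W S T \<xi>)" "coeff_eq S T f (chaos_coeff M W S T \<xi>)"
proof -
  show c: "has_chaos_expansion M W S T \<xi> (chaos_coeff M W S T \<xi>)"
    unfolding chaos_coeff_def by (rule someI[of _ f]) (rule f)
  show "coeff_eq S T f (chaos_coeff M W S T \<xi>)"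
    using chaos_ae_equal_iff[OF S f c] ae_equal_refl by blast
qed

text \<open>The slice bound holds for almost every last time. Integrating it over the interval gives
  the factor \<open>T - S\<close> and a summable bound for \<open>chaos_exists\<close>, so the
  choice in \<open>from_chaos\<close> is meaningful.\<close>

lemma from_chaos_expansion:
  assumes S: "0 \<le> S" "S \<le> T" and f: "volterra_coeffs S T f"
  shows "has_chaos_expansion M W S T (from_chaos M W S T f) f"
proof -
  obtain c where c: "\<And>n. 0 < c n" "summable c" "\<And>n. AE t in time_interval S T. slice_sqn T n (f n) t
    \<le> ennreal ((c n)\<^sup>2)"
    using f by (auto simp: volterra_coeffs_def)
  note fm = volterra_coeffs_measurable[OF f]
  have "sqn (simplex_measure (Suc n) S T) (f n) \<le> ennreal ((T - S) * (c n)\<^sup>2)" for n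
  proof -
    have "sqn (simplex_measure (Suc n) S T) (f n) \<le> (\<integral>\<^sup>+ t. ennreal ((c n)\<^sup>2) \<partial>time_interval S T)"
      unfolding slice_sqn_integral[OF fm] by (rule nn_integral_mono_AE[OF c(3)])
    also have "\<dots> = ennreal ((c n)\<^sup>2) * ennreal (T - S)"
      unfolding nn_integral_time_interval using S by (simp add: nn_integral_cmult_indicator)
    finally show ?thesis using S by (simp add: ennreal_mult'[symmetric] mult.commute)
  qed
  \<comment> \<open>A summable positive sequence is eventually below 1, where squaring makes numbers
    smaller.\<close>
  moreover have "summable (\<lambda>n. (T - S) * (c n)\<^sup>2)"
  proof (rule summable_mult)
    have "\<forall>\<^sub>F n in sequentially. c n < 1" by (rule order_tendstoD(2)[OF summable_LIMSEQ_zero[OF c(2)]]) simp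
    then have "\<forall>\<^sub>F n in sequentially. norm ((c n)\<^sup>2) \<le> c n"
    proof eventually_elim
      case (elim n)
      then show ?case using c(1)[of n] mult_left_mono[of "c n" 1 "c n"] by (simp add: power2_eq_square)
    qed
    then show "summable (\<lambda>n. (c n)\<^sup>2)" by (rule summable_comparison_test_ev[OF _ c(2)])
  qed
  ultimately have "\<exists>\<xi>. has_chaos_expansion M W S T \<xi> f"
    by (rule chaos_exists[OF S fm]) (use S in simp)
  then show ?thesis unfolding from_chaos_def by (rule someI_ex)
qed

lemma star_kernelsD:
  assumes "K \<in> star_kernels M W S T"
  shows "has_chaos_expansion M W S T K (chaos_coeff M W S T K)" "volterra_coeffs S T (chaos_coeff M W S T K)"
  using assms by (simp_all add: star_kernels_def volterra_coeffs_iff)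

text \<open>Membership is stated for the chosen coefficients, but the condition is invariant under
  almost everywhere equality, so any expansion with Volterra coefficients will do.\<close>

lemma star_kernelsI:
  assumes S: "0 \<le> S" "S \<le> T" and f: "has_chaos_expansion M W S T R f" "volterra_coeffs S T f"
  shows "R \<in> star_kernels M W S T"
proof -
  note c = chaos_coeff_eq[OF S f(1)]
  have "volterra_coeffs S T (chaos_coeff M W S T R)"
    by (rule volterra_coeffs_cong[OF f(2) _ c(2)]) (use c(1) in \<open>auto simp: has_chaos_expansion_iff
      L2_simplex_iff\<close>)
  then show ?thesis using c(1) unfolding star_kernels_def volterra_coeffs_iff by (auto simp:
    has_chaos_expansion_iff)
qed

lemma star_expansion:
  assumes S: "0 \<le> S" "S \<le> T" and K: "K1 \<in> star_kernels M W S T" "K2 \<in> star_kernels M W S T"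
  shows "has_chaos_expansion M W S T (star M W S T K1 K2) (coeff_conv (chaos_coeff M W S T K1)
    (chaos_coeff M W S T K2))"
  using from_chaos_expansion[OF S volterra_coeffs_conv[OF star_kernelsD(2)[OF K(1)]
    star_kernelsD(2)[OF K(2)]]]
  by (simp add: star_def coeff_conv_def[abs_def])

lemma is_star_resolvent_iff:
  assumes S: "0 \<le> S" "S \<le> T" and K: "K \<in> star_kernels M W S T"
  shows "is_star_resolvent M W S T K R \<longleftrightarrow> R \<in> star_kernels M W S T \<and>
    is_resolvent_coeffs S T (chaos_coeff M W S T K) (chaos_coeff M W S T R)"
proof -
  have "ae_equal M S T R (\<lambda>t \<omega>. K t \<omega> + star M W S T K R t \<omega>) \<longleftrightarrow>
      coeff_eq S T (chaos_coeff M W S T R) (\<lambda>n t. chaos_coeff M W S T K n t + coeff_conv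
        (chaos_coeff M W S T K) (chaos_coeff M W S T R) n t)"
    "ae_equal M S T R (\<lambda>t \<omega>. K t \<omega> + star M W S T R K t \<omega>) \<longleftrightarrow>
      coeff_eq S T (chaos_coeff M W S T R) (\<lambda>n t. chaos_coeff M W S T K n t + coeff_conv
        (chaos_coeff M W S T R) (chaos_coeff M W S T K) n t)"
    if R: "R \<in> star_kernels M W S T"
    by (intro chaos_ae_equal_iff[OF S] has_chaos_add[OF S] star_kernelsD(1) star_expansion S K R)+
  then show ?thesis unfolding is_star_resolvent_def is_resolvent_coeffs_def using star_kernelsD(2) by blast
qed

text \<open>A resolvent family determines a process through \<open>from_chaos\<close>. Its chosen
  coefficients may differ from the family on null sets, which
  \<open>is_resolvent_coeffs_cong\<close> absorbs.\<close>

lemma ex_star_resolvent_iff: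
  assumes S: "0 \<le> S" "S \<le> T" and K: "K \<in> star_kernels M W S T"
  shows "(\<exists>R. is_star_resolvent M W S T K R) \<longleftrightarrow> (\<exists>r. is_resolvent_coeffs S T (chaos_coeff M W S T K) r)"
proof
  assume "\<exists>r. is_resolvent_coeffs S T (chaos_coeff M W S T K) r"
  then obtain r where r: "is_resolvent_coeffs S T (chaos_coeff M W S T K) r" by blast
  then have V: "volterra_coeffs S T r" by (simp add: is_resolvent_coeffs_def)
  let ?R = "from_chaos M W S T r"
  have h: "has_chaos_expansion M W S T ?R r" by (rule from_chaos_expansion[OF S V])
  have R: "?R \<in> star_kernels M W S T" by (rule star_kernelsI[OF S h V])
  have "is_resolvent_coeffs S T (chaos_coeff M W S T K) (chaos_coeff M W S T ?R)"
    by (rule is_resolvent_coeffs_cong[OF r star_kernelsD(2)[OF K] star_kernelsD(2)[OF K] coeff_eq_refl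
          star_kernelsD(2)[OF R] chaos_coeff_eq(2)[OF S h]])
  then show "\<exists>R. is_star_resolvent M W S T K R" using is_star_resolvent_iff[OF S K] R by blast
qed (use is_star_resolvent_iff[OF S K] in blast)

text \<open>The restricted kernel passes through two choices, a process with the restricted
  coefficients and then coefficients of that process. Uniqueness returns the original coefficients
  up to null sets of the small simplex.\<close>

lemma restrict_kernel_star_kernels:
  assumes S: "0 \<le> S" "S \<le> U" "U \<le> V" "V \<le> T" and K: "K \<in> star_kernels M W S T"
  shows "restrict_kernel M W S T U V K \<in> star_kernels M W U V"
    "coeff_eq U V (chaos_coeff M W U V (restrict_kernel M W S T U V K)) (chaos_coeff M W S T K)"
proof -
  let ?k = "chaos_coeff M W S T K"
  let ?f = "\<lambda>n. restrict (?k n) (simplex_pts (Suc n) U V)"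
  have V: "volterra_coeffs U V ?k" by (rule volterra_coeffs_mono[OF star_kernelsD(2)[OF K] S(2,4)])
  have UV: "0 \<le> U" "U \<le> V" using S by auto
  have eq: "coeff_eq U V ?f ?k" unfolding coeff_eq_def by (auto intro: AE_I2)
  have "?f n \<in> borel_measurable (simplex_measure (Suc n) U V)" for n
    using volterra_coeffs_measurable[OF V, of n] by (subst measurable_cong[of _ _ "?k n"]) auto
  then have f: "volterra_coeffs U V ?f" by (rule volterra_coeffs_cong[OF V _ coeff_eq_sym[OF eq]])
  have h: "has_chaos_expansion M W U V (restrict_kernel M W S T U V K) ?f"
    unfolding restrict_kernel_def by (rule from_chaos_expansion[OF UV f])
  show "restrict_kernel M W S T U V K \<in> star_kernels M W U V" by (rule star_kernelsI[OF UV h f])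
  show "coeff_eq U V (chaos_coeff M W U V (restrict_kernel M W S T U V K)) ?k"
    using coeff_eq_sym[OF chaos_coeff_eq(2)[OF UV h]] eq by (rule coeff_eq_trans)
qed

end

theorem theorem5p4:
  fixes M :: "'w measure" and W :: "real \<Rightarrow> 'w \<Rightarrow> real"
    and S T :: real and K :: "real \<Rightarrow> 'w \<Rightarrow> real^'d^'d"
    and m :: nat and U :: "nat \<Rightarrow> real"
  assumes "prob_space M" and "complete_measure M" and "brownian_motion M W"
    and "0 \<le> S" and "S < T"
    and "K \<in> star_kernels M W S T"
    and "m \<ge> 1" and "U 0 = S" and "U m = T" and "\<forall>k<m. U k < U (Suc k)"
    and "\<forall>k<m. \<exists>R. is_star_resolvent M W (U k) (U (Suc k))
                        (restrict_kernel M W S T (U k) (U (Suc k)) K) R"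
  shows "\<exists>R. is_star_resolvent M W S T K R"
proof -
  interpret prob_space M by fact
  interpret brownian M W by unfold_locales fact
  let ?k = "chaos_coeff M W S T K"
  have V: "volterra_coeffs S T ?k" by (rule star_kernelsD(2)[OF assms(6)])
  have mono: "U i \<le> U j" if "i \<le> j" "j \<le> m" for i j
    using that
  proof (induction rule: dec_induct)
    case (step n)
    then show ?case using assms(10) by (meson Suc_leD Suc_le_lessD less_imp_le order_trans)
  qed simp
  \<comment> \<open>The hypothesis concerns coefficients chosen anew on each subinterval. It is
    moved to the fixed family \<open>?k\<close>, so that neighbouring pieces can be glued for one
    and the same kernel.\<close>
  have piece: "\<exists>r. is_resolvent_coeffs (U k) (U (Suc k)) ?k r" if k: "k < m" for k
  proof -
    have b: "0 \<le> U k" "S \<le> U k" "U k \<le> U (Suc k)" "U (Suc k) \<le> T"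
      using mono[of 0 k] mono[of k "Suc k"] mono[of "Suc k" m] assms k by auto
    note R = restrict_kernel_star_kernels[OF assms(4) b(2,3,4) assms(6)]
    obtain r where r: "is_resolvent_coeffs (U k) (U (Suc k)) (chaos_coeff M W (U k) (U (Suc k))
      (restrict_kernel M W S T (U k) (U (Suc k)) K)) r"
      using ex_star_resolvent_iff[OF b(1,3) R(1)] assms(11) k by blast
    have "is_resolvent_coeffs (U k) (U (Suc k)) ?k r"
      by (rule is_resolvent_coeffs_cong[OF r star_kernelsD(2)[OF R(1)] volterra_coeffs_mono[OF V
        b(2,4)] R(2) _ coeff_eq_refl])
        (use r in \<open>simp add: is_resolvent_coeffs_def\<close>)
    then show ?thesis by blast
  qed
  \<comment> \<open>The interval grows to the right, from \<open>S\<close> to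
    \<open>U (Suc j)\<close>, and each step glues at \<open>U (Suc j)\<close>. Starting at one piece
    rather than at an empty interval matches \<open>m \<ge> 1\<close>.\<close>
  have "Suc j \<le> m \<Longrightarrow> \<exists>r. is_resolvent_coeffs S (U (Suc j)) ?k r" for j
  proof (induction j)
    case 0
    then show ?case using piece[of 0] assms(8) by simp
  next
    case (Suc j)
    then obtain r1 where r1: "is_resolvent_coeffs S (U (Suc j)) ?k r1" by auto
    obtain r2 where r2: "is_resolvent_coeffs (U (Suc j)) (U (Suc (Suc j))) ?k r2" using piece[of
      "Suc j"] Suc.prems by auto
    have "S < U (Suc j)" using mono[of 0 j] assms(8,10) Suc.prems by (metis Suc_leD Suc_le_lessD le0
      le_less_trans)
    moreover have "U (Suc j) < U (Suc (Suc j))" using assms(10) Suc.prems by auto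
    moreover have "volterra_coeffs S (U (Suc (Suc j))) ?k"
      by (rule volterra_coeffs_mono[OF V]) (use mono[of "Suc (Suc j)" m] assms(9) Suc.prems in auto)
    ultimately show ?case using resolvent_coeffs_glue r1 r2 by blast
  qed
  from this[of "m - 1"] have "\<exists>r. is_resolvent_coeffs S T ?k r" using assms(7,9) by simp
  then show ?thesis using ex_star_resolvent_iff[OF assms(4) less_imp_le[OF assms(5)] assms(6)] by blast
qed

end
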